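(* Let $F$ be a field, let $X$ be a finite category, let $R\in\mathrm{rep}(X,\mathbf{vect}_F)$, and let $F'$ be any field extension of $F$. Then $R$ is additively $\mathbf{Set}$-realizable (over $F$) if and only if $R\otimes_F F'\in\mathrm{rep}(X,\mathbf{vect}_{F'})$ is additively $\mathbf{Set}$-realizable (over $F'$).
   Context: For a small category $X$ and a category $C$, $\mathrm{rep}(X,C)$ is the category of functors $X\to C$. For a field $K$, $\mathbf{Vect}_K$ (resp. $\mathbf{vect}_K$) is the category of (finite-dimensional) $K$-vector spaces. $R\otimes_F F'$ is the composition of $R$ with $-\otimes_F F'$. $\mathtt{free}\colon\mathbf{Set}\to\mathbf{Vect}_K$ sends a set to the free $K$-vector space on it, and $\mathtt{free}_*(S)=\mathtt{free}\circ S$ for $S\in\mathrm{rep}(X,\mathbf{Set})$. A representation in $\mathrm{rep}(X,\mathbf{Vect}_K)$ is additively $\mathbf{Set}$-realizable (over $K$) if it lies in the additive image of $\mathtt{free}_*\colon\mathrm{rep}(X,\mathbf{Set})\to\mathrm{rep}(X,\mathbf{Vect}_K)$, i.e. if it is a finite direct sum of direct summands of representations isomorphic to some $\mathtt{free}\circ S$. *)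

theory Defs
  imports "HOL-Algebra.AbelCoset" "Jordan_Normal_Form.Missing_VectorSpace"
begin

section \<open>Finite categories\<close>

record ('o, 'm) category =
  Obj :: "'o set"
  Mor :: "'m set"
  Dom :: "'m \<Rightarrow> 'o"
  Cod :: "'m \<Rightarrow> 'o"
  Id  :: "'o \<Rightarrow> 'm"
  Comp :: "'m \<Rightarrow> 'm \<Rightarrow> 'm"  (infixl \<open>\<cdot>\<index>\<close> 70)

text \<open>\<open>g \<cdot> f\<close> is \<open>g\<close> after \<open>f\<close>; it is meaningful only if \<open>Dom g = Cod f\<close>.\<close>

locale category =
  fixes X :: "('o, 'm) category" (structure)
  assumes Dom_in: "f \<in> Mor X \<Longrightarrow> Dom X f \<in> Obj X"
    and Cod_in: "f \<in> Mor X \<Longrightarrow> Cod X f \<in> Obj X"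
    and Id_in: "x \<in> Obj X \<Longrightarrow> Id X x \<in> Mor X"
    and Dom_Id: "x \<in> Obj X \<Longrightarrow> Dom X (Id X x) = x"
    and Cod_Id: "x \<in> Obj X \<Longrightarrow> Cod X (Id X x) = x"
    and Comp_in: "\<lbrakk>f \<in> Mor X; g \<in> Mor X; Dom X g = Cod X f\<rbrakk> \<Longrightarrow> g \<cdot> f \<in> Mor X"
    and Dom_Comp: "\<lbrakk>f \<in> Mor X; g \<in> Mor X; Dom X g = Cod X f\<rbrakk> \<Longrightarrow> Dom X (g \<cdot> f) = Dom X f"
    and Cod_Comp: "\<lbrakk>f \<in> Mor X; g \<in> Mor X; Dom X g = Cod X f\<rbrakk> \<Longrightarrow> Cod X (g \<cdot> f) = Cod X g"
    and Comp_Id_right: "f \<in> Mor X \<Longrightarrow> f \<cdot> Id X (Dom X f) = f"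
    and Comp_Id_left: "f \<in> Mor X \<Longrightarrow> Id X (Cod X f) \<cdot> f = f"
    and Comp_assoc: "\<lbrakk>f \<in> Mor X; g \<in> Mor X; h \<in> Mor X; Dom X g = Cod X f; Dom X h = Cod X g\<rbrakk>
      \<Longrightarrow> (h \<cdot> g) \<cdot> f = h \<cdot> (g \<cdot> f)"

locale finite_category = category +
  assumes finite_Obj: "finite (Obj X)"
    and finite_Mor: "finite (Mor X)"


section \<open>Representations in sets and in vector spaces\<close>

record ('o, 'm, 's) set_functor =
  SObj :: "'o \<Rightarrow> 's set"
  SMor :: "'m \<Rightarrow> 's \<Rightarrow> 's"

locale set_rep = category X for X :: "('o, 'm) category" (structure) +
  fixes S :: "('o, 'm, 's) set_functor"
  assumes SMor_in: "f \<in> Mor X \<Longrightarrow> SMor S f \<in> SObj S (Dom X f) \<rightarrow> SObj S (Cod X f)"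
    and SMor_Id: "\<lbrakk>x \<in> Obj X; s \<in> SObj S x\<rbrakk> \<Longrightarrow> SMor S (Id X x) s = s"
    and SMor_Comp: "\<lbrakk>f \<in> Mor X; g \<in> Mor X; Dom X g = Cod X f; s \<in> SObj S (Dom X f)\<rbrakk>
      \<Longrightarrow> SMor S (g \<cdot> f) s = SMor S g (SMor S f s)"

record ('o, 'm, 'k, 'v) vect_functor =
  VObj :: "'o \<Rightarrow> ('k, 'v) module"
  VMor :: "'m \<Rightarrow> 'v \<Rightarrow> 'v"

locale vect_rep = category X + field K
  for X :: "('o, 'm) category" (structure) and K :: "('k, 'l) ring_scheme" +
  fixes R :: "('o, 'm, 'k, 'v) vect_functor"
  assumes VObj_vectorspace: "x \<in> Obj X \<Longrightarrow> vectorspace K (VObj R x)"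
    and VMor_hom: "f \<in> Mor X \<Longrightarrow>
      VMor R f \<in> LinearCombinations.module_hom K (VObj R (Dom X f)) (VObj R (Cod X f))"
    and VMor_Id: "\<lbrakk>x \<in> Obj X; v \<in> carrier (VObj R x)\<rbrakk> \<Longrightarrow> VMor R (Id X x) v = v"
    and VMor_Comp: "\<lbrakk>f \<in> Mor X; g \<in> Mor X; Dom X g = Cod X f; v \<in> carrier (VObj R (Dom X f))\<rbrakk>
      \<Longrightarrow> VMor R (g \<cdot> f) v = VMor R g (VMor R f v)"

locale fin_dim_vect_rep = vect_rep +
  assumes VObj_fin_dim: "x \<in> Obj X \<Longrightarrow> vectorspace.fin_dim K (VObj R x)"

definition rep_isomorphic ::
  "('o, 'm) category \<Rightarrow> ('k, 'l) ring_scheme \<Rightarrow>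
   ('o, 'm, 'k, 'v) vect_functor \<Rightarrow> ('o, 'm, 'k, 'w) vect_functor \<Rightarrow> bool"
  where "rep_isomorphic X K R R' \<longleftrightarrow>
    (\<exists>\<eta>. (\<forall>x\<in>Obj X. \<eta> x \<in> LinearCombinations.module_hom K (VObj R x) (VObj R' x) \<and>
              bij_betw (\<eta> x) (carrier (VObj R x)) (carrier (VObj R' x))) \<and>
         (\<forall>f\<in>Mor X. \<forall>v\<in>carrier (VObj R (Dom X f)).
              \<eta> (Cod X f) (VMor R f v) = VMor R' f (\<eta> (Dom X f) v)))"

definition rep_plus ::
  "('o, 'm, 'k, 'v) vect_functor \<Rightarrow> ('o, 'm, 'k, 'w) vect_functor \<Rightarrow>
   ('o, 'm, 'k, 'v \<times> 'w) vect_functor"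
  where "rep_plus R R' =
    \<lparr>VObj = (\<lambda>x. direct_sum (VObj R x) (VObj R' x)),
     VMor = (\<lambda>f. map_prod (VMor R f) (VMor R' f))\<rparr>"

text \<open>Direct sums of a finite family; as the index set is only ever finite, the carrier is the full
  product. As in \<^const>\<open>direct_sum\<close>, the multiplicative fields of the record are irrelevant.\<close>

definition vs_sum :: "'i set \<Rightarrow> ('i \<Rightarrow> ('k, 'v) module) \<Rightarrow> ('k, 'i \<Rightarrow> 'v) module"
  where "vs_sum I M =
    \<lparr>carrier = (\<Pi>\<^sub>E i\<in>I. carrier (M i)),
     mult = (\<lambda>v w. \<lambda>i\<in>I. \<zero>\<^bsub>M i\<^esub>),
     one = (\<lambda>i\<in>I. \<zero>\<^bsub>M i\<^esub>),
     zero = (\<lambda>i\<in>I. \<zero>\<^bsub>M i\<^esub>),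
     add = (\<lambda>v w. \<lambda>i\<in>I. v i \<oplus>\<^bsub>M i\<^esub> w i),
     smult = (\<lambda>c v. \<lambda>i\<in>I. c \<odot>\<^bsub>M i\<^esub> v i)\<rparr>"

definition rep_sum ::
  "'i set \<Rightarrow> ('i \<Rightarrow> ('o, 'm, 'k, 'v) vect_functor) \<Rightarrow> ('o, 'm, 'k, 'i \<Rightarrow> 'v) vect_functor"
  where "rep_sum I D =
    \<lparr>VObj = (\<lambda>x. vs_sum I (\<lambda>i. VObj (D i) x)),
     VMor = (\<lambda>f v. \<lambda>i\<in>I. VMor (D i) f (v i))\<rparr>"

text \<open>A direct summand and its complement embed into the ambient representation, so taking all
  three in the same type loses no generality up to isomorphism.\<close>

definition direct_summand ::
  "('o, 'm) category \<Rightarrow> ('k, 'l) ring_scheme \<Rightarrow>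
   ('o, 'm, 'k, 'v) vect_functor \<Rightarrow> ('o, 'm, 'k, 'v) vect_functor \<Rightarrow> bool"
  where "direct_summand X K D N \<longleftrightarrow>
    vect_rep X K D \<and> (\<exists>E :: ('o, 'm, 'k, 'v) vect_functor.
      vect_rep X K E \<and> rep_isomorphic X K N (rep_plus D E))"


section \<open>Free vector spaces and additive realizability\<close>

definition free_vs :: "('k, 'l) ring_scheme \<Rightarrow> 's set \<Rightarrow> ('k, 's \<Rightarrow> 'k) module"
  where "free_vs K A =
    (ring.func_space K A)\<lparr>carrier := {c \<in> A \<rightarrow>\<^sub>E carrier K. finite {a \<in> A. c a \<noteq> \<zero>\<^bsub>K\<^esub>}}\<rparr>"

definition free_gen :: "('k, 'l) ring_scheme \<Rightarrow> 's set \<Rightarrow> 's \<Rightarrow> 's \<Rightarrow> 'k"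
  where "free_gen K A a = (\<lambda>x\<in>A. if x = a then \<one>\<^bsub>K\<^esub> else \<zero>\<^bsub>K\<^esub>)"

text \<open>The linear map \<open>free A \<rightarrow> free B\<close> that sends the generator of \<open>a\<close> to the one of \<open>h a\<close>.\<close>

definition free_map ::
  "('k, 'l) ring_scheme \<Rightarrow> 's set \<Rightarrow> 't set \<Rightarrow> ('s \<Rightarrow> 't) \<Rightarrow> ('s \<Rightarrow> 'k) \<Rightarrow> ('t \<Rightarrow> 'k)"
  where "free_map K A B h c = (\<lambda>b\<in>B. \<Oplus>\<^bsub>K\<^esub>a\<in>{a \<in> A. h a = b \<and> c a \<noteq> \<zero>\<^bsub>K\<^esub>}. c a)"

definition free_rep ::
  "('o, 'm) category \<Rightarrow> ('k, 'l) ring_scheme \<Rightarrow> ('o, 'm, 's) set_functor \<Rightarrow>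
   ('o, 'm, 'k, 's \<Rightarrow> 'k) vect_functor"
  where "free_rep X K S =
    \<lparr>VObj = (\<lambda>x. free_vs K (SObj S x)),
     VMor = (\<lambda>f. free_map K (SObj S (Dom X f)) (SObj S (Cod X f)) (SMor S f))\<rparr>"

text \<open>HOL cannot quantify over types inside a formula, so the type \<open>'s\<close> from which the sets
  \<open>S x\<close> are drawn (the universe of \<open>Set\<close>) is a parameter. For it to play that role it should be infinite:
  a finite type would bound the size of all sets \<open>S x\<close>.\<close>

definition additively_set_realizable ::
  "'s itself \<Rightarrow> ('o, 'm) category \<Rightarrow> ('k, 'l) ring_scheme \<Rightarrow>
   ('o, 'm, 'k, 'v) vect_functor \<Rightarrow> bool"
  where "additively_set_realizable (U :: 's itself) X K R \<longleftrightarrow>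
    (\<exists>(n :: nat)
      (S :: nat \<Rightarrow> ('o, 'm, 's) set_functor)
      (N :: nat \<Rightarrow> ('o, 'm, 'k, 's \<Rightarrow> 'k) vect_functor)
      (D :: nat \<Rightarrow> ('o, 'm, 'k, 's \<Rightarrow> 'k) vect_functor).
      (\<forall>i<n. set_rep X (S i) \<and>
             vect_rep X K (N i) \<and> rep_isomorphic X K (N i) (free_rep X K (S i)) \<and>
             direct_summand X K (D i) (N i)) \<and>
      rep_isomorphic X K R (rep_sum {..<n} D))"


section \<open>Tensor products and extension of scalars\<close>

definition quotient_vs :: "('k, 'v, 'z) module_scheme \<Rightarrow> 'v set \<Rightarrow> ('k, 'v set) module"
  where "quotient_vs P N =
    \<lparr>carrier = a_rcosets\<^bsub>P\<^esub> N, mult = (\<lambda>C D. N), one = N, zero = N,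
     add = (\<lambda>C D. C <+>\<^bsub>P\<^esub> D),
     smult = (\<lambda>c C. \<Union>z\<in>C. N +>\<^bsub>P\<^esub> (c \<odot>\<^bsub>P\<^esub> z))\<rparr>"

text \<open>\<open>V \<otimes> W\<close> is the quotient of the free space on \<open>V \<times> W\<close> by the bilinearity relations.\<close>

definition tensor_free ::
  "('k, 'l) ring_scheme \<Rightarrow> ('k, 'v) module \<Rightarrow> ('k, 'w) module \<Rightarrow> ('k, 'v \<times> 'w \<Rightarrow> 'k) module"
  where "tensor_free K V W = free_vs K (carrier V \<times> carrier W)"

definition tensor_relators ::
  "('k, 'l) ring_scheme \<Rightarrow> ('k, 'v) module \<Rightarrow> ('k, 'w) module \<Rightarrow> ('v \<times> 'w \<Rightarrow> 'k) set"
  where "tensor_relators K V W =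
    (let P = tensor_free K V W; e = (\<lambda>v w. free_gen K (carrier V \<times> carrier W) (v, w)) in
      {e (v \<oplus>\<^bsub>V\<^esub> v') w \<ominus>\<^bsub>P\<^esub> (e v w \<oplus>\<^bsub>P\<^esub> e v' w) | v v' w.
         v \<in> carrier V \<and> v' \<in> carrier V \<and> w \<in> carrier W} \<union>
      {e v (w \<oplus>\<^bsub>W\<^esub> w') \<ominus>\<^bsub>P\<^esub> (e v w \<oplus>\<^bsub>P\<^esub> e v w') | v w w'.
         v \<in> carrier V \<and> w \<in> carrier W \<and> w' \<in> carrier W} \<union>
      {e (c \<odot>\<^bsub>V\<^esub> v) w \<ominus>\<^bsub>P\<^esub> c \<odot>\<^bsub>P\<^esub> e v w | c v w.
         c \<in> carrier K \<and> v \<in> carrier V \<and> w \<in> carrier W} \<union>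
      {e v (c \<odot>\<^bsub>W\<^esub> w) \<ominus>\<^bsub>P\<^esub> c \<odot>\<^bsub>P\<^esub> e v w | c v w.
         c \<in> carrier K \<and> v \<in> carrier V \<and> w \<in> carrier W})"

definition tensor_null ::
  "('k, 'l) ring_scheme \<Rightarrow> ('k, 'v) module \<Rightarrow> ('k, 'w) module \<Rightarrow> ('v \<times> 'w \<Rightarrow> 'k) set"
  where "tensor_null K V W =
    LinearCombinations.module.span K (tensor_free K V W) (tensor_relators K V W)"

definition tensor ::
  "('k, 'l) ring_scheme \<Rightarrow> ('k, 'v) module \<Rightarrow> ('k, 'w) module \<Rightarrow>
   ('k, ('v \<times> 'w \<Rightarrow> 'k) set) module"
  where "tensor K V W = quotient_vs (tensor_free K V W) (tensor_null K V W)"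

text \<open>\<open>f \<otimes> g\<close>. An element \<open>C\<close> of \<open>V \<otimes> W\<close> is a coset; for linear \<open>f\<close> and \<open>g\<close> all cosets in the union
  below are equal.\<close>

definition tensor_map ::
  "('k, 'l) ring_scheme \<Rightarrow> ('k, 'v) module \<Rightarrow> ('k, 'w) module \<Rightarrow>
   ('k, 'v') module \<Rightarrow> ('k, 'w') module \<Rightarrow> ('v \<Rightarrow> 'v') \<Rightarrow> ('w \<Rightarrow> 'w') \<Rightarrow>
   ('v \<times> 'w \<Rightarrow> 'k) set \<Rightarrow> ('v' \<times> 'w' \<Rightarrow> 'k) set"
  where "tensor_map K V W V' W' f g C =
    (\<Union>z\<in>C. tensor_null K V' W' +>\<^bsub>tensor_free K V' W'\<^esub>
       free_map K (carrier V \<times> carrier W) (carrier V' \<times> carrier W') (map_prod f g) z)"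

text \<open>A field extension of \<open>F\<close> is a field \<open>F'\<close> with a (necessarily injective) ring homomorphism
  \<open>\<phi> : F \<rightarrow> F'\<close>; it makes \<open>F'\<close> an \<open>F\<close>-vector space.\<close>

definition ext_as_vs ::
  "('g, 'l) ring_scheme \<Rightarrow> ('f \<Rightarrow> 'g) \<Rightarrow> ('f, 'g) module"
  where "ext_as_vs F' \<phi> =
    \<lparr>carrier = carrier F', mult = mult F', one = one F', zero = zero F', add = add F',
     smult = (\<lambda>a b. \<phi> a \<otimes>\<^bsub>F'\<^esub> b)\<rparr>"

text \<open>\<open>V \<otimes>\<^sub>F F'\<close> as an \<open>F'\<close>-vector space: \<open>c\<close> in \<open>F'\<close> acts by \<open>id \<otimes> (c \<cdot> _)\<close>.\<close>

definition ext_scalars ::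
  "('f, 'l) ring_scheme \<Rightarrow> ('g, 'l') ring_scheme \<Rightarrow> ('f \<Rightarrow> 'g) \<Rightarrow> ('f, 'v) module \<Rightarrow>
   ('g, ('v \<times> 'g \<Rightarrow> 'f) set) module"
  where "ext_scalars F F' \<phi> V =
    (let E = ext_as_vs F' \<phi>; T = tensor F V E in
      \<lparr>carrier = carrier T, mult = mult T, one = one T, zero = zero T, add = add T,
       smult = (\<lambda>c. tensor_map F V E V E id (\<lambda>b. c \<otimes>\<^bsub>F'\<^esub> b))\<rparr>)"

definition rep_ext_scalars ::
  "('o, 'm) category \<Rightarrow> ('f, 'l) ring_scheme \<Rightarrow> ('g, 'l') ring_scheme \<Rightarrow> ('f \<Rightarrow> 'g) \<Rightarrow>
   ('o, 'm, 'f, 'v) vect_functor \<Rightarrow> ('o, 'm, 'g, ('v \<times> 'g \<Rightarrow> 'f) set) vect_functor"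
  where "rep_ext_scalars X F F' \<phi> R =
    (let E = ext_as_vs F' \<phi> in
      \<lparr>VObj = (\<lambda>x. ext_scalars F F' \<phi> (VObj R x)),
       VMor = (\<lambda>f. tensor_map F (VObj R (Dom X f)) E (VObj R (Cod X f)) E (VMor R f) id)\<rparr>)"

end

theory Submission
  imports Defs
begin

text \<open>A finite-dimensional representation \<open>R\<close> is additively \<open>Set\<close>-realizable iff it is a retract of
  \<open>free \<circ> S\<close> for some \<open>S\<close> with finite values: a finite direct sum of free representations is free on the
  disjoint union, and as \<open>X\<close> is finite and \<open>R\<close> has finite bases, the inclusion only meets a finite
  subfunctor. Such a retraction amounts to linear forms \<open>I\<^sub>s\<close> and vectors \<open>P\<^sub>s\<close> with
  \<open>v = \<Sum>\<^sub>s I\<^sub>s(v) P\<^sub>s\<close>, subject to naturality; it extends along \<open>F \<rightarrow> F'\<close>.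

  Conversely, let \<open>(I, P)\<close> be such data for \<open>R \<otimes> F'\<close>. Take coordinate forms \<open>l\<^sub>b\<close> for a basis \<open>B\<close> of \<open>F'\<close>
  over \<open>F\<close>, an \<open>F\<close>-linear \<open>\<pi> : F' \<rightarrow> F\<close> with \<open>\<pi> 1 = 1\<close>, and a finite \<open>B\<^sub>1 \<subseteq> B\<close> containing the support of all
  \<open>P\<^sub>s\<close>. Then \<open>P'\<^sub>b\<^sub>s = (id \<otimes> l\<^sub>b) P\<^sub>s\<close> and \<open>I'\<^sub>b\<^sub>s v = \<pi> (b I\<^sub>s(v \<otimes> 1))\<close> exhibit \<open>R\<close> as a retract of the free
  representation on \<open>B\<^sub>1 \<times> S\<close>: apply \<open>id \<otimes> \<pi>\<close> to \<open>v \<otimes> 1 = \<Sum>\<^sub>s \<Sum>\<^sub>b P'\<^sub>b\<^sub>s \<otimes> b I\<^sub>s(v \<otimes> 1)\<close>.\<close>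

text \<open>The difficulty in descending is that the data over F' have entries that need not come
  from F, so the retraction itself does not descend. The remedy is to forget down to F. Over F, the
  representation R \<otimes> F' has R as a retract, by v \<mapsto> v \<otimes> 1 and id \<otimes>
  \<pi>, while the free F'-space on S is the free F-space on B \<times> S; composing would already
  present R as a retract. The formulas for I' and P' are a variant of this composition in which the
  coordinate forms act on the vectors and \<pi> acts on the forms. Only finitely many vectors then
  have to be expanded, so finitely many b suffice even if B is infinite. No morphism moves the index
  b, so the naturality of I' and P' is inherited from that of I and P. A second obstacle is the type
  from which the elements of S are drawn: forming disjoint unions adds summand indices to it, and
  descent adds elements of F'. With finitely many objects and finite values, all elements together
  fit into any infinite type, and this undoes the change of type.\<close>

lemma abelian_group_vectorspace: "vectorspace K V \<Longrightarrow> abelian_group V"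
  by (simp add: vectorspace_def module_def)

lemma additive_zero:
  assumes "abelian_group V" "abelian_group W" "f \<in> carrier V \<rightarrow> carrier W"
    and "\<And>v w. \<lbrakk>v \<in> carrier V; w \<in> carrier V\<rbrakk> \<Longrightarrow> f (v \<oplus>\<^bsub>V\<^esub> w) = f v \<oplus>\<^bsub>W\<^esub> f w"
  shows "f \<zero>\<^bsub>V\<^esub> = \<zero>\<^bsub>W\<^esub>"
proof -
  interpret V: abelian_group V by fact
  interpret W: abelian_group W by fact
  have "f \<zero>\<^bsub>V\<^esub> \<oplus>\<^bsub>W\<^esub> f \<zero>\<^bsub>V\<^esub> = f \<zero>\<^bsub>V\<^esub>"
    using assms(4)[of "\<zero>\<^bsub>V\<^esub>" "\<zero>\<^bsub>V\<^esub>"] by simp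
  then show ?thesis
    using assms(3) by (simp add: W.add.l_cancel_one Pi_iff)
qed

text \<open>Additivity alone is asked for because many of the maps in question connect spaces over
  different fields: multiples of \<phi>, the projection \<pi>, the map v \<mapsto> v \<otimes>
  t.\<close>

lemma additive_finsum:
  assumes "abelian_group V" "abelian_group W" "f \<in> carrier V \<rightarrow> carrier W"
    and add: "\<And>v w. \<lbrakk>v \<in> carrier V; w \<in> carrier V\<rbrakk> \<Longrightarrow> f (v \<oplus>\<^bsub>V\<^esub> w) = f v \<oplus>\<^bsub>W\<^esub> f w"
    and "g \<in> A \<rightarrow> carrier V"
  shows "f (finsum V g A) = finsum W (\<lambda>a. f (g a)) A"
proof -
  interpret V: abelian_group V by fact
  interpret W: abelian_group W by fact
  have zero: "f \<zero>\<^bsub>V\<^esub> = \<zero>\<^bsub>W\<^esub>"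
    by (rule additive_zero[OF assms(1-3)]) (fact add)
  show ?thesis
    using \<open>g \<in> A \<rightarrow> carrier V\<close>
  proof (induction A rule: infinite_finite_induct)
    case (insert a A)
    then have "g \<in> A \<rightarrow> carrier V" "g a \<in> carrier V" "(\<lambda>a. f (g a)) \<in> A \<rightarrow> carrier W"
      using assms(3) by auto
    then show ?case
      using insert assms(3) by (simp add: add V.finsum_insert W.finsum_insert Pi_iff)
  qed (simp_all add: zero)
qed

lemma module_hom_zero:
  assumes "abelian_group V" "abelian_group W" "f \<in> module_hom K V W"
  shows "f \<zero>\<^bsub>V\<^esub> = \<zero>\<^bsub>W\<^esub>"
  using assms by (intro additive_zero) (auto simp: module_hom_def)

lemma module_hom_comp:
  assumes "f \<in> module_hom K V W" "g \<in> module_hom K W Z"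
  shows "(\<lambda>v. g (f v)) \<in> module_hom K V Z"
  using assms by (auto simp: module_hom_def Pi_iff)

lemma module_hom_carrier:
  "\<lbrakk>f \<in> module_hom K V W; v \<in> carrier V\<rbrakk> \<Longrightarrow> f v \<in> carrier W"
  by (auto simp: module_hom_def)

lemma (in abelian_monoid) finsum_fibres:
  assumes "finite A" "finite B" "h \<in> A \<rightarrow> B" "g \<in> A \<rightarrow> carrier G"
  shows "finsum G g A = (\<Oplus>b\<in>B. finsum G g {a \<in> A. h a = b})"
proof -
  have "A = (\<Union>b\<in>B. {a \<in> A. h a = b})"
    using assms by auto
  moreover have "finsum G g (\<Union>b\<in>B. {a \<in> A. h a = b}) = (\<Oplus>b\<in>B. finsum G g {a \<in> A. h a = b})"
    using assms by (intro add.finprod_UN_disjoint) (auto simp: pairwise_def disjnt_def)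
  ultimately show ?thesis by simp
qed

text \<open>A stand-in for \<open>module_hom\<close> with the field as target:
  \<open>module_hom\<close> expects a module record there, and a field is a ring record.\<close>

definition linear_form :: "('k, 'l) ring_scheme \<Rightarrow> ('k, 'v) module \<Rightarrow> ('v \<Rightarrow> 'k) \<Rightarrow> bool" where
  "linear_form K V g \<longleftrightarrow> g \<in> carrier V \<rightarrow> carrier K \<and>
    (\<forall>v\<in>carrier V. \<forall>w\<in>carrier V. g (v \<oplus>\<^bsub>V\<^esub> w) = g v \<oplus>\<^bsub>K\<^esub> g w) \<and>
    (\<forall>k\<in>carrier K. \<forall>v\<in>carrier V. g (k \<odot>\<^bsub>V\<^esub> v) = k \<otimes>\<^bsub>K\<^esub> g v)"

section \<open>Free vector spaces\<close>

context field begin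

lemma free_vs_carrier:
  "carrier (free_vs R A) = {c \<in> A \<rightarrow>\<^sub>E carrier R. finite {a \<in> A. c a \<noteq> \<zero>}}"
  by (simp add: free_vs_def)

lemma free_vs_add: "c \<oplus>\<^bsub>free_vs R A\<^esub> d = (\<lambda>a\<in>A. c a \<oplus> d a)"
  by (simp add: free_vs_def func_space_def)

lemma free_vs_zero: "\<zero>\<^bsub>free_vs R A\<^esub> = (\<lambda>a\<in>A. \<zero>)"
  by (simp add: free_vs_def func_space_def)

lemma free_vs_smult: "k \<odot>\<^bsub>free_vs R A\<^esub> c = (\<lambda>a\<in>A. k \<otimes> c a)"
  by (simp add: free_vs_def func_space_def)

lemmas free_vs_simps = free_vs_carrier free_vs_add free_vs_zero free_vs_smult

lemma free_vs_vectorspace: "vectorspace R (free_vs R A)"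
proof -
  interpret M: module R "func_space A" by (rule func_space_is_module)
  have "submodule R {c \<in> A \<rightarrow>\<^sub>E carrier R. finite {a \<in> A. c a \<noteq> \<zero>}} (func_space A)"
  proof (unfold_locales, goal_cases)
    case (2 c d)
    have "{a \<in> A. c a \<oplus> d a \<noteq> \<zero>} \<subseteq> {a \<in> A. c a \<noteq> \<zero>} \<union> {a \<in> A. d a \<noteq> \<zero>}"
      by auto
    moreover have "finite \<dots>" using 2 by simp
    ultimately have "finite {a \<in> A. c a \<oplus> d a \<noteq> \<zero>}" by (rule finite_subset)
    then show ?case using 2 by (auto simp: func_space_def cong: conj_cong)
  next
    case (4 k c)
    have "{a \<in> A. k \<otimes> c a \<noteq> \<zero>} \<subseteq> {a \<in> A. c a \<noteq> \<zero>}"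
      using 4 by auto
    moreover have "finite \<dots>" using 4 by simp
    ultimately have "finite {a \<in> A. k \<otimes> c a \<noteq> \<zero>}" by (rule finite_subset)
    then show ?case using 4 by (auto simp: func_space_def cong: conj_cong)
  qed (auto simp: func_space_def cong: conj_cong)
  then have "module R (free_vs R A)"
    unfolding free_vs_def by (rule M.submodule_is_module)
  then show ?thesis
    by (simp add: vectorspace_def field_axioms)
qed

lemma free_vs_finite_carrier: "finite A \<Longrightarrow> carrier (free_vs R A) = A \<rightarrow>\<^sub>E carrier R"
  by (auto simp: free_vs_carrier)

lemma free_gen_carrier: "a \<in> A \<Longrightarrow> free_gen R A a \<in> carrier (free_vs R A)"
  by (auto simp: free_vs_carrier free_gen_def intro!: finite_subset[of _ "{a}"] split: if_splits)

text \<open>Induction on the support: setting one nonzero coefficient to zero leaves a vector whose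
  support is smaller by one point.\<close>

lemma free_vs_induct [consumes 1, case_names zero step]:
  assumes "c \<in> carrier (free_vs R A)"
    and "Q \<zero>\<^bsub>free_vs R A\<^esub>"
    and "\<And>c k a. \<lbrakk>c \<in> carrier (free_vs R A); Q c; k \<in> carrier R; a \<in> A\<rbrakk>
      \<Longrightarrow> Q (c \<oplus>\<^bsub>free_vs R A\<^esub> k \<odot>\<^bsub>free_vs R A\<^esub> free_gen R A a)"
  shows "Q c"
proof -
  have "finite T \<Longrightarrow> \<forall>c\<in>carrier (free_vs R A). {a \<in> A. c a \<noteq> \<zero>} = T \<longrightarrow> Q c" for T
  proof (induction T rule: finite_induct)
    case empty
    have "c = \<zero>\<^bsub>free_vs R A\<^esub>" if "c \<in> carrier (free_vs R A)" "{a \<in> A. c a \<noteq> \<zero>} = {}" for c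
      using that by (intro ext) (auto simp: free_vs_simps PiE_iff extensional_def)
    then show ?case using assms(2) by blast
  next
    case (insert a T)
    show ?case
    proof (intro ballI impI)
      fix c assume c: "c \<in> carrier (free_vs R A)" and supp: "{a \<in> A. c a \<noteq> \<zero>} = insert a T"
      define d where "d = (\<lambda>x\<in>A. if x = a then \<zero> else c x)"
      have a: "a \<in> A" using supp by blast
      have d_supp: "{a \<in> A. d a \<noteq> \<zero>} = T"
        using supp insert.hyps by (auto simp: d_def)
      have d: "d \<in> carrier (free_vs R A)"
        using c insert.hyps(1) d_supp
        by (auto simp: free_vs_carrier d_def PiE_iff cong: conj_cong)
      have "c = d \<oplus>\<^bsub>free_vs R A\<^esub> c a \<odot>\<^bsub>free_vs R A\<^esub> free_gen R A a"
        using c a by (intro ext) (auto simp: free_vs_simps free_gen_def d_def PiE_iff extensional_def)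
      then show "Q c"
        using assms(3)[of d "c a" a] insert.IH d d_supp a c by (auto simp: free_vs_carrier PiE_iff)
    qed
  qed
  then show ?thesis using assms(1) by (auto simp: free_vs_carrier)
qed

end

text \<open>The sum runs over the support of \<open>c\<close>, because \<open>A\<close> may be
  infinite and \<open>finsum\<close> over an infinite set is zero by convention.\<close>

definition free_lift ::
  "('k, 'l) ring_scheme \<Rightarrow> ('k, 'v, 'z) module_scheme \<Rightarrow> 's set \<Rightarrow> ('s \<Rightarrow> 'v) \<Rightarrow> ('s \<Rightarrow> 'k) \<Rightarrow> 'v" where
  "free_lift K Z A f c = (\<Oplus>\<^bsub>Z\<^esub>a\<in>{a \<in> A. c a \<noteq> \<zero>\<^bsub>K\<^esub>}. c a \<odot>\<^bsub>Z\<^esub> f a)"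

context vectorspace begin

text \<open>Terms outside the support vanish. The freedom in \<open>B\<close> allows vectors with
  different supports to be summed over one common index set.\<close>

lemma free_lift_eq:
  assumes "finite B" "B \<subseteq> A" "{a \<in> A. c a \<noteq> \<zero>\<^bsub>K\<^esub>} \<subseteq> B" "f \<in> A \<rightarrow> carrier V"
    "c \<in> carrier (free_vs K A)"
  shows "free_lift K V A f c = (\<Oplus>\<^bsub>V\<^esub>a\<in>B. c a \<odot>\<^bsub>V\<^esub> f a)"
  unfolding free_lift_def
  using assms by (intro M.add.finprod_mono_neutral_cong_left) (auto simp: free_vs_carrier Pi_iff PiE_iff)

lemma free_lift_hom:
  assumes f: "f \<in> A \<rightarrow> carrier V"
  shows "free_lift K V A f \<in> module_hom K (free_vs K A) V"
proof -
  interpret F: vectorspace K "free_vs K A" by (rule free_vs_vectorspace)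
  have supp: "finite {a \<in> A. c a \<noteq> \<zero>\<^bsub>K\<^esub>}" "\<And>a. a \<in> A \<Longrightarrow> c a \<in> carrier K"
    if "c \<in> carrier (free_vs K A)" for c
    using that by (auto simp: free_vs_carrier)
  have "free_lift K V A f c \<in> carrier V" if "c \<in> carrier (free_vs K A)" for c
    unfolding free_lift_def using supp[OF that] f by (intro M.finsum_closed) auto
  moreover have "free_lift K V A f (c \<oplus>\<^bsub>free_vs K A\<^esub> d) = free_lift K V A f c \<oplus>\<^bsub>V\<^esub> free_lift K V A f d"
    if c: "c \<in> carrier (free_vs K A)" and d: "d \<in> carrier (free_vs K A)" for c d
  proof -
    define B where "B = {a \<in> A. c a \<noteq> \<zero>\<^bsub>K\<^esub>} \<union> {a \<in> A. d a \<noteq> \<zero>\<^bsub>K\<^esub>}"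
    have B: "finite B" "B \<subseteq> A" using supp[OF c] supp[OF d] by (auto simp: B_def)
    have "free_lift K V A f (c \<oplus>\<^bsub>free_vs K A\<^esub> d) = (\<Oplus>\<^bsub>V\<^esub>a\<in>B. (c \<oplus>\<^bsub>free_vs K A\<^esub> d) a \<odot>\<^bsub>V\<^esub> f a)"
      using B f F.M.a_closed[OF c d] supp[OF c] supp[OF d]
      by (intro free_lift_eq) (auto simp: B_def free_vs_add)
    also have "\<dots> = (\<Oplus>\<^bsub>V\<^esub>a\<in>B. c a \<odot>\<^bsub>V\<^esub> f a \<oplus>\<^bsub>V\<^esub> d a \<odot>\<^bsub>V\<^esub> f a)"
      using B f supp[OF c] supp[OF d]
      by (intro M.finsum_cong') (auto simp: free_vs_add Pi_iff smult_l_distr subset_iff)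
    also have "\<dots> = (\<Oplus>\<^bsub>V\<^esub>a\<in>B. c a \<odot>\<^bsub>V\<^esub> f a) \<oplus>\<^bsub>V\<^esub> (\<Oplus>\<^bsub>V\<^esub>a\<in>B. d a \<odot>\<^bsub>V\<^esub> f a)"
      using B f supp[OF c] supp[OF d] by (intro M.finsum_addf) (auto simp: Pi_iff subset_iff)
    also have "\<dots> = free_lift K V A f c \<oplus>\<^bsub>V\<^esub> free_lift K V A f d"
      using B f c d by (simp add: free_lift_eq[of B A c] free_lift_eq[of B A d] B_def)
    finally show ?thesis .
  qed
  moreover have "free_lift K V A f (k \<odot>\<^bsub>free_vs K A\<^esub> c) = k \<odot>\<^bsub>V\<^esub> free_lift K V A f c"
    if k: "k \<in> carrier K" and c: "c \<in> carrier (free_vs K A)" for k c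
  proof -
    define B where "B = {a \<in> A. c a \<noteq> \<zero>\<^bsub>K\<^esub>}"
    have B: "finite B" "B \<subseteq> A" using supp[OF c] by (auto simp: B_def)
    have "free_lift K V A f (k \<odot>\<^bsub>free_vs K A\<^esub> c) = (\<Oplus>\<^bsub>V\<^esub>a\<in>B. (k \<odot>\<^bsub>free_vs K A\<^esub> c) a \<odot>\<^bsub>V\<^esub> f a)"
      using B f F.smult_closed[OF k c] k by (intro free_lift_eq) (auto simp: B_def free_vs_smult)
    also have "\<dots> = (\<Oplus>\<^bsub>V\<^esub>a\<in>B. k \<odot>\<^bsub>V\<^esub> (c a \<odot>\<^bsub>V\<^esub> f a))"
      using B f k supp[OF c]
      by (intro M.finsum_cong') (auto simp: free_vs_smult Pi_iff smult_assoc1 subset_iff)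
    also have "\<dots> = k \<odot>\<^bsub>V\<^esub> (\<Oplus>\<^bsub>V\<^esub>a\<in>B. c a \<odot>\<^bsub>V\<^esub> f a)"
      using B f k supp[OF c]
      by (intro additive_finsum[of V V "\<lambda>v. k \<odot>\<^bsub>V\<^esub> v", symmetric])
        (auto simp: M.abelian_group_axioms smult_r_distr Pi_iff subset_iff)
    finally show ?thesis by (simp add: B_def free_lift_def)
  qed
  ultimately show ?thesis by (auto simp: module_hom_def)
qed

lemma free_lift_gen:
  assumes "f \<in> A \<rightarrow> carrier V" "a \<in> A"
  shows "free_lift K V A f (free_gen K A a) = f a"
proof -
  have "{x \<in> A. free_gen K A a x \<noteq> \<zero>\<^bsub>K\<^esub>} = {a}"
    using assms by (auto simp: free_gen_def)
  then show ?thesis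
    using assms by (auto simp: free_lift_def free_gen_def Pi_iff)
qed

text \<open>This reduces the functor laws of \<open>free_rep\<close> and the naturality of
  projections from a free representation to identities between images of generators.\<close>

lemma free_vs_hom_eqI:
  assumes g: "g \<in> module_hom K (free_vs K A) V" and h: "h \<in> module_hom K (free_vs K A) V"
    and eq: "\<And>a. a \<in> A \<Longrightarrow> g (free_gen K A a) = h (free_gen K A a)"
    and "c \<in> carrier (free_vs K A)"
  shows "g c = h c"
  using \<open>c \<in> carrier (free_vs K A)\<close>
proof (induction rule: free_vs_induct)
  case zero
  have "abelian_group (free_vs K A)"
    by (rule abelian_group_vectorspace[OF free_vs_vectorspace])
  then show ?case
    using module_hom_zero[OF _ M.abelian_group_axioms g] module_hom_zero[OF _ M.abelian_group_axioms h]
    by simp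
next
  case (step c k a)
  interpret F: vectorspace K "free_vs K A" by (rule free_vs_vectorspace)
  show ?case
    using step free_gen_carrier[of a A]
    by (simp add: module_hom_add[OF g] module_hom_add[OF h] module_hom_smult[OF g] module_hom_smult[OF h] eq)
qed

end

context field begin

lemma free_vs_finsum_apply:
  assumes "g \<in> T \<rightarrow> carrier (free_vs R A)" "b \<in> A"
  shows "(finsum (free_vs R A) g T) b = (\<Oplus>t\<in>T. g t b)"
  using assms abelian_group_vectorspace[OF free_vs_vectorspace]
  by (intro additive_finsum[of "free_vs R A" R "\<lambda>c. c b"])
    (auto simp: free_vs_simps abelian_group_axioms)

text \<open>At a point \<open>b\<close> the lifted sum retains exactly the terms with
  \<open>h a = b\<close>. The identity hands the linearity of \<open>free_lift\<close> and its
  values on generators over to \<open>free_map\<close>.\<close>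

lemma free_map_eq_lift:
  assumes h: "h \<in> A \<rightarrow> B" and c: "c \<in> carrier (free_vs R A)"
  shows "free_map R A B h c = free_lift R (free_vs R B) A (\<lambda>a. free_gen R B (h a)) c"
proof -
  interpret F: vectorspace R "free_vs R B" by (rule free_vs_vectorspace)
  have gen: "(\<lambda>a. free_gen R B (h a)) \<in> A \<rightarrow> carrier (free_vs R B)"
    using h by (auto intro: free_gen_carrier)
  have "free_lift R (free_vs R B) A (\<lambda>a. free_gen R B (h a)) c \<in> carrier (free_vs R B)"
    using F.free_lift_hom[OF gen] c by (rule module_hom_carrier)
  then have ext: "free_lift R (free_vs R B) A (\<lambda>a. free_gen R B (h a)) c \<in> extensional B"
    by (simp add: free_vs_carrier PiE_iff)
  have cc: "\<And>a. a \<in> A \<Longrightarrow> c a \<in> carrier R" and fin: "finite {a \<in> A. c a \<noteq> \<zero>}"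
    using c by (auto simp: free_vs_carrier)
  show ?thesis
  proof (rule extensionalityI[OF _ ext])
    show "free_map R A B h c \<in> extensional B"
      by (simp add: free_map_def)
    fix b assume b: "b \<in> B"
    have "free_lift R (free_vs R B) A (\<lambda>a. free_gen R B (h a)) c b
      = (\<Oplus>a\<in>{a \<in> A. c a \<noteq> \<zero>}. (c a \<odot>\<^bsub>free_vs R B\<^esub> free_gen R B (h a)) b)"
      unfolding free_lift_def using b cc gen by (intro free_vs_finsum_apply) auto
    also have "\<dots> = (\<Oplus>a\<in>{a \<in> A. h a = b \<and> c a \<noteq> \<zero>}. c a)"
      using b cc fin by (intro add.finprod_mono_neutral_cong_right)
        (auto simp: free_vs_smult free_gen_def)
    finally show "free_map R A B h c b = free_lift R (free_vs R B) A (\<lambda>a. free_gen R B (h a)) c b"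
      using b by (simp add: free_map_def)
  qed
qed

lemma module_hom_cong:
  assumes "\<And>v. v \<in> carrier V \<Longrightarrow> f v = g v" "g \<in> module_hom R V W" "vectorspace R V"
  shows "f \<in> module_hom R V W"
proof -
  interpret V: vectorspace R V by fact
  show ?thesis using assms by (auto simp: module_hom_def)
qed

lemma free_map_hom:
  assumes h: "h \<in> A \<rightarrow> B"
  shows "free_map R A B h \<in> module_hom R (free_vs R A) (free_vs R B)"
proof -
  interpret F: vectorspace R "free_vs R B" by (rule free_vs_vectorspace)
  have "free_lift R (free_vs R B) A (\<lambda>a. free_gen R B (h a)) \<in> module_hom R (free_vs R A) (free_vs R B)"
    using h by (intro F.free_lift_hom) (auto intro: free_gen_carrier)
  then show ?thesis
    by (rule module_hom_cong[rotated]) (simp_all add: free_map_eq_lift h free_vs_vectorspace)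
qed

lemma free_map_gen:
  assumes h: "h \<in> A \<rightarrow> B" and a: "a \<in> A"
  shows "free_map R A B h (free_gen R A a) = free_gen R B (h a)"
proof -
  interpret F: vectorspace R "free_vs R B" by (rule free_vs_vectorspace)
  show ?thesis
    using assms by (simp add: free_map_eq_lift free_gen_carrier F.free_lift_gen Pi_iff)
qed

text \<open>For finite \<open>A\<close> the support condition drops out, and the coefficient becomes
  a plain fibre sum, the shape in which the naturality of coordinate forms is stated below.\<close>

lemma free_map_apply:
  assumes "finite A" "c \<in> carrier (free_vs R A)" "b \<in> B"
  shows "free_map R A B h c b = (\<Oplus>a\<in>{a \<in> A. h a = b}. c a)"
  using assms unfolding free_map_def
  by (simp, intro add.finprod_mono_neutral_cong_left) (auto simp: free_vs_carrier PiE_iff)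

end

section \<open>Tensor products\<close>

definition bilinear_map ::
  "('k, 'l) ring_scheme \<Rightarrow> ('k, 'v) module \<Rightarrow> ('k, 'w) module \<Rightarrow> ('k, 'z) module \<Rightarrow>
   ('v \<Rightarrow> 'w \<Rightarrow> 'z) \<Rightarrow> bool" where
  "bilinear_map K V W Z \<beta> \<longleftrightarrow>
    (\<forall>v\<in>carrier V. \<beta> v \<in> module_hom K W Z) \<and> (\<forall>w\<in>carrier W. (\<lambda>v. \<beta> v w) \<in> module_hom K V Z)"

definition pure_tensor ::
  "('k, 'l) ring_scheme \<Rightarrow> ('k, 'v) module \<Rightarrow> ('k, 'w) module \<Rightarrow> 'v \<Rightarrow> 'w \<Rightarrow> ('v \<times> 'w \<Rightarrow> 'k) set" where
  "pure_tensor K V W v w =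
    tensor_null K V W +>\<^bsub>tensor_free K V W\<^esub> free_gen K (carrier V \<times> carrier W) (v, w)"

text \<open>The map induced on the quotient by a bilinear \<beta>. It is evaluated at an arbitrary
  representative of the coset; bilinearity makes the choice immaterial.\<close>

definition tensor_lift ::
  "('k, 'l) ring_scheme \<Rightarrow> ('k, 'v) module \<Rightarrow> ('k, 'w) module \<Rightarrow> ('k, 'z) module \<Rightarrow>
   ('v \<Rightarrow> 'w \<Rightarrow> 'z) \<Rightarrow> ('v \<times> 'w \<Rightarrow> 'k) set \<Rightarrow> 'z" where
  "tensor_lift K V W Z \<beta> C =
    free_lift K Z (carrier V \<times> carrier W) (case_prod \<beta>) (SOME z. z \<in> C)"

text \<open>Closure under negatives comes from scaling by \<open>\<ominus> \<one>\<close>.\<close>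

lemma (in module) submodule_abelian_subgroup:
  assumes "submodule R N M"
  shows "abelian_subgroup N M"
proof -
  interpret N: submodule R N M by fact
  have "\<ominus>\<^bsub>M\<^esub> x \<in> N" if "x \<in> N" for x
  proof -
    have "x \<in> carrier M" using N.subset that by blast
    then show ?thesis
      using N.smult_closed[of "\<ominus> \<one>" x] that by (simp add: smult_l_minus)
  qed
  then show ?thesis
    using N.subset
    by (intro abelian_subgroupI3 additive_subgroupI subgroup.intro M.abelian_group_axioms)
      (auto simp: a_inv_def[symmetric])
qed

lemma (in module) coset_eqI:
  assumes "submodule R N M" "x \<in> carrier M" "y \<in> carrier M" "x \<ominus>\<^bsub>M\<^esub> y \<in> N"
  shows "N +>\<^bsub>M\<^esub> x = N +>\<^bsub>M\<^esub> y"
proof -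
  interpret N: submodule R N M by fact
  interpret N: abelian_subgroup N M
    by (rule submodule_abelian_subgroup) fact
  have "x \<in> N +>\<^bsub>M\<^esub> y"
    using assms by (simp add: N.a_rcos_module a_minus_def)
  then show ?thesis
    using assms N.a_repr_independence' by auto
qed

locale tensor_product = V: vectorspace K V + W: vectorspace K W
  for K :: "('k, 'l) ring_scheme" and V :: "('k, 'v) module" and W :: "('k, 'w) module"
begin

abbreviation "\<P> \<equiv> tensor_free K V W"
abbreviation "\<N> \<equiv> tensor_null K V W"
abbreviation "\<T> \<equiv> tensor K V W"
abbreviation "gen v w \<equiv> free_gen K (carrier V \<times> carrier W) (v, w)"
abbreviation "coset z \<equiv> \<N> +>\<^bsub>\<P>\<^esub> z"
abbreviation pure (infixl \<open>\<star>\<close> 72) where "v \<star> w \<equiv> pure_tensor K V W v w"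

lemma free_vectorspace: "vectorspace K \<P>"
  unfolding tensor_free_def by (rule V.free_vs_vectorspace)

sublocale P: vectorspace K \<P>
  by (rule free_vectorspace)

lemma gen_carrier: "\<lbrakk>v \<in> carrier V; w \<in> carrier W\<rbrakk> \<Longrightarrow> gen v w \<in> carrier \<P>"
  unfolding tensor_free_def by (rule V.free_gen_carrier) simp

lemma relators_intros:
  "\<lbrakk>v \<in> carrier V; v' \<in> carrier V; w \<in> carrier W\<rbrakk> \<Longrightarrow>
    gen (v \<oplus>\<^bsub>V\<^esub> v') w \<ominus>\<^bsub>\<P>\<^esub> (gen v w \<oplus>\<^bsub>\<P>\<^esub> gen v' w) \<in> tensor_relators K V W"
  "\<lbrakk>v \<in> carrier V; w \<in> carrier W; w' \<in> carrier W\<rbrakk> \<Longrightarrow>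
    gen v (w \<oplus>\<^bsub>W\<^esub> w') \<ominus>\<^bsub>\<P>\<^esub> (gen v w \<oplus>\<^bsub>\<P>\<^esub> gen v w') \<in> tensor_relators K V W"
  "\<lbrakk>k \<in> carrier K; v \<in> carrier V; w \<in> carrier W\<rbrakk> \<Longrightarrow>
    gen (k \<odot>\<^bsub>V\<^esub> v) w \<ominus>\<^bsub>\<P>\<^esub> k \<odot>\<^bsub>\<P>\<^esub> gen v w \<in> tensor_relators K V W"
  "\<lbrakk>k \<in> carrier K; v \<in> carrier V; w \<in> carrier W\<rbrakk> \<Longrightarrow>
    gen v (k \<odot>\<^bsub>W\<^esub> w) \<ominus>\<^bsub>\<P>\<^esub> k \<odot>\<^bsub>\<P>\<^esub> gen v w \<in> tensor_relators K V W"
  unfolding tensor_relators_def Let_def by blast+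

lemma relators_cases [consumes 1, case_names add_left add_right smult_left smult_right]:
  assumes "r \<in> tensor_relators K V W"
  obtains v v' w where "v \<in> carrier V" "v' \<in> carrier V" "w \<in> carrier W"
      "r = gen (v \<oplus>\<^bsub>V\<^esub> v') w \<ominus>\<^bsub>\<P>\<^esub> (gen v w \<oplus>\<^bsub>\<P>\<^esub> gen v' w)"
    | v w w' where "v \<in> carrier V" "w \<in> carrier W" "w' \<in> carrier W"
      "r = gen v (w \<oplus>\<^bsub>W\<^esub> w') \<ominus>\<^bsub>\<P>\<^esub> (gen v w \<oplus>\<^bsub>\<P>\<^esub> gen v w')"
    | k v w where "k \<in> carrier K" "v \<in> carrier V" "w \<in> carrier W"
      "r = gen (k \<odot>\<^bsub>V\<^esub> v) w \<ominus>\<^bsub>\<P>\<^esub> k \<odot>\<^bsub>\<P>\<^esub> gen v w"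
    | k v w where "k \<in> carrier K" "v \<in> carrier V" "w \<in> carrier W"
      "r = gen v (k \<odot>\<^bsub>W\<^esub> w) \<ominus>\<^bsub>\<P>\<^esub> k \<odot>\<^bsub>\<P>\<^esub> gen v w"
  using assms unfolding tensor_relators_def Let_def
  by (elim UnE CollectE exE conjE) (rule that; assumption)+

lemma relators_carrier: "tensor_relators K V W \<subseteq> carrier \<P>"
  by (intro subsetI) (auto elim!: relators_cases intro!: P.M.minus_closed gen_carrier)

lemma null_submodule: "submodule K \<N> \<P>"
  unfolding tensor_null_def by (rule P.span_is_submodule[OF relators_carrier])

lemma relators_null: "tensor_relators K V W \<subseteq> \<N>"
  unfolding tensor_null_def by (rule P.in_own_span[OF relators_carrier])

sublocale Q: abelian_subgroup \<N> \<P>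
  by (rule P.submodule_abelian_subgroup[OF null_submodule])

text \<open>Every proof of well-definedness on the tensor product goes through this: it leaves only
  the four kinds of relators to check.\<close>

lemma null_subset_kernel:
  assumes "submodule K U \<P>" "tensor_relators K V W \<subseteq> U"
  shows "\<N> \<subseteq> U"
  unfolding tensor_null_def using assms by (intro P.span_is_subset)

lemma tensor_carrier: "carrier \<T> = coset ` carrier \<P>"
  by (auto simp: tensor_def quotient_vs_def A_RCOSETS_def')

lemma tensor_add: "\<lbrakk>x \<in> carrier \<P>; y \<in> carrier \<P>\<rbrakk> \<Longrightarrow> coset x \<oplus>\<^bsub>\<T>\<^esub> coset y = coset (x \<oplus>\<^bsub>\<P>\<^esub> y)"
  by (simp add: tensor_def quotient_vs_def Q.a_rcos_sum)

lemma tensor_zero: "\<zero>\<^bsub>\<T>\<^esub> = coset \<zero>\<^bsub>\<P>\<^esub>"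
  using Q.a_rcos_const[of "\<zero>\<^bsub>\<P>\<^esub>"] by (simp add: tensor_def quotient_vs_def)

lemma tensor_abelian_group: "abelian_group \<T>"
proof (rule abelian_groupI)
  show "\<exists>y\<in>carrier \<T>. y \<oplus>\<^bsub>\<T>\<^esub> x = \<zero>\<^bsub>\<T>\<^esub>" if "x \<in> carrier \<T>" for x
  proof -
    obtain z where "z \<in> carrier \<P>" "x = coset z"
      using \<open>x \<in> carrier \<T>\<close> by (auto simp: tensor_carrier)
    then show ?thesis
      by (intro bexI[of _ "coset (\<ominus>\<^bsub>\<P>\<^esub> z)"])
        (auto simp: tensor_add tensor_zero tensor_carrier P.M.l_neg)
  qed
qed (auto simp: tensor_carrier tensor_add tensor_zero P.M.a_ac)

sublocale T: abelian_group \<T>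
  by (rule tensor_abelian_group)

lemma pure_carrier [simp]: "\<lbrakk>v \<in> carrier V; w \<in> carrier W\<rbrakk> \<Longrightarrow> v \<star> w \<in> carrier \<T>"
  by (simp add: pure_tensor_def tensor_carrier gen_carrier)

lemma coset_eq_null:
  "\<lbrakk>x \<ominus>\<^bsub>\<P>\<^esub> y \<in> \<N>; x \<in> carrier \<P>; y \<in> carrier \<P>\<rbrakk> \<Longrightarrow> coset x = coset y"
  by (rule P.coset_eqI[OF null_submodule])

lemma pure_add_left:
  assumes "v \<in> carrier V" "v' \<in> carrier V" "w \<in> carrier W"
  shows "(v \<oplus>\<^bsub>V\<^esub> v') \<star> w = v \<star> w \<oplus>\<^bsub>\<T>\<^esub> v' \<star> w"
proof -
  have "gen (v \<oplus>\<^bsub>V\<^esub> v') w \<ominus>\<^bsub>\<P>\<^esub> (gen v w \<oplus>\<^bsub>\<P>\<^esub> gen v' w) \<in> \<N>"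
    using assms by (intro subsetD[OF relators_null] relators_intros)
  then show ?thesis
    using assms by (simp add: pure_tensor_def tensor_add gen_carrier coset_eq_null)
qed

lemma pure_add_right:
  assumes "v \<in> carrier V" "w \<in> carrier W" "w' \<in> carrier W"
  shows "v \<star> (w \<oplus>\<^bsub>W\<^esub> w') = v \<star> w \<oplus>\<^bsub>\<T>\<^esub> v \<star> w'"
proof -
  have "gen v (w \<oplus>\<^bsub>W\<^esub> w') \<ominus>\<^bsub>\<P>\<^esub> (gen v w \<oplus>\<^bsub>\<P>\<^esub> gen v w') \<in> \<N>"
    using assms by (intro subsetD[OF relators_null] relators_intros)
  then show ?thesis
    using assms by (simp add: pure_tensor_def tensor_add gen_carrier coset_eq_null)
qed

text \<open>\<open>\<T>\<close> is handled as an abelian group only, so the scalar appears on a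
  representative in \<open>\<P>\<close>. The right-hand side is the same as for the second factor,
  and balancedness follows.\<close>

lemma pure_smult_left:
  assumes "k \<in> carrier K" "v \<in> carrier V" "w \<in> carrier W"
  shows "(k \<odot>\<^bsub>V\<^esub> v) \<star> w = coset (k \<odot>\<^bsub>\<P>\<^esub> gen v w)"
proof -
  have "gen (k \<odot>\<^bsub>V\<^esub> v) w \<ominus>\<^bsub>\<P>\<^esub> k \<odot>\<^bsub>\<P>\<^esub> gen v w \<in> \<N>"
    using assms by (intro subsetD[OF relators_null] relators_intros)
  then show ?thesis
    using assms by (simp add: pure_tensor_def gen_carrier coset_eq_null)
qed

lemma pure_smult_right:
  assumes "k \<in> carrier K" "v \<in> carrier V" "w \<in> carrier W"
  shows "v \<star> (k \<odot>\<^bsub>W\<^esub> w) = coset (k \<odot>\<^bsub>\<P>\<^esub> gen v w)"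
proof -
  have "gen v (k \<odot>\<^bsub>W\<^esub> w) \<ominus>\<^bsub>\<P>\<^esub> k \<odot>\<^bsub>\<P>\<^esub> gen v w \<in> \<N>"
    using assms by (intro subsetD[OF relators_null] relators_intros)
  then show ?thesis
    using assms by (simp add: pure_tensor_def gen_carrier coset_eq_null)
qed

lemma pure_balanced:
  "\<lbrakk>k \<in> carrier K; v \<in> carrier V; w \<in> carrier W\<rbrakk> \<Longrightarrow> (k \<odot>\<^bsub>V\<^esub> v) \<star> w = v \<star> (k \<odot>\<^bsub>W\<^esub> w)"
  by (simp add: pure_smult_left pure_smult_right)

lemma pure_zero_left: "w \<in> carrier W \<Longrightarrow> \<zero>\<^bsub>V\<^esub> \<star> w = \<zero>\<^bsub>\<T>\<^esub>"
  by (rule additive_zero[OF V.M.abelian_group_axioms tensor_abelian_group, of "\<lambda>v. v \<star> w"])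
    (simp_all add: pure_add_left)

text \<open>A coefficient is absorbed into the left factor, and zero is itself a pure tensor; hence
  pure tensors generate under addition alone and no case for scalars arises.\<close>

lemma tensor_induct [consumes 1, case_names pure add]:
  assumes "x \<in> carrier \<T>"
    and pure: "\<And>v w. \<lbrakk>v \<in> carrier V; w \<in> carrier W\<rbrakk> \<Longrightarrow> Q (v \<star> w)"
    and add: "\<And>x y. \<lbrakk>x \<in> carrier \<T>; y \<in> carrier \<T>; Q x; Q y\<rbrakk> \<Longrightarrow> Q (x \<oplus>\<^bsub>\<T>\<^esub> y)"
  shows "Q x"
proof -
  obtain z where z: "z \<in> carrier \<P>" "x = coset z"
    using assms(1) by (auto simp: tensor_carrier)
  have "z \<in> carrier (free_vs K (carrier V \<times> carrier W))"
    using z by (simp add: tensor_free_def)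
  then have "Q (coset z)"
  proof (induction rule: V.free_vs_induct)
    case zero
    then show ?case
      using pure[of "\<zero>\<^bsub>V\<^esub>" "\<zero>\<^bsub>W\<^esub>"]
      by (simp add: pure_zero_left tensor_zero flip: tensor_free_def)
  next
    case (step c k a)
    obtain v w where a: "a = (v, w)" "v \<in> carrier V" "w \<in> carrier W"
      using step by auto
    have "coset (c \<oplus>\<^bsub>\<P>\<^esub> k \<odot>\<^bsub>\<P>\<^esub> gen v w) = coset c \<oplus>\<^bsub>\<T>\<^esub> (k \<odot>\<^bsub>V\<^esub> v) \<star> w"
      using step a by (simp add: pure_smult_left tensor_add gen_carrier flip: tensor_free_def)
    moreover have "coset c \<in> carrier \<T>"
      using step by (simp add: tensor_carrier flip: tensor_free_def)
    moreover have "(k \<odot>\<^bsub>V\<^esub> v) \<star> w \<in> carrier \<T>"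
      using step a by simp
    ultimately show ?case
      using add[of "coset c" "(k \<odot>\<^bsub>V\<^esub> v) \<star> w"] step a pure
      by (simp flip: tensor_free_def)
  qed
  then show ?thesis by (simp add: z)
qed

text \<open>The linear extension \<open>L\<close> of \<beta> to the free space kills each kind of
  relator, hence all of \<open>\<N>\<close>. Representatives of a coset differ by elements of
  \<open>\<N>\<close>, so the one picked by \<open>SOME\<close> gives the value at any
  other.\<close>

lemma tensor_lift:
  assumes Z: "vectorspace K Z" and \<beta>: "bilinear_map K V W Z \<beta>"
  shows tensor_lift_carrier: "x \<in> carrier \<T> \<Longrightarrow> tensor_lift K V W Z \<beta> x \<in> carrier Z"
    and tensor_lift_add: "\<lbrakk>x \<in> carrier \<T>; y \<in> carrier \<T>\<rbrakk> \<Longrightarrow>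
      tensor_lift K V W Z \<beta> (x \<oplus>\<^bsub>\<T>\<^esub> y) = tensor_lift K V W Z \<beta> x \<oplus>\<^bsub>Z\<^esub> tensor_lift K V W Z \<beta> y"
    and tensor_lift_pure: "\<lbrakk>v \<in> carrier V; w \<in> carrier W\<rbrakk> \<Longrightarrow> tensor_lift K V W Z \<beta> (v \<star> w) = \<beta> v w"
proof -
  interpret Z: vectorspace K Z by fact
  define L where "L = free_lift K Z (carrier V \<times> carrier W) (case_prod \<beta>)"
  have \<beta>c: "case_prod \<beta> \<in> carrier V \<times> carrier W \<rightarrow> carrier Z"
    using \<beta> by (auto simp: bilinear_map_def module_hom_def)
  have hom: "L \<in> module_hom K \<P> Z"
    unfolding L_def tensor_free_def by (rule Z.free_lift_hom[OF \<beta>c])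
  interpret L: mod_hom K \<P> Z L
    by (unfold_locales) (fact hom)
  have gen: "L (gen v w) = \<beta> v w" if "v \<in> carrier V" "w \<in> carrier W" for v w
    unfolding L_def using that by (subst Z.free_lift_gen[OF \<beta>c]) auto
  have \<beta>_in: "\<beta> v w \<in> carrier Z" if "v \<in> carrier V" "w \<in> carrier W" for v w
    using \<beta> that by (auto simp: bilinear_map_def module_hom_def)
  have "\<N> \<subseteq> L.ker"
  proof (rule null_subset_kernel[OF L.ker_is_submodule])
    have "L r = \<zero>\<^bsub>Z\<^esub>" if "r \<in> tensor_relators K V W" for r
      using that \<beta> by (cases r rule: relators_cases)
        (simp_all add: gen gen_carrier module_hom_def bilinear_map_def \<beta>_in Z.M.r_neg a_minus_def)
    then show "tensor_relators K V W \<subseteq> L.ker"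
      using relators_carrier by (auto simp: L.ker_def)
  qed
  then have lift: "tensor_lift K V W Z \<beta> (coset z) = L z" if "z \<in> carrier \<P>" for z
  proof -
    have "(SOME z'. z' \<in> coset z) \<in> coset z"
      by (rule someI[of "\<lambda>z'. z' \<in> coset z"]) (rule Q.a_rcos_self[OF that])
    then obtain n where "n \<in> \<N>" "(SOME z'. z' \<in> coset z) = n \<oplus>\<^bsub>\<P>\<^esub> z"
      by (auto simp: a_r_coset_def')
    moreover from this have "n \<in> carrier \<P>" "L n = \<zero>\<^bsub>Z\<^esub>"
      using \<open>\<N> \<subseteq> L.ker\<close> by (auto simp: L.ker_def)
    ultimately show ?thesis
      using that by (simp add: tensor_lift_def L_def[symmetric])
  qed
  show "x \<in> carrier \<T> \<Longrightarrow> tensor_lift K V W Z \<beta> x \<in> carrier Z"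
    by (auto simp: tensor_carrier lift)
  show "\<lbrakk>x \<in> carrier \<T>; y \<in> carrier \<T>\<rbrakk> \<Longrightarrow>
      tensor_lift K V W Z \<beta> (x \<oplus>\<^bsub>\<T>\<^esub> y) = tensor_lift K V W Z \<beta> x \<oplus>\<^bsub>Z\<^esub> tensor_lift K V W Z \<beta> y"
    by (auto simp: tensor_carrier tensor_add lift)
  show "\<lbrakk>v \<in> carrier V; w \<in> carrier W\<rbrakk> \<Longrightarrow> tensor_lift K V W Z \<beta> (v \<star> w) = \<beta> v w"
    by (simp add: pure_tensor_def lift gen_carrier gen)
qed

end

text \<open>The map on free spaces sends a relator to a relator of the same kind, so the preimage of
  the target's null space is a submodule containing the source's null space. All cosets in the
  defining union then coincide, and the union over the nonempty source coset is a single
  coset.\<close>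

lemma tensor_map:
  assumes "vectorspace K V" "vectorspace K W" "vectorspace K V'" "vectorspace K W'"
    and f: "f \<in> module_hom K V V'" and g: "g \<in> module_hom K W W'"
  defines "M \<equiv> tensor_map K V W V' W' f g"
  shows tensor_map_carrier: "x \<in> carrier (tensor K V W) \<Longrightarrow> M x \<in> carrier (tensor K V' W')"
    and tensor_map_add: "\<lbrakk>x \<in> carrier (tensor K V W); y \<in> carrier (tensor K V W)\<rbrakk> \<Longrightarrow>
      M (x \<oplus>\<^bsub>tensor K V W\<^esub> y) = M x \<oplus>\<^bsub>tensor K V' W'\<^esub> M y"
    and tensor_map_pure: "\<lbrakk>v \<in> carrier V; w \<in> carrier W\<rbrakk> \<Longrightarrow>
      M (pure_tensor K V W v w) = pure_tensor K V' W' (f v) (g w)"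
proof -
  interpret A: tensor_product K V W using assms by (simp add: tensor_product_def)
  interpret B: tensor_product K V' W' using assms by (simp add: tensor_product_def)
  define L where "L = free_map K (carrier V \<times> carrier W) (carrier V' \<times> carrier W') (map_prod f g)"
  have fg: "map_prod f g \<in> carrier V \<times> carrier W \<rightarrow> carrier V' \<times> carrier W'"
    using f g by (auto simp: module_hom_def)
  have f_in: "\<And>v. v \<in> carrier V \<Longrightarrow> f v \<in> carrier V'" and g_in: "\<And>w. w \<in> carrier W \<Longrightarrow> g w \<in> carrier W'"
    using fg f g by (auto simp: module_hom_def)
  have hom: "L \<in> module_hom K A.\<P> B.\<P>"
    unfolding L_def tensor_free_def by (rule A.V.free_map_hom[OF fg])
  interpret L: mod_hom K A.\<P> B.\<P> L
    by (unfold_locales) (fact hom)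
  have gen: "L (A.gen v w) = B.gen (f v) (g w)" if "v \<in> carrier V" "w \<in> carrier W" for v w
    unfolding L_def using that by (subst A.V.free_map_gen[OF fg]) auto
  interpret N': submodule K B.\<N> B.\<P> by (rule B.null_submodule)
  have "A.\<N> \<subseteq> {z \<in> carrier A.\<P>. L z \<in> B.\<N>}"
  proof (rule A.null_subset_kernel)
    show "submodule K {z \<in> carrier A.\<P>. L z \<in> B.\<N>} A.\<P>"
      by unfold_locales auto
    have "L r \<in> tensor_relators K V' W'" if "r \<in> tensor_relators K V W" for r
    proof -
      from that show ?thesis
      proof (cases r rule: A.relators_cases)
        case (add_left v v' w)
        then show ?thesis
          using B.relators_intros(1)[of "f v" "f v'" "g w"] f_in g_in
          by (simp add: gen A.gen_carrier module_hom_add[OF f])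
      next
        case (add_right v w w')
        then show ?thesis
          using B.relators_intros(2)[of "f v" "g w" "g w'"] f_in g_in
          by (simp add: gen A.gen_carrier module_hom_add[OF g])
      next
        case (smult_left k v w)
        then show ?thesis
          using B.relators_intros(3)[of k "f v" "g w"] f_in g_in
          by (simp add: gen A.gen_carrier module_hom_smult[OF f])
      next
        case (smult_right k v w)
        then show ?thesis
          using B.relators_intros(4)[of k "f v" "g w"] f_in g_in
          by (simp add: gen A.gen_carrier module_hom_smult[OF g])
      qed
    qed
    then show "tensor_relators K V W \<subseteq> {z \<in> carrier A.\<P>. L z \<in> B.\<N>}"
      using A.relators_carrier B.relators_null by auto
  qed
  then have M: "M (A.coset z) = B.coset (L z)" if "z \<in> carrier A.\<P>" for z
  proof -
    have "B.coset (L z') = B.coset (L z)" if "z' \<in> A.coset z" for z'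
    proof -
      obtain n where n: "n \<in> A.\<N>" "z' = n \<oplus>\<^bsub>A.\<P>\<^esub> z"
        using \<open>z' \<in> A.coset z\<close> by (auto simp: a_r_coset_def')
      then have "n \<in> carrier A.\<P>" "L n \<in> B.\<N>" "L n \<in> carrier B.\<P>"
        using \<open>A.\<N> \<subseteq> {z \<in> carrier A.\<P>. L z \<in> B.\<N>}\<close> by auto
      then have "L z' \<in> B.coset (L z)"
        using n \<open>z \<in> carrier A.\<P>\<close> by (auto simp: a_r_coset_def')
      then show ?thesis
        using B.Q.a_repr_independence'[of "L z'" "L z"] \<open>z \<in> carrier A.\<P>\<close> by simp
    qed
    then have "(\<Union>z'\<in>A.coset z. B.coset (L z')) = (\<Union>z'\<in>A.coset z. B.coset (L z))"
      by auto
    then show ?thesis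
      using A.Q.a_rcos_self[OF that] by (auto simp: M_def tensor_map_def L_def)
  qed
  show "x \<in> carrier A.\<T> \<Longrightarrow> M x \<in> carrier B.\<T>"
    by (auto simp: A.tensor_carrier B.tensor_carrier M)
  show "\<lbrakk>x \<in> carrier A.\<T>; y \<in> carrier A.\<T>\<rbrakk> \<Longrightarrow> M (x \<oplus>\<^bsub>A.\<T>\<^esub> y) = M x \<oplus>\<^bsub>B.\<T>\<^esub> M y"
    by (auto simp: A.tensor_carrier A.tensor_add B.tensor_add M)
  show "\<lbrakk>v \<in> carrier V; w \<in> carrier W\<rbrakk> \<Longrightarrow> M (pure_tensor K V W v w) = pure_tensor K V' W' (f v) (g w)"
    by (simp add: pure_tensor_def M A.gen_carrier gen)
qed

section \<open>Extension of scalars\<close>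

lemma ext_as_vs_vectorspace:
  assumes "field F" "field F'" "\<phi> \<in> ring_hom F F'"
  shows "vectorspace F (ext_as_vs F' \<phi>)"
proof -
  interpret F: field F by fact
  interpret F': field F' by fact
  show ?thesis
    using assms ring_hom_closed[OF assms(3)]
    by (intro vs_criteria)
      (auto simp: ext_as_vs_def F'.a_ac F'.m_assoc ring_hom_add ring_hom_mult ring_hom_one
        F'.l_distr F'.r_distr intro: bexI[of _ "\<ominus>\<^bsub>F'\<^esub> v" for v] F'.r_neg)
qed

locale scalar_extension = F': field F' + tensor_product F V "ext_as_vs F' \<phi>"
  for F :: "('f, 'l) ring_scheme" and F' :: "('g, 'l') ring_scheme" and \<phi> :: "'f \<Rightarrow> 'g"
    and V :: "('f, 'v) module" +
  assumes \<phi>_hom: "\<phi> \<in> ring_hom F F'"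
begin

abbreviation "E \<equiv> ext_as_vs F' \<phi>"
abbreviation "VE \<equiv> ext_scalars F F' \<phi> V"
abbreviation ext_pure (infixl \<open>\<star>\<close> 72) where "v \<star> t \<equiv> pure_tensor F V E v t"

lemma E_simps [simp]:
  "carrier E = carrier F'" "x \<oplus>\<^bsub>E\<^esub> y = x \<oplus>\<^bsub>F'\<^esub> y" "\<zero>\<^bsub>E\<^esub> = \<zero>\<^bsub>F'\<^esub>" "a \<odot>\<^bsub>E\<^esub> b = \<phi> a \<otimes>\<^bsub>F'\<^esub> b"
  by (simp_all add: ext_as_vs_def)

lemma VE_simps [simp]:
  "carrier VE = carrier \<T>" "x \<oplus>\<^bsub>VE\<^esub> y = x \<oplus>\<^bsub>\<T>\<^esub> y" "\<zero>\<^bsub>VE\<^esub> = \<zero>\<^bsub>\<T>\<^esub>"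
  by (simp_all add: ext_scalars_def Let_def)

lemma \<phi>_closed [simp]: "a \<in> carrier F \<Longrightarrow> \<phi> a \<in> carrier F'"
  using \<phi>_hom by (rule ring_hom_closed)

lemma mult_hom: "c \<in> carrier F' \<Longrightarrow> (\<lambda>b. c \<otimes>\<^bsub>F'\<^esub> b) \<in> module_hom F E E"
  by (auto simp: module_hom_def F'.r_distr F'.m_lcomm)

lemma id_hom: "id \<in> module_hom F V V"
  by (auto simp: module_hom_def)

lemma smult_eq: "c \<odot>\<^bsub>VE\<^esub> x = tensor_map F V E V E id (\<lambda>b. c \<otimes>\<^bsub>F'\<^esub> b) x"
  by (simp add: ext_scalars_def Let_def)

lemmas smult_tensor_map =
  tensor_map[OF V.vectorspace_axioms W.vectorspace_axioms V.vectorspace_axioms W.vectorspace_axioms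
    id_hom mult_hom, folded smult_eq]

lemma smult_carrier: "\<lbrakk>c \<in> carrier F'; x \<in> carrier \<T>\<rbrakk> \<Longrightarrow> c \<odot>\<^bsub>VE\<^esub> x \<in> carrier \<T>"
  by (rule smult_tensor_map(1))

lemma smult_add: "\<lbrakk>c \<in> carrier F'; x \<in> carrier \<T>; y \<in> carrier \<T>\<rbrakk> \<Longrightarrow>
    c \<odot>\<^bsub>VE\<^esub> (x \<oplus>\<^bsub>\<T>\<^esub> y) = c \<odot>\<^bsub>VE\<^esub> x \<oplus>\<^bsub>\<T>\<^esub> c \<odot>\<^bsub>VE\<^esub> y"
  by (rule smult_tensor_map(2))

lemma smult_pure: "\<lbrakk>c \<in> carrier F'; v \<in> carrier V; t \<in> carrier F'\<rbrakk> \<Longrightarrow>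
    c \<odot>\<^bsub>VE\<^esub> (v \<star> t) = v \<star> (c \<otimes>\<^bsub>F'\<^esub> t)"
  using smult_tensor_map(3)[of c v t] by simp

text \<open>Nothing is asked of \<open>Z\<close> beyond having an addition, so the same rule
  compares maps into tensor products, into \<open>V\<close> and into \<open>F'\<close>.\<close>

lemma additive_eqI:
  assumes "x \<in> carrier \<T>"
    and "\<And>x y. \<lbrakk>x \<in> carrier \<T>; y \<in> carrier \<T>\<rbrakk> \<Longrightarrow> f (x \<oplus>\<^bsub>\<T>\<^esub> y) = f x \<oplus>\<^bsub>Z\<^esub> f y"
    and "\<And>x y. \<lbrakk>x \<in> carrier \<T>; y \<in> carrier \<T>\<rbrakk> \<Longrightarrow> g (x \<oplus>\<^bsub>\<T>\<^esub> y) = g x \<oplus>\<^bsub>Z\<^esub> g y"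
    and "\<And>v t. \<lbrakk>v \<in> carrier V; t \<in> carrier F'\<rbrakk> \<Longrightarrow> f (v \<star> t) = g (v \<star> t)"
  shows "f x = g x"
  using assms(1) by (induction rule: tensor_induct) (simp_all add: assms)

text \<open>Both sides of each scalar law are additive in the tensor. This leaves pure tensors,
  where the law is one of multiplication in \<open>F'\<close> on the right factor.\<close>

lemma ext_vectorspace: "vectorspace F' VE"
proof -
  have "c \<odot>\<^bsub>VE\<^esub> x \<oplus>\<^bsub>\<T>\<^esub> d \<odot>\<^bsub>VE\<^esub> x = (c \<oplus>\<^bsub>F'\<^esub> d) \<odot>\<^bsub>VE\<^esub> x"
    if "c \<in> carrier F'" "d \<in> carrier F'" "x \<in> carrier \<T>" for c d x
    using that(3) by (rule additive_eqI[where Z = \<T>])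
      (auto simp: smult_add smult_carrier smult_pure F'.l_distr pure_add_right[symmetric] T.a_ac that)
  moreover have "(c \<otimes>\<^bsub>F'\<^esub> d) \<odot>\<^bsub>VE\<^esub> x = c \<odot>\<^bsub>VE\<^esub> (d \<odot>\<^bsub>VE\<^esub> x)"
    if "c \<in> carrier F'" "d \<in> carrier F'" "x \<in> carrier \<T>" for c d x
    using that(3) by (rule additive_eqI[where Z = \<T>])
      (auto simp: smult_add smult_carrier smult_pure F'.m_assoc that)
  moreover have "\<one>\<^bsub>F'\<^esub> \<odot>\<^bsub>VE\<^esub> x = x" if "x \<in> carrier \<T>" for x
    using that by (rule additive_eqI[where Z = \<T>]) (auto simp: smult_add smult_pure)
  ultimately show ?thesis
    by (intro vs_criteria)
      (auto simp: F'.field_axioms smult_add smult_carrier T.a_ac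
        intro: bexI[of _ "\<ominus>\<^bsub>\<T>\<^esub> x" for x] T.r_neg)
qed

sublocale VE: vectorspace F' VE
  by (rule ext_vectorspace)

text \<open>The base change of the form \<open>g\<close>, that is \<open>g \<otimes> id\<close>
  followed by the identification of F \<otimes> F' with F'.\<close>

abbreviation "ext_form g \<equiv> tensor_lift F V E E (\<lambda>v t. \<phi> (g v) \<otimes>\<^bsub>F'\<^esub> t)"

lemma ext_form:
  assumes g: "linear_form F V g"
  shows linear_form_ext_form: "linear_form F' VE (ext_form g)"
    and ext_form_pure: "\<lbrakk>v \<in> carrier V; t \<in> carrier F'\<rbrakk> \<Longrightarrow> ext_form g (v \<star> t) = \<phi> (g v) \<otimes>\<^bsub>F'\<^esub> t"
proof -
  have "bilinear_map F V E E (\<lambda>v t. \<phi> (g v) \<otimes>\<^bsub>F'\<^esub> t)"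
    using g by (auto simp: bilinear_map_def module_hom_def linear_form_def Pi_iff F'.r_distr F'.l_distr
      ring_hom_add[OF \<phi>_hom] ring_hom_mult[OF \<phi>_hom] F'.m_assoc F'.m_lcomm)
  note L = tensor_lift[OF W.vectorspace_axioms this]
  show pure: "\<lbrakk>v \<in> carrier V; t \<in> carrier F'\<rbrakk> \<Longrightarrow> ext_form g (v \<star> t) = \<phi> (g v) \<otimes>\<^bsub>F'\<^esub> t" for v t
    using L(3) by simp
  have \<phi>g: "\<phi> (g v) \<in> carrier F'" if "v \<in> carrier V" for v
    using g that by (auto simp: linear_form_def Pi_iff)
  have "ext_form g (c \<odot>\<^bsub>VE\<^esub> x) = c \<otimes>\<^bsub>F'\<^esub> ext_form g x"
    if "c \<in> carrier F'" "x \<in> carrier \<T>" for c x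
    using that(2) by (rule additive_eqI[where Z = F'])
      (use L(1,2) that(1) in \<open>auto simp: smult_add smult_carrier smult_pure pure \<phi>g F'.r_distr F'.m_lcomm\<close>)
  then show "linear_form F' VE (ext_form g)"
    using L(1,2) by (auto simp: linear_form_def)
qed

text \<open>The map \<open>id \<otimes> l\<close> from \<open>V \<otimes> F'\<close> to \<open>V \<otimes> F = V\<close>.\<close>

abbreviation "slice l \<equiv> tensor_lift F V E V (\<lambda>v t. l t \<odot>\<^bsub>V\<^esub> v)"

lemma slice:
  assumes l: "linear_form F E l"
  shows slice_carrier: "x \<in> carrier \<T> \<Longrightarrow> slice l x \<in> carrier V"
    and slice_add: "\<lbrakk>x \<in> carrier \<T>; y \<in> carrier \<T>\<rbrakk> \<Longrightarrow> slice l (x \<oplus>\<^bsub>\<T>\<^esub> y) = slice l x \<oplus>\<^bsub>V\<^esub> slice l y"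
    and slice_pure: "\<lbrakk>v \<in> carrier V; t \<in> carrier F'\<rbrakk> \<Longrightarrow> slice l (v \<star> t) = l t \<odot>\<^bsub>V\<^esub> v"
proof -
  have "bilinear_map F V E V (\<lambda>v t. l t \<odot>\<^bsub>V\<^esub> v)"
    using l by (auto simp: bilinear_map_def module_hom_def linear_form_def Pi_iff
      V.smult_l_distr V.smult_r_distr V.smult_assoc1[symmetric] V.m_comm)
  note L = tensor_lift[OF V.vectorspace_axioms this]
  show "x \<in> carrier \<T> \<Longrightarrow> slice l x \<in> carrier V"
    and "\<lbrakk>x \<in> carrier \<T>; y \<in> carrier \<T>\<rbrakk> \<Longrightarrow> slice l (x \<oplus>\<^bsub>\<T>\<^esub> y) = slice l x \<oplus>\<^bsub>V\<^esub> slice l y"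
    and "\<lbrakk>v \<in> carrier V; t \<in> carrier F'\<rbrakk> \<Longrightarrow> slice l (v \<star> t) = l t \<odot>\<^bsub>V\<^esub> v"
    using L by simp_all
qed

end

lemma scalar_extensionI:
  assumes "field F" "field F'" "\<phi> \<in> ring_hom F F'" "vectorspace F V"
  shows "scalar_extension F F' \<phi> V"
  using assms ext_as_vs_vectorspace[OF assms(1-3)]
  by (simp add: scalar_extension_def scalar_extension_axioms_def tensor_product_def)

lemma (in vect_rep) VMor_carrier: "\<lbrakk>f \<in> Mor X; v \<in> carrier (VObj R (Dom X f))\<rbrakk> \<Longrightarrow> VMor R f v \<in> carrier (VObj R (Cod X f))"
  using VMor_hom by (rule module_hom_carrier)

section \<open>Base change of a representation\<close>

locale rep_extension = vect_rep X F R + F': field F'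
  for X :: "('o, 'm) category" and F :: "('f, 'l) ring_scheme"
    and R :: "('o, 'm, 'f, 'v) vect_functor" and F' :: "('g, 'l') ring_scheme" +
  fixes \<phi> :: "'f \<Rightarrow> 'g"
  assumes hom: "\<phi> \<in> ring_hom F F'"
begin

abbreviation "R' \<equiv> rep_ext_scalars X F F' \<phi> R"
abbreviation "ten x \<equiv> pure_tensor F (VObj R x) (ext_as_vs F' \<phi>)"

lemma VObj_ext: "VObj R' x = ext_scalars F F' \<phi> (VObj R x)"
  by (simp add: rep_ext_scalars_def Let_def)

lemma scalar_extension: "x \<in> Obj X \<Longrightarrow> scalar_extension F F' \<phi> (VObj R x)"
  by (intro scalar_extensionI field_axioms F'.field_axioms hom VObj_vectorspace)

lemma VMor_ext:
  assumes f: "f \<in> Mor X"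
  shows VMor_ext_carrier: "w \<in> carrier (VObj R' (Dom X f)) \<Longrightarrow> VMor R' f w \<in> carrier (VObj R' (Cod X f))"
    and VMor_ext_add: "\<lbrakk>w \<in> carrier (VObj R' (Dom X f)); w' \<in> carrier (VObj R' (Dom X f))\<rbrakk> \<Longrightarrow>
      VMor R' f (w \<oplus>\<^bsub>VObj R' (Dom X f)\<^esub> w') = VMor R' f w \<oplus>\<^bsub>VObj R' (Cod X f)\<^esub> VMor R' f w'"
    and VMor_ext_pure: "\<lbrakk>v \<in> carrier (VObj R (Dom X f)); t \<in> carrier F'\<rbrakk> \<Longrightarrow>
      VMor R' f (ten (Dom X f) v t) = ten (Cod X f) (VMor R f v) t"
proof -
  interpret A: scalar_extension F F' \<phi> "VObj R (Dom X f)"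
    using f by (intro scalar_extension Dom_in)
  interpret B: scalar_extension F F' \<phi> "VObj R (Cod X f)"
    using f by (intro scalar_extension Cod_in)
  have eq: "VMor R' f = tensor_map F (VObj R (Dom X f)) A.E (VObj R (Cod X f)) A.E (VMor R f) id"
    by (simp add: rep_ext_scalars_def Let_def)
  have "id \<in> module_hom F A.E A.E"
    by (auto simp: module_hom_def)
  note L = tensor_map[OF A.V.vectorspace_axioms A.W.vectorspace_axioms B.V.vectorspace_axioms
      A.W.vectorspace_axioms VMor_hom[OF f] this, folded eq]
  show "w \<in> carrier (VObj R' (Dom X f)) \<Longrightarrow> VMor R' f w \<in> carrier (VObj R' (Cod X f))"
    and "\<lbrakk>w \<in> carrier (VObj R' (Dom X f)); w' \<in> carrier (VObj R' (Dom X f))\<rbrakk> \<Longrightarrow>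
      VMor R' f (w \<oplus>\<^bsub>VObj R' (Dom X f)\<^esub> w') = VMor R' f w \<oplus>\<^bsub>VObj R' (Cod X f)\<^esub> VMor R' f w'"
    and "\<lbrakk>v \<in> carrier (VObj R (Dom X f)); t \<in> carrier F'\<rbrakk> \<Longrightarrow>
      VMor R' f (ten (Dom X f) v t) = ten (Cod X f) (VMor R f v) t"
    using L by (simp_all add: VObj_ext)
qed

sublocale ext: vect_rep X F' R'
proof (intro vect_rep.intro category_axioms F'.field_axioms vect_rep_axioms.intro, goal_cases)
  case (1 x)
  then show ?case
    unfolding VObj_ext by (intro scalar_extension.ext_vectorspace scalar_extension)
next
  case (2 f)
  interpret A: scalar_extension F F' \<phi> "VObj R (Dom X f)"
    using 2 by (intro scalar_extension Dom_in)
  interpret B: scalar_extension F F' \<phi> "VObj R (Cod X f)"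
    using 2 by (intro scalar_extension Cod_in)
  note L = VMor_ext[OF 2, unfolded VObj_ext, simplified]
  have "VMor R' f (c \<odot>\<^bsub>A.VE\<^esub> x) = c \<odot>\<^bsub>B.VE\<^esub> VMor R' f x"
    if "c \<in> carrier F'" "x \<in> carrier A.\<T>" for c x
    using that(2) by (rule A.additive_eqI[where Z = B.\<T>])
      (simp_all add: L A.smult_add A.smult_carrier A.smult_pure B.smult_add B.smult_pure
        VMor_carrier 2 that(1))
  then show ?case
    unfolding VObj_ext by (auto simp: module_hom_def L)
next
  case (3 x w)
  interpret A: scalar_extension F F' \<phi> "VObj R x"
    using 3 by (intro scalar_extension)
  note L = VMor_ext[OF Id_in, unfolded VObj_ext, simplified, of x]
  show ?case
    using 3(2) unfolding VObj_ext A.VE_simps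
    by (rule A.additive_eqI[where Z = A.\<T>]) (use L 3(1) VMor_Id in \<open>simp_all add: Dom_Id Cod_Id\<close>)
next
  case (4 f g w)
  interpret A: scalar_extension F F' \<phi> "VObj R (Dom X f)"
    using 4 by (intro scalar_extension Dom_in)
  interpret B: scalar_extension F F' \<phi> "VObj R (Cod X f)"
    using 4 by (intro scalar_extension Cod_in)
  interpret C: scalar_extension F F' \<phi> "VObj R (Cod X g)"
    using 4 by (intro scalar_extension Cod_in)
  have gf: "g \<cdot>\<^bsub>X\<^esub> f \<in> Mor X" "Dom X (g \<cdot>\<^bsub>X\<^esub> f) = Dom X f" "Cod X (g \<cdot>\<^bsub>X\<^esub> f) = Cod X g"
    using 4 by (auto simp: Comp_in Dom_Comp Cod_Comp)
  note Lf = VMor_ext[OF 4(1), unfolded VObj_ext, simplified]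
  note Lg = VMor_ext[OF 4(2), unfolded VObj_ext 4(3), simplified]
  note Lgf = VMor_ext[OF gf(1), unfolded VObj_ext gf, simplified]
  show ?case
    using 4(4) unfolding VObj_ext A.VE_simps
    by (rule A.additive_eqI[where Z = C.\<T>])
      (simp_all add: Lf Lg Lgf VMor_carrier 4(1-3) VMor_Comp)
qed

end

section \<open>Retracts of representations\<close>

text \<open>Replaces the notion of direct summand: no complement is named, the two representations
  may have different carrier types, and retractions compose.\<close>

locale rep_retraction =
  fixes X :: "('o, 'm) category" and K :: "('k, 'l) ring_scheme"
    and R :: "('o, 'm, 'k, 'v) vect_functor" and T :: "('o, 'm, 'k, 'w) vect_functor"
    and i :: "'o \<Rightarrow> 'v \<Rightarrow> 'w" and p :: "'o \<Rightarrow> 'w \<Rightarrow> 'v"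
  assumes i_hom: "x \<in> Obj X \<Longrightarrow> i x \<in> module_hom K (VObj R x) (VObj T x)"
    and p_hom: "x \<in> Obj X \<Longrightarrow> p x \<in> module_hom K (VObj T x) (VObj R x)"
    and p_i: "\<lbrakk>x \<in> Obj X; v \<in> carrier (VObj R x)\<rbrakk> \<Longrightarrow> p x (i x v) = v"
    and i_nat: "\<lbrakk>f \<in> Mor X; v \<in> carrier (VObj R (Dom X f))\<rbrakk> \<Longrightarrow>
      i (Cod X f) (VMor R f v) = VMor T f (i (Dom X f) v)"
    and p_nat: "\<lbrakk>f \<in> Mor X; w \<in> carrier (VObj T (Dom X f))\<rbrakk> \<Longrightarrow>
      p (Cod X f) (VMor T f w) = VMor R f (p (Dom X f) w)"
begin

lemmas i_carrier = module_hom_carrier[OF i_hom]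
lemmas p_carrier = module_hom_carrier[OF p_hom]

end

definition rep_retract ::
  "('o, 'm) category \<Rightarrow> ('k, 'l) ring_scheme \<Rightarrow>
   ('o, 'm, 'k, 'v) vect_functor \<Rightarrow> ('o, 'm, 'k, 'w) vect_functor \<Rightarrow> bool" where
  "rep_retract X K R T \<longleftrightarrow> (\<exists>i p. rep_retraction X K R T i p)"

lemma (in category) rep_retract_trans:
  assumes "rep_retract X K R T" "rep_retract X K T U"
  shows "rep_retract X K R U"
proof -
  obtain i p where "rep_retraction X K R T i p"
    using assms(1) unfolding rep_retract_def by blast
  then interpret A: rep_retraction X K R T i p .
  obtain j q where "rep_retraction X K T U j q"
    using assms(2) unfolding rep_retract_def by blast
  then interpret B: rep_retraction X K T U j q .
  have "rep_retraction X K R U (\<lambda>x v. j x (i x v)) (\<lambda>x v. p x (q x v))"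
    by unfold_locales
      (simp_all add: module_hom_comp[OF A.i_hom B.i_hom] module_hom_comp[OF B.p_hom A.p_hom] Dom_in
        A.i_carrier B.p_carrier A.p_i B.p_i A.i_nat B.i_nat A.p_nat B.p_nat)
  then show ?thesis
    unfolding rep_retract_def by blast
qed

text \<open>Only \<open>R\<close> has to be a representation. The laws for the inverse \<theta>
  follow by applying \<eta> to the expected value in \<open>R\<close> and cancelling with \<theta>,
  which uses no property of \<open>T\<close> of its own.\<close>

lemma (in vect_rep) rep_retract_iso:
  assumes "rep_isomorphic X K R T"
  shows "rep_retract X K R T" and "rep_retract X K T R"
proof -
  obtain \<eta> where hom: "\<And>x. x \<in> Obj X \<Longrightarrow> \<eta> x \<in> module_hom K (VObj R x) (VObj T x)"
    and bij: "\<And>x. x \<in> Obj X \<Longrightarrow> bij_betw (\<eta> x) (carrier (VObj R x)) (carrier (VObj T x))"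
    and nat: "\<And>f v. \<lbrakk>f \<in> Mor X; v \<in> carrier (VObj R (Dom X f))\<rbrakk> \<Longrightarrow> \<eta> (Cod X f) (VMor R f v) = VMor T f (\<eta> (Dom X f) v)"
    using assms unfolding rep_isomorphic_def by metis
  define \<theta> where "\<theta> x = inv_into (carrier (VObj R x)) (\<eta> x)" for x
  have \<theta>\<eta>: "\<theta> x (\<eta> x v) = v" if "x \<in> Obj X" "v \<in> carrier (VObj R x)" for x v
    using bij_betw_inv_into_left[OF bij] that by (simp add: \<theta>_def)
  have \<eta>\<theta>: "\<eta> x (\<theta> x w) = w" if "x \<in> Obj X" "w \<in> carrier (VObj T x)" for x w
    using bij_betw_inv_into_right[OF bij] that by (simp add: \<theta>_def)
  have \<theta>_in: "\<theta> x w \<in> carrier (VObj R x)" if "x \<in> Obj X" "w \<in> carrier (VObj T x)" for x w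
    using bij[OF that(1)] that(2) by (auto simp: \<theta>_def bij_betw_def inv_into_into)
  have \<theta>_hom: "\<theta> x \<in> module_hom K (VObj T x) (VObj R x)" if x: "x \<in> Obj X" for x
  proof -
    interpret V: vectorspace K "VObj R x" using x by (rule VObj_vectorspace)
    have "\<theta> x (v \<oplus>\<^bsub>VObj T x\<^esub> w) = \<theta> x v \<oplus>\<^bsub>VObj R x\<^esub> \<theta> x w"
      if "v \<in> carrier (VObj T x)" "w \<in> carrier (VObj T x)" for v w
      using \<theta>\<eta>[OF x, of "\<theta> x v \<oplus>\<^bsub>VObj R x\<^esub> \<theta> x w"] that x
      by (simp add: module_hom_add[OF hom] \<eta>\<theta> \<theta>_in)
    moreover have "\<theta> x (k \<odot>\<^bsub>VObj T x\<^esub> v) = k \<odot>\<^bsub>VObj R x\<^esub> \<theta> x v"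
      if "k \<in> carrier K" "v \<in> carrier (VObj T x)" for k v
      using \<theta>\<eta>[OF x, of "k \<odot>\<^bsub>VObj R x\<^esub> \<theta> x v"] that x
      by (simp add: module_hom_smult[OF hom] \<eta>\<theta> \<theta>_in)
    ultimately show ?thesis
      by (auto simp: module_hom_def \<theta>_in x)
  qed
  have \<theta>_nat: "\<theta> (Cod X f) (VMor T f w) = VMor R f (\<theta> (Dom X f) w)"
    if "f \<in> Mor X" "w \<in> carrier (VObj T (Dom X f))" for f w
    using nat[of f "\<theta> (Dom X f) w"] \<theta>\<eta>[of "Cod X f" "VMor R f (\<theta> (Dom X f) w)"] that
    by (simp add: \<eta>\<theta> \<theta>_in Dom_in Cod_in VMor_carrier)
  have "rep_retraction X K R T \<eta> \<theta>" "rep_retraction X K T R \<theta> \<eta>"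
    by (unfold_locales; simp add: hom nat \<theta>_hom \<theta>_nat \<theta>\<eta> \<eta>\<theta>)+
  then show "rep_retract X K R T" "rep_retract X K T R"
    unfolding rep_retract_def by blast+
qed

lemma rep_plus_simps:
  "VObj (rep_plus R R') x = direct_sum (VObj R x) (VObj R' x)"
  "VMor (rep_plus R R') f = map_prod (VMor R f) (VMor R' f)"
  by (simp_all add: rep_plus_def)

lemma direct_sum_simps:
  "carrier (direct_sum V W) = carrier V \<times> carrier W"
  "a \<oplus>\<^bsub>direct_sum V W\<^esub> b = (fst a \<oplus>\<^bsub>V\<^esub> fst b, snd a \<oplus>\<^bsub>W\<^esub> snd b)"
  "k \<odot>\<^bsub>direct_sum V W\<^esub> a = (k \<odot>\<^bsub>V\<^esub> fst a, k \<odot>\<^bsub>W\<^esub> snd a)"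
  by (simp_all add: direct_sum_def)

lemma rep_retract_plus:
  assumes "vect_rep X K D" "vect_rep X K E"
  shows "rep_retract X K D (rep_plus D E)"
proof -
  interpret D: vect_rep X K D by fact
  interpret E: vect_rep X K E by fact
  have zero: "\<zero>\<^bsub>VObj E x\<^esub> \<in> carrier (VObj E x)" "\<zero>\<^bsub>VObj E x\<^esub> \<oplus>\<^bsub>VObj E x\<^esub> \<zero>\<^bsub>VObj E x\<^esub> = \<zero>\<^bsub>VObj E x\<^esub>"
    "k \<in> carrier K \<Longrightarrow> k \<odot>\<^bsub>VObj E x\<^esub> \<zero>\<^bsub>VObj E x\<^esub> = \<zero>\<^bsub>VObj E x\<^esub>" if "x \<in> Obj X" for x k
  proof -
    interpret V: vectorspace K "VObj E x" using that by (rule E.VObj_vectorspace)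
    show "\<zero>\<^bsub>VObj E x\<^esub> \<in> carrier (VObj E x)" "\<zero>\<^bsub>VObj E x\<^esub> \<oplus>\<^bsub>VObj E x\<^esub> \<zero>\<^bsub>VObj E x\<^esub> = \<zero>\<^bsub>VObj E x\<^esub>"
      "k \<in> carrier K \<Longrightarrow> k \<odot>\<^bsub>VObj E x\<^esub> \<zero>\<^bsub>VObj E x\<^esub> = \<zero>\<^bsub>VObj E x\<^esub>" by simp_all
  qed
  have VMor_zero: "VMor E f \<zero>\<^bsub>VObj E (Dom X f)\<^esub> = \<zero>\<^bsub>VObj E (Cod X f)\<^esub>" if "f \<in> Mor X" for f
    using that by (intro module_hom_zero[OF _ _ E.VMor_hom] abelian_group_vectorspace[OF E.VObj_vectorspace]
        D.Dom_in D.Cod_in)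
  have "rep_retraction X K D (rep_plus D E) (\<lambda>x v. (v, \<zero>\<^bsub>VObj E x\<^esub>)) (\<lambda>x. fst)"
    by unfold_locales (auto simp: module_hom_def rep_plus_simps direct_sum_simps zero VMor_zero)
  then show ?thesis
    unfolding rep_retract_def by blast
qed

lemma rep_sum_simps:
  "carrier (VObj (rep_sum I D) x) = (\<Pi>\<^sub>E i\<in>I. carrier (VObj (D i) x))"
  "v \<oplus>\<^bsub>VObj (rep_sum I D) x\<^esub> w = (\<lambda>i\<in>I. v i \<oplus>\<^bsub>VObj (D i) x\<^esub> w i)"
  "k \<odot>\<^bsub>VObj (rep_sum I D) x\<^esub> v = (\<lambda>i\<in>I. k \<odot>\<^bsub>VObj (D i) x\<^esub> v i)"
  "VMor (rep_sum I D) f v = (\<lambda>i\<in>I. VMor (D i) f (v i))"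
  by (simp_all add: rep_sum_def vs_sum_def)

lemma rep_retract_sum:
  assumes "\<And>i. i \<in> I \<Longrightarrow> rep_retract X K (D i) (T i)"
  shows "rep_retract X K (rep_sum I D) (rep_sum I T)"
proof -
  have "\<forall>i\<in>I. \<exists>j p. rep_retraction X K (D i) (T i) j p"
    using assms unfolding rep_retract_def by blast
  then obtain j p where jp: "\<And>i. i \<in> I \<Longrightarrow> rep_retraction X K (D i) (T i) (j i) (p i)"
    by metis
  note hom = rep_retraction.i_hom[OF jp, unfolded module_hom_def, simplified]
    rep_retraction.p_hom[OF jp, unfolded module_hom_def, simplified]
  note nat = rep_retraction.i_nat[OF jp] rep_retraction.p_nat[OF jp]
  have "rep_retraction X K (rep_sum I D) (rep_sum I T)
    (\<lambda>x v. \<lambda>i\<in>I. j i x (v i)) (\<lambda>x v. \<lambda>i\<in>I. p i x (v i))"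
  proof (unfold_locales, goal_cases)
    case (1 x)
    show ?case
      using hom(1)[OF _ 1] by (auto simp: module_hom_def rep_sum_simps PiE_iff Pi_iff)
  next
    case (2 x)
    show ?case
      using hom(2)[OF _ 2] by (auto simp: module_hom_def rep_sum_simps PiE_iff Pi_iff)
  next
    case (3 x v)
    then show ?case
      using rep_retraction.p_i[OF jp] by (intro ext) (auto simp: rep_sum_simps PiE_iff extensional_def)
  qed (auto simp: rep_sum_simps PiE_iff nat)
  then show ?thesis
    unfolding rep_retract_def by blast
qed

section \<open>Free representations and their finite direct sums\<close>

context set_rep begin

lemma SMor_in': "\<lbrakk>f \<in> Mor X; s \<in> SObj S (Dom X f)\<rbrakk> \<Longrightarrow> SMor S f s \<in> SObj S (Cod X f)"
  using SMor_in by (auto simp: Pi_iff)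

lemma free_rep_vect_rep:
  assumes "field K"
  shows "vect_rep X K (free_rep X K S)"
proof -
  interpret K: field K by fact
  show ?thesis
  proof (intro vect_rep.intro vect_rep_axioms.intro category_axioms assms, goal_cases)
    case (1 x)
    show ?case by (simp add: free_rep_def K.free_vs_vectorspace)
  next
    case (2 f)
    then show ?case by (simp add: free_rep_def K.free_map_hom SMor_in)
  next
    case (3 x v)
    interpret F: vectorspace K "free_vs K (SObj S x)" by (rule K.free_vs_vectorspace)
    have h: "SMor S (Id X x) \<in> SObj S x \<rightarrow> SObj S x"
      using 3 by (auto simp: SMor_Id)
    have "(\<lambda>v. v) \<in> module_hom K (free_vs K (SObj S x)) (free_vs K (SObj S x))"
      by (simp add: module_hom_def)
    then have "free_map K (SObj S x) (SObj S x) (SMor S (Id X x)) v = v"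
      using 3 by - (rule F.free_vs_hom_eqI[OF K.free_map_hom[OF h], where h = "\<lambda>v. v"],
          simp_all add: K.free_map_gen[OF h] SMor_Id free_rep_def)
    then show ?case
      using 3 by (simp add: free_rep_def Dom_Id Cod_Id)
  next
    case (4 f g v)
    interpret F: vectorspace K "free_vs K (SObj S (Cod X g))" by (rule K.free_vs_vectorspace)
    have f: "SMor S f \<in> SObj S (Dom X f) \<rightarrow> SObj S (Cod X f)"
      and g: "SMor S g \<in> SObj S (Cod X f) \<rightarrow> SObj S (Cod X g)"
      and gf: "SMor S (g \<cdot> f) \<in> SObj S (Dom X f) \<rightarrow> SObj S (Cod X g)"
      using 4 SMor_in[of f] SMor_in[of g] SMor_in[of "g \<cdot> f"] by (simp_all add: Comp_in Dom_Comp Cod_Comp)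
    have "free_map K (SObj S (Dom X f)) (SObj S (Cod X g)) (SMor S (g \<cdot> f)) v =
      free_map K (SObj S (Cod X f)) (SObj S (Cod X g)) (SMor S g)
        (free_map K (SObj S (Dom X f)) (SObj S (Cod X f)) (SMor S f) v)"
      using 4 SMor_in'[of f]
      by - (rule F.free_vs_hom_eqI[OF K.free_map_hom[OF gf] module_hom_comp[OF K.free_map_hom[OF f] K.free_map_hom[OF g]]],
          simp_all add: K.free_map_gen[OF f] K.free_map_gen[OF g] K.free_map_gen[OF gf] SMor_Comp free_rep_def)
    then show ?case
      using 4 by (simp add: free_rep_def Dom_Comp Cod_Comp)
  qed
qed

end

text \<open>The coproduct of set functors, with the index as a tag that no morphism changes. For a
  constant family it is the product of the index set with \<open>S\<close>, which is how descent
  uses it.\<close>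

definition set_sum ::
  "'i set \<Rightarrow> ('i \<Rightarrow> ('o, 'm, 's) set_functor) \<Rightarrow> ('o, 'm, 'i \<times> 's) set_functor" where
  "set_sum I S = \<lparr>SObj = (\<lambda>x. SIGMA i:I. SObj (S i) x), SMor = (\<lambda>f (i, s). (i, SMor (S i) f s))\<rparr>"

lemma set_rep_set_sum:
  assumes "category X" "\<And>i. i \<in> I \<Longrightarrow> set_rep X (S i)"
  shows "set_rep X (set_sum I S)"
proof -
  interpret category X by fact
  note S = set_rep.SMor_in'[OF assms(2)] set_rep.SMor_Id[OF assms(2)] set_rep.SMor_Comp[OF assms(2)]
  show ?thesis
    by (intro set_rep.intro set_rep_axioms.intro category_axioms) (auto simp: set_sum_def S)
qed

text \<open>Inclusion and projection are uncurrying and currying. Because \<open>I\<close> is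
  finite, a family of finitely supported functions is one finitely supported function on the
  disjoint union.\<close>

lemma rep_retract_free_sum:
  fixes S :: "'i \<Rightarrow> ('o, 'm, 's) set_functor" and K :: "('k, 'l) ring_scheme"
  assumes "field K" "finite I" "\<And>i. i \<in> I \<Longrightarrow> set_rep X (S i)" "category X"
  shows "rep_retract X K (rep_sum I (\<lambda>i. free_rep X K (S i))) (free_rep X K (set_sum I S))"
proof -
  interpret K: field K by fact
  interpret category X by fact
  define i where "i x v = (\<lambda>(i, s)\<in>(SIGMA i:I. SObj (S i) x). v i s)" for x and v :: "'i \<Rightarrow> 's \<Rightarrow> 'k"
  define p where "p x v = (\<lambda>i\<in>I. \<lambda>s\<in>SObj (S i) x. v (i, s))" for x and v :: "'i \<times> 's \<Rightarrow> 'k"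
  note simps = free_rep_def set_sum_def rep_sum_simps K.free_vs_simps
  have fin_i: "finite {a \<in> (SIGMA i:I. SObj (S i) x). (case a of (i, s) \<Rightarrow> v i s) \<noteq> \<zero>\<^bsub>K\<^esub>}"
    if "\<And>i. i \<in> I \<Longrightarrow> finite {s \<in> SObj (S i) x. v i s \<noteq> \<zero>\<^bsub>K\<^esub>}" for x and v :: "'i \<Rightarrow> 's \<Rightarrow> 'k"
    by (rule finite_subset[of _ "SIGMA i:I. {s \<in> SObj (S i) x. v i s \<noteq> \<zero>\<^bsub>K\<^esub>}"])
      (use that assms(2) in auto)
  have fin_p: "finite {s \<in> SObj (S i) x. v (i, s) \<noteq> \<zero>\<^bsub>K\<^esub>}"
    if "i \<in> I" "finite {a \<in> (SIGMA i:I. SObj (S i) x). v a \<noteq> \<zero>\<^bsub>K\<^esub>}" for x i and v :: "'i \<times> 's \<Rightarrow> 'k"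
    by (rule finite_subset[OF _ finite_imageI[OF that(2), of snd]]) (use that(1) in force)
  have "rep_retraction X K (rep_sum I (\<lambda>i. free_rep X K (S i))) (free_rep X K (set_sum I S)) i p"
  proof
    fix x assume x: "x \<in> Obj X"
    show "i x \<in> module_hom K (VObj (rep_sum I (\<lambda>i. free_rep X K (S i))) x) (VObj (free_rep X K (set_sum I S)) x)"
      by (auto simp: module_hom_def simps i_def PiE_iff fun_eq_iff restrict_def extensional_def intro!: fin_i cong: conj_cong)
    show "p x \<in> module_hom K (VObj (free_rep X K (set_sum I S)) x) (VObj (rep_sum I (\<lambda>i. free_rep X K (S i))) x)"
      by (auto simp: module_hom_def simps p_def PiE_iff fun_eq_iff restrict_def extensional_def intro: fin_p cong: conj_cong)
    show "p x (i x v) = v" if "v \<in> carrier (VObj (rep_sum I (\<lambda>i. free_rep X K (S i))) x)" for v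
      using that by (auto simp: simps p_def i_def PiE_iff fun_eq_iff restrict_def extensional_def)
  next
    fix f v assume f: "f \<in> Mor X" and v: "v \<in> carrier (VObj (rep_sum I (\<lambda>i. free_rep X K (S i))) (Dom X f))"
    have "i (Cod X f) (VMor (rep_sum I (\<lambda>i. free_rep X K (S i))) f v) (j, t)
      = VMor (free_rep X K (set_sum I S)) f (i (Dom X f) v) (j, t)" if "j \<in> I" "t \<in> SObj (S j) (Cod X f)" for j t
    proof -
      \<comment> \<open>The fibre of the sum functor over \<open>(j, t)\<close> stays within summand
        \<open>j\<close>: it is the image under \<open>Pair j\<close> of the fibre of
        \<open>SMor (S j) f\<close> over \<open>t\<close>. Reindexing along \<open>Pair j\<close>
        therefore matches the two coefficients.\<close>
      have "(\<Oplus>\<^bsub>K\<^esub>a\<in>Pair j ` {a \<in> SObj (S j) (Dom X f). SMor (S j) f a = t \<and> v j a \<noteq> \<zero>\<^bsub>K\<^esub>}. i (Dom X f) v a)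
        = (\<Oplus>\<^bsub>K\<^esub>a\<in>{a \<in> SObj (S j) (Dom X f). SMor (S j) f a = t \<and> v j a \<noteq> \<zero>\<^bsub>K\<^esub>}. i (Dom X f) v (j, a))"
        using v that by (intro K.finsum_reindex) (auto simp: inj_on_def simps i_def PiE_iff)
      also have "\<dots> = (\<Oplus>\<^bsub>K\<^esub>a\<in>{a \<in> SObj (S j) (Dom X f). SMor (S j) f a = t \<and> v j a \<noteq> \<zero>\<^bsub>K\<^esub>}. v j a)"
        using v that by (intro K.finsum_cong') (auto simp: simps i_def PiE_iff)
      finally have "(\<Oplus>\<^bsub>K\<^esub>a\<in>Pair j ` {a \<in> SObj (S j) (Dom X f). SMor (S j) f a = t \<and> v j a \<noteq> \<zero>\<^bsub>K\<^esub>}. i (Dom X f) v a)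
        = (\<Oplus>\<^bsub>K\<^esub>a\<in>{a \<in> SObj (S j) (Dom X f). SMor (S j) f a = t \<and> v j a \<noteq> \<zero>\<^bsub>K\<^esub>}. v j a)" .
      moreover have "Pair j ` {a \<in> SObj (S j) (Dom X f). SMor (S j) f a = t \<and> v j a \<noteq> \<zero>\<^bsub>K\<^esub>}
        = {a \<in> (SIGMA i:I. SObj (S i) (Dom X f)). (case a of (i, s) \<Rightarrow> (i, SMor (S i) f s)) = (j, t) \<and> i (Dom X f) v a \<noteq> \<zero>\<^bsub>K\<^esub>}"
        using that by (auto simp: i_def)
      ultimately show ?thesis
        using that by (simp add: simps free_map_def i_def[of "Cod X f"])
    qed
    then show "i (Cod X f) (VMor (rep_sum I (\<lambda>i. free_rep X K (S i))) f v)
      = VMor (free_rep X K (set_sum I S)) f (i (Dom X f) v)"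
      by (intro extensionalityI[of _ "SIGMA i:I. SObj (S i) (Cod X f)"])
        (auto simp: i_def simps free_map_def)
  next
    fix f v assume f: "f \<in> Mor X" and v: "v \<in> carrier (VObj (free_rep X K (set_sum I S)) (Dom X f))"
    have "free_map K (SIGMA i:I. SObj (S i) (Dom X f)) (SIGMA i:I. SObj (S i) (Cod X f)) (\<lambda>(i, s). (i, SMor (S i) f s)) v (j, t)
      = free_map K (SObj (S j) (Dom X f)) (SObj (S j) (Cod X f)) (SMor (S j) f) (p (Dom X f) v j) t"
      if "j \<in> I" "t \<in> SObj (S j) (Cod X f)" for j t
    proof -
      have "(\<Oplus>\<^bsub>K\<^esub>a\<in>Pair j ` {a \<in> SObj (S j) (Dom X f). SMor (S j) f a = t \<and> v (j, a) \<noteq> \<zero>\<^bsub>K\<^esub>}. v a)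
        = (\<Oplus>\<^bsub>K\<^esub>a\<in>{a \<in> SObj (S j) (Dom X f). SMor (S j) f a = t \<and> v (j, a) \<noteq> \<zero>\<^bsub>K\<^esub>}. v (j, a))"
        using v that by (intro K.finsum_reindex) (auto simp: inj_on_def simps PiE_iff)
      also have "\<dots> = (\<Oplus>\<^bsub>K\<^esub>a\<in>{a \<in> SObj (S j) (Dom X f). SMor (S j) f a = t \<and> p (Dom X f) v j a \<noteq> \<zero>\<^bsub>K\<^esub>}. p (Dom X f) v j a)"
        using v that by (intro K.finsum_cong') (auto simp: simps p_def PiE_iff)
      also have "Pair j ` {a \<in> SObj (S j) (Dom X f). SMor (S j) f a = t \<and> v (j, a) \<noteq> \<zero>\<^bsub>K\<^esub>}
        = {a \<in> (SIGMA i:I. SObj (S i) (Dom X f)). (case a of (i, s) \<Rightarrow> (i, SMor (S i) f s)) = (j, t) \<and> v a \<noteq> \<zero>\<^bsub>K\<^esub>}"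
        using that by auto
      finally show ?thesis
        using that by (simp add: free_map_def)
    qed
    then show "p (Cod X f) (VMor (free_rep X K (set_sum I S)) f v)
      = VMor (rep_sum I (\<lambda>i. free_rep X K (S i))) f (p (Dom X f) v)"
      by (auto simp: simps p_def[of "Cod X f"] fun_eq_iff restrict_def free_map_def[where A = "SObj _ _"])
  qed
  then show ?thesis
    unfolding rep_retract_def by blast
qed

lemma (in category) rep_retract_sum_free:
  fixes S :: "nat \<Rightarrow> ('o, 'm, 's) set_functor"
  assumes "field K" "\<And>i. i < n \<Longrightarrow> set_rep X (S i)" "\<And>i. i < n \<Longrightarrow> rep_retract X K (D i) (free_rep X K (S i))"
  shows "rep_retract X K (rep_sum {..<n} D) (free_rep X K (set_sum {..<n} S))"
  using assms
  by (intro rep_retract_trans[OF rep_retract_sum rep_retract_free_sum] category_axioms) auto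

text \<open>\<open>D i\<close> is a retract of \<open>rep_plus (D i) E\<close>, which is isomorphic
  to \<open>N i\<close> and so to a free representation; the sum over i is then collected on a
  disjoint union. The summand index becomes part of the elements, hence the type
  \<open>nat \<times> 's\<close>.\<close>

lemma realizable_imp_retract:
  fixes R :: "('o, 'm, 'k, 'v) vect_functor"
  assumes "vect_rep X K R" "additively_set_realizable TYPE('s) X K R"
  shows "\<exists>S :: ('o, 'm, nat \<times> 's) set_functor. set_rep X S \<and> rep_retract X K R (free_rep X K S)"
proof -
  interpret R: vect_rep X K R by fact
  obtain n and S :: "nat \<Rightarrow> ('o, 'm, 's) set_functor" and N D :: "nat \<Rightarrow> ('o, 'm, 'k, 's \<Rightarrow> 'k) vect_functor"
    where all: "\<forall>i<n. set_rep X (S i) \<and> vect_rep X K (N i) \<and> rep_isomorphic X K (N i) (free_rep X K (S i)) \<and>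
      direct_summand X K (D i) (N i)"
    and R: "rep_isomorphic X K R (rep_sum {..<n} D)"
    using assms(2) unfolding additively_set_realizable_def by (elim exE conjE) (rule that)
  have S: "set_rep X (S i)" and N: "vect_rep X K (N i)"
    and NS: "rep_isomorphic X K (N i) (free_rep X K (S i))" and D: "direct_summand X K (D i) (N i)"
    if "i < n" for i
    using all that by auto
  have "rep_retract X K (D i) (free_rep X K (S i))" if i: "i < n" for i
  proof -
    obtain E :: "('o, 'm, 'k, 's \<Rightarrow> 'k) vect_functor" where E: "vect_rep X K (D i)" "vect_rep X K E" "rep_isomorphic X K (N i) (rep_plus (D i) E)"
      using D[OF i] unfolding direct_summand_def by blast
    have "rep_retract X K (D i) (rep_plus (D i) E)"
      using E by (intro rep_retract_plus)
    moreover have "rep_retract X K (rep_plus (D i) E) (N i)"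
      using E(3) by (rule vect_rep.rep_retract_iso(2)[OF N[OF i]])
    moreover have "rep_retract X K (N i) (free_rep X K (S i))"
      using NS[OF i] by (rule vect_rep.rep_retract_iso(1)[OF N[OF i]])
    ultimately show ?thesis by (meson R.rep_retract_trans)
  qed
  then have "rep_retract X K (rep_sum {..<n} D) (free_rep X K (set_sum {..<n} S))"
    by (intro R.rep_retract_sum_free S R.field_axioms)
  then have "rep_retract X K R (free_rep X K (set_sum {..<n} S))"
    by (rule R.rep_retract_trans[OF R.rep_retract_iso(1)[OF R]])
  moreover have "set_rep X (set_sum {..<n} S)"
    by (rule set_rep_set_sum[OF R.category_axioms]) (simp add: S)
  ultimately show ?thesis by blast
qed

section \<open>From retracts to direct summands\<close>

definition subrep ::
  "('o, 'm, 'k, 'v) vect_functor \<Rightarrow> ('o \<Rightarrow> 'v set) \<Rightarrow> ('o, 'm, 'k, 'v) vect_functor" where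
  "subrep T U = T\<lparr>VObj := (\<lambda>x. VObj T x\<lparr>carrier := U x\<rparr>)\<rparr>"

lemma (in vect_rep) subrep_vect_rep:
  assumes "\<And>x. x \<in> Obj X \<Longrightarrow> submodule K (U x) (VObj R x)"
    and "\<And>f v. \<lbrakk>f \<in> Mor X; v \<in> U (Dom X f)\<rbrakk> \<Longrightarrow> VMor R f v \<in> U (Cod X f)"
  shows "vect_rep X K (subrep R U)"
proof (intro vect_rep.intro vect_rep_axioms.intro category_axioms field_axioms, goal_cases)
  case (1 x)
  interpret V: vectorspace K "VObj R x" using 1 by (rule VObj_vectorspace)
  have "subspace K (U x) (VObj R x)"
    using assms(1)[OF 1] V.vectorspace_axioms by (simp add: subspace_def)
  then show ?case
    using V.subspace_is_vs by (simp add: subrep_def)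
next
  case (2 f)
  have "U (Dom X f) \<subseteq> carrier (VObj R (Dom X f))"
    using submodule.subset[OF assms(1)[OF Dom_in[OF 2]]] .
  then show ?case
    using VMor_hom[OF 2] assms(2)[OF 2] by (auto simp: module_hom_def subrep_def Pi_iff subset_iff)
next
  case (3 x v)
  then show ?case
    using submodule.subset[OF assms(1)] VMor_Id by (auto simp: subrep_def)
next
  case (4 f g v)
  then show ?case
    using submodule.subset[OF assms(1)[OF Dom_in[OF 4(1)]]] VMor_Comp by (auto simp: subrep_def)
qed

text \<open>The natural idempotent \<open>e = i p\<close> splits \<open>T\<close> into its image,
  isomorphic to \<open>R\<close>, and its kernel. Both are subrepresentations of \<open>T\<close>,
  so they have the carrier type that \<open>direct_summand\<close> prescribes.\<close>

lemma rep_retract_imp_summand: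
  assumes "vect_rep X K R" "vect_rep X K T" "rep_retract X K R T"
  shows "\<exists>D. direct_summand X K D T \<and> rep_isomorphic X K R D"
proof -
  interpret R: vect_rep X K R by fact
  interpret T: vect_rep X K T by fact
  obtain i p where "rep_retraction X K R T i p"
    using assms(3) unfolding rep_retract_def by blast
  then interpret rep_retraction X K R T i p .
  define e where "e x w = i x (p x w)" for x w
  have e_hom: "e x \<in> module_hom K (VObj T x) (VObj T x)" if "x \<in> Obj X" for x
    unfolding e_def by (rule module_hom_comp[OF p_hom i_hom]) (fact that)+
  have e_e: "e x (e x w) = e x w" if "x \<in> Obj X" "w \<in> carrier (VObj T x)" for x w
    using that by (simp add: e_def p_i p_carrier)
  have e_nat: "e (Cod X f) (VMor T f w) = VMor T f (e (Dom X f) w)"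
    if "f \<in> Mor X" "w \<in> carrier (VObj T (Dom X f))" for f w
    using that by (simp add: e_def p_nat i_nat p_carrier R.Dom_in)
  \<comment> \<open>The image of the idempotent is described as its set of fixed points, an
    equational condition that is visibly linear and natural.\<close>
  define D where "D = subrep T (\<lambda>x. {w \<in> carrier (VObj T x). e x w = w})"
  define E where "E = subrep T (\<lambda>x. {w \<in> carrier (VObj T x). e x w = \<zero>\<^bsub>VObj T x\<^esub>})"
  have D: "vect_rep X K D"
    unfolding D_def
  proof (rule T.subrep_vect_rep)
    fix x assume x: "x \<in> Obj X"
    interpret V: vectorspace K "VObj T x" using x by (rule T.VObj_vectorspace)
    interpret e: mod_hom K "VObj T x" "VObj T x" "e x" by unfold_locales (rule e_hom[OF x])
    show "submodule K {w \<in> carrier (VObj T x). e x w = w} (VObj T x)"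
      by unfold_locales auto
  qed (simp add: e_nat T.VMor_carrier)
  have E: "vect_rep X K E"
    unfolding E_def
  proof (rule T.subrep_vect_rep)
    fix x assume x: "x \<in> Obj X"
    interpret V: vectorspace K "VObj T x" using x by (rule T.VObj_vectorspace)
    interpret e: mod_hom K "VObj T x" "VObj T x" "e x" by unfold_locales (rule e_hom[OF x])
    show "submodule K {w \<in> carrier (VObj T x). e x w = \<zero>\<^bsub>VObj T x\<^esub>} (VObj T x)"
      using e.ker_is_submodule by (simp add: e.ker_def)
  next
    fix f v assume f: "f \<in> Mor X" and v: "v \<in> {w \<in> carrier (VObj T (Dom X f)). e (Dom X f) w = \<zero>\<^bsub>VObj T (Dom X f)\<^esub>}"
    have "VMor T f \<zero>\<^bsub>VObj T (Dom X f)\<^esub> = \<zero>\<^bsub>VObj T (Cod X f)\<^esub>"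
      using f by (intro module_hom_zero[OF _ _ T.VMor_hom] abelian_group_vectorspace[OF T.VObj_vectorspace]
        R.Dom_in R.Cod_in)
    then show "VMor T f v \<in> {w \<in> carrier (VObj T (Cod X f)). e (Cod X f) w = \<zero>\<^bsub>VObj T (Cod X f)\<^esub>}"
      using f v by (simp add: e_nat T.VMor_carrier)
  qed
  have "rep_isomorphic X K T (rep_plus D E)"
    unfolding rep_isomorphic_def
  \<comment> \<open>The Peirce decomposition of \<open>w\<close> with respect to \<open>e\<close>;
    its inverse is addition of the two components.\<close>
  proof (intro exI[of _ "\<lambda>x w. (e x w, w \<ominus>\<^bsub>VObj T x\<^esub> e x w)"] conjI ballI)
    fix x assume x: "x \<in> Obj X"
    interpret V: vectorspace K "VObj T x" using x by (rule T.VObj_vectorspace)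
    interpret e: mod_hom K "VObj T x" "VObj T x" "e x" by unfold_locales (rule e_hom[OF x])
    have [simp]: "e x (e x w) = e x w" if "w \<in> carrier (VObj T x)" for w
      using e_e[OF x that] .
    have minus_add: "(v \<oplus>\<^bsub>VObj T x\<^esub> w) \<ominus>\<^bsub>VObj T x\<^esub> (v' \<oplus>\<^bsub>VObj T x\<^esub> w')
        = (v \<ominus>\<^bsub>VObj T x\<^esub> v') \<oplus>\<^bsub>VObj T x\<^esub> (w \<ominus>\<^bsub>VObj T x\<^esub> w')"
      if "v \<in> carrier (VObj T x)" "w \<in> carrier (VObj T x)" "v' \<in> carrier (VObj T x)" "w' \<in> carrier (VObj T x)"
      for v w v' w'
      using that by (simp add: a_minus_def V.M.minus_add V.M.a_ac)
    have cancel: "v \<oplus>\<^bsub>VObj T x\<^esub> (w \<oplus>\<^bsub>VObj T x\<^esub> \<ominus>\<^bsub>VObj T x\<^esub> v) = w"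
      if "v \<in> carrier (VObj T x)" "w \<in> carrier (VObj T x)" for v w
      using that by (metis V.M.a_inv_closed V.M.a_lcomm V.M.r_neg V.M.r_zero)
    show "(\<lambda>w. (e x w, w \<ominus>\<^bsub>VObj T x\<^esub> e x w)) \<in> module_hom K (VObj T x) (VObj (rep_plus D E) x)"
      by (auto simp: module_hom_def rep_plus_simps direct_sum_simps D_def E_def subrep_def minus_add
          a_minus_def V.smult_r_distr V.smult_r_minus V.M.r_neg V.M.minus_add V.M.a_ac)
    show "bij_betw (\<lambda>w. (e x w, w \<ominus>\<^bsub>VObj T x\<^esub> e x w)) (carrier (VObj T x)) (carrier (VObj (rep_plus D E) x))"
      by (rule bij_betw_byWitness[where f' = "\<lambda>(a, b). a \<oplus>\<^bsub>VObj T x\<^esub> b"])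
        (auto simp: rep_plus_simps direct_sum_simps D_def E_def subrep_def a_minus_def V.M.a_ac
          V.M.r_neg V.M.r_neg2 V.M.r_neg1 cancel)
  next
    fix f w assume f: "f \<in> Mor X" and w: "w \<in> carrier (VObj T (Dom X f))"
    interpret V: vectorspace K "VObj T (Dom X f)" using f by (intro T.VObj_vectorspace R.Dom_in)
    interpret W: vectorspace K "VObj T (Cod X f)" using f by (intro T.VObj_vectorspace R.Cod_in)
    interpret f: mod_hom K "VObj T (Dom X f)" "VObj T (Cod X f)" "VMor T f"
      by unfold_locales (rule T.VMor_hom[OF f])
    show "(e (Cod X f) (VMor T f w), VMor T f w \<ominus>\<^bsub>VObj T (Cod X f)\<^esub> e (Cod X f) (VMor T f w)) =
      VMor (rep_plus D E) f (e (Dom X f) w, w \<ominus>\<^bsub>VObj T (Dom X f)\<^esub> e (Dom X f) w)"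
      using f w module_hom_carrier[OF e_hom w]
      by (simp add: rep_plus_simps D_def E_def subrep_def e_nat R.Dom_in)
  qed
  then have "direct_summand X K D T"
    using D E unfolding direct_summand_def by blast
  moreover have "rep_isomorphic X K R D"
    unfolding rep_isomorphic_def
  proof (intro exI[of _ i] conjI ballI)
    fix x assume x: "x \<in> Obj X"
    show "i x \<in> module_hom K (VObj R x) (VObj D x)"
      using i_hom[OF x] x by (auto simp: module_hom_def D_def subrep_def e_def p_i)
    show "bij_betw (i x) (carrier (VObj R x)) (carrier (VObj D x))"
      by (rule bij_betw_byWitness[where f' = "p x"])
        (use x in \<open>auto simp: D_def subrep_def e_def p_i p_carrier i_carrier\<close>)
  qed (simp add: D_def subrep_def i_nat)
  ultimately show ?thesis by blast
qed

lemma rep_isomorphic_refl: "rep_isomorphic X K R R"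
  unfolding rep_isomorphic_def
  by (intro exI[of _ "\<lambda>x v. v"]) (auto simp: module_hom_def bij_betw_def)

text \<open>A single summand of a single free representation is enough, so \<open>n = 1\<close>.
  What remains is to identify \<open>D\<close> with the one-term sum of \<open>D\<close>, whose
  vectors are functions on \<open>{..<1}\<close>.\<close>

lemma retract_imp_realizable:
  fixes R :: "('o, 'm, 'k, 'v) vect_functor" and S :: "('o, 'm, 's) set_functor"
  assumes R: "vect_rep X K R" and S: "set_rep X S" and "rep_retract X K R (free_rep X K S)"
  shows "additively_set_realizable TYPE('s) X K R"
proof -
  interpret R: vect_rep X K R by fact
  interpret S: set_rep X S by fact
  have N: "vect_rep X K (free_rep X K S)"
    by (rule S.free_rep_vect_rep[OF R.field_axioms])
  obtain D where D: "direct_summand X K D (free_rep X K S)" and "rep_isomorphic X K R D"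
    using rep_retract_imp_summand[OF R N assms(3)] by blast
  then obtain \<eta> where hom: "\<And>x. x \<in> Obj X \<Longrightarrow> \<eta> x \<in> module_hom K (VObj R x) (VObj D x)"
    and bij: "\<And>x. x \<in> Obj X \<Longrightarrow> bij_betw (\<eta> x) (carrier (VObj R x)) (carrier (VObj D x))"
    and nat: "\<And>f v. \<lbrakk>f \<in> Mor X; v \<in> carrier (VObj R (Dom X f))\<rbrakk> \<Longrightarrow> \<eta> (Cod X f) (VMor R f v) = VMor D f (\<eta> (Dom X f) v)"
    unfolding rep_isomorphic_def by metis
  have "rep_isomorphic X K R (rep_sum {..<1 :: nat} (\<lambda>_. D))"
    unfolding rep_isomorphic_def
  proof (intro exI[of _ "\<lambda>x v. \<lambda>i\<in>{..<1 :: nat}. \<eta> x v"] conjI ballI)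
    fix x assume x: "x \<in> Obj X"
    \<comment> \<open>A family over \<open>{..<1}\<close> is determined by its entry at 0, so
      evaluation at 0 is the inverse.\<close>
    have bij': "bij_betw (\<lambda>v. \<lambda>i\<in>{..<1 :: nat}. v) (carrier (VObj D x)) ({..<1} \<rightarrow>\<^sub>E carrier (VObj D x))"
      by (rule bij_betw_byWitness[where f' = "\<lambda>v. v 0"])
        (auto simp: PiE_iff extensional_def fun_eq_iff)
    show "(\<lambda>v. \<lambda>i\<in>{..<1 :: nat}. \<eta> x v) \<in> module_hom K (VObj R x) (VObj (rep_sum {..<1 :: nat} (\<lambda>_. D)) x)"
      using hom[OF x] by (auto simp: module_hom_def rep_sum_simps)
    show "bij_betw (\<lambda>v. \<lambda>i\<in>{..<1 :: nat}. \<eta> x v) (carrier (VObj R x))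
        (carrier (VObj (rep_sum {..<1 :: nat} (\<lambda>_. D)) x))"
      using bij_betw_trans[OF bij[OF x] bij'] by (simp add: rep_sum_simps comp_def)
  qed (auto simp: rep_sum_simps nat)
  then show ?thesis
    unfolding additively_set_realizable_def
    using S N D rep_isomorphic_refl
    by (intro exI[of _ "1 :: nat"] exI[of _ "\<lambda>_ :: nat. S"] exI[of _ "\<lambda>_ :: nat. free_rep X K S"]
        exI[of _ "\<lambda>_ :: nat. D"]) blast
qed

section \<open>Splittings over finite set representations\<close>

text \<open>A splitting of \<open>R\<close> off \<open>free \<circ> S\<close>, written out in coordinates: the inclusion is \<open>v \<mapsto> (I x s v)\<^sub>s\<close>
  and the projection sends the generator \<open>s\<close> to \<open>P x s\<close>.\<close>

locale set_splitting = vect_rep X K R + S: set_rep X S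
  for X :: "('o, 'm) category" and K :: "('k, 'l) ring_scheme"
    and R :: "('o, 'm, 'k, 'v) vect_functor" and S :: "('o, 'm, 's) set_functor" +
  fixes I :: "'o \<Rightarrow> 's \<Rightarrow> 'v \<Rightarrow> 'k" and P :: "'o \<Rightarrow> 's \<Rightarrow> 'v"
  assumes finite_S: "x \<in> Obj X \<Longrightarrow> finite (SObj S x)"
    and I_form: "\<lbrakk>x \<in> Obj X; s \<in> SObj S x\<rbrakk> \<Longrightarrow> linear_form K (VObj R x) (I x s)"
    and P_carrier: "\<lbrakk>x \<in> Obj X; s \<in> SObj S x\<rbrakk> \<Longrightarrow> P x s \<in> carrier (VObj R x)"
    and decomp: "\<lbrakk>x \<in> Obj X; v \<in> carrier (VObj R x)\<rbrakk> \<Longrightarrow>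
      (\<Oplus>\<^bsub>VObj R x\<^esub>s\<in>SObj S x. I x s v \<odot>\<^bsub>VObj R x\<^esub> P x s) = v"
    and P_nat: "\<lbrakk>f \<in> Mor X; s \<in> SObj S (Dom X f)\<rbrakk> \<Longrightarrow> VMor R f (P (Dom X f) s) = P (Cod X f) (SMor S f s)"
    and I_nat: "\<lbrakk>f \<in> Mor X; t \<in> SObj S (Cod X f); v \<in> carrier (VObj R (Dom X f))\<rbrakk> \<Longrightarrow>
      I (Cod X f) t (VMor R f v) = (\<Oplus>\<^bsub>K\<^esub>s\<in>{s \<in> SObj S (Dom X f). SMor S f s = t}. I (Dom X f) s v)"
begin

lemma I_carrier: "\<lbrakk>x \<in> Obj X; s \<in> SObj S x; v \<in> carrier (VObj R x)\<rbrakk> \<Longrightarrow> I x s v \<in> carrier K"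
  using I_form[of x s] by (auto simp: linear_form_def Pi_iff)

lemma I_add: "\<lbrakk>x \<in> Obj X; s \<in> SObj S x; v \<in> carrier (VObj R x); w \<in> carrier (VObj R x)\<rbrakk> \<Longrightarrow>
    I x s (v \<oplus>\<^bsub>VObj R x\<^esub> w) = I x s v \<oplus>\<^bsub>K\<^esub> I x s w"
  using I_form by (auto simp: linear_form_def)

lemma I_smult: "\<lbrakk>x \<in> Obj X; s \<in> SObj S x; k \<in> carrier K; v \<in> carrier (VObj R x)\<rbrakk> \<Longrightarrow>
    I x s (k \<odot>\<^bsub>VObj R x\<^esub> v) = k \<otimes>\<^bsub>K\<^esub> I x s v"
  using I_form by (auto simp: linear_form_def)

text \<open>Since \<open>SObj S x\<close> is finite, any tuple of coordinates is a vector of the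
  free space. Then \<open>decomp\<close> says that the projection undoes the inclusion, and
  \<open>I_nat\<close> and \<open>P_nat\<close> are their naturality squares.\<close>

lemma retract: "rep_retract X K R (free_rep X K S)"
proof -
  have PA: "P x \<in> SObj S x \<rightarrow> carrier (VObj R x)" if "x \<in> Obj X" for x
    using P_carrier that by auto
  have "rep_retraction X K R (free_rep X K S) (\<lambda>x v. \<lambda>s\<in>SObj S x. I x s v)
    (\<lambda>x. free_lift K (VObj R x) (SObj S x) (P x))"
  proof (unfold_locales, goal_cases)
    case (1 x)
    then show ?case
      by (auto simp: module_hom_def free_rep_def free_vs_finite_carrier free_vs_add free_vs_smult finite_S
          I_carrier I_add I_smult restrict_def fun_eq_iff)
  next
    case (2 x)
    interpret V: vectorspace K "VObj R x" using 2 by (rule VObj_vectorspace)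
    show ?case
      using V.free_lift_hom[OF PA[OF 2]] by (simp add: free_rep_def)
  next
    case (3 x v)
    interpret V: vectorspace K "VObj R x" using 3(1) by (rule VObj_vectorspace)
    have "(\<lambda>s\<in>SObj S x. I x s v) \<in> carrier (free_vs K (SObj S x))"
      using 3 by (simp add: free_vs_finite_carrier finite_S I_carrier)
    then have "free_lift K (VObj R x) (SObj S x) (P x) (\<lambda>s\<in>SObj S x. I x s v)
      = (\<Oplus>\<^bsub>VObj R x\<^esub>s\<in>SObj S x. (\<lambda>s\<in>SObj S x. I x s v) s \<odot>\<^bsub>VObj R x\<^esub> P x s)"
      using PA[OF 3(1)] by (intro V.free_lift_eq) (auto simp: finite_S 3)
    also have "\<dots> = v"
      using 3 by (subst decomp[symmetric, of x v])
        (auto intro!: V.M.finsum_cong' simp: I_carrier P_carrier)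
    finally show ?case .
  next
    case (4 f v)
    have x: "Dom X f \<in> Obj X" and y: "Cod X f \<in> Obj X"
      using 4 by (auto simp: Dom_in Cod_in)
    have "(\<lambda>s\<in>SObj S (Dom X f). I (Dom X f) s v) \<in> carrier (free_vs K (SObj S (Dom X f)))"
      using x 4 by (simp add: free_vs_finite_carrier finite_S I_carrier)
    then have "free_map K (SObj S (Dom X f)) (SObj S (Cod X f)) (SMor S f) (\<lambda>s\<in>SObj S (Dom X f). I (Dom X f) s v) t
      = I (Cod X f) t (VMor R f v)" if "t \<in> SObj S (Cod X f)" for t
      using that x 4 by (simp add: free_map_apply finite_S I_nat)
        (intro finsum_cong', auto simp: I_carrier)
    then show ?case
      by (intro extensionalityI[of _ "SObj S (Cod X f)"]) (auto simp: free_rep_def free_map_def)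
  next
    case (5 f c)
    have x: "Dom X f \<in> Obj X" and y: "Cod X f \<in> Obj X"
      using 5 by (auto simp: Dom_in Cod_in)
    interpret V: vectorspace K "VObj R (Dom X f)" using x by (rule VObj_vectorspace)
    interpret W: vectorspace K "VObj R (Cod X f)" using y by (rule VObj_vectorspace)
    note f = S.SMor_in[OF 5(1)]
    have "free_lift K (VObj R (Cod X f)) (SObj S (Cod X f)) (P (Cod X f))
        (free_map K (SObj S (Dom X f)) (SObj S (Cod X f)) (SMor S f) c) =
      VMor R f (free_lift K (VObj R (Dom X f)) (SObj S (Dom X f)) (P (Dom X f)) c)"
      using 5 S.SMor_in'[OF 5(1)]
      by - (rule W.free_vs_hom_eqI[OF module_hom_comp[OF free_map_hom[OF f] W.free_lift_hom[OF PA[OF y]]]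
            module_hom_comp[OF V.free_lift_hom[OF PA[OF x]] VMor_hom[OF 5(1)]]],
          simp_all add: free_map_gen[OF f] V.free_lift_gen[OF PA[OF x]] W.free_lift_gen[OF PA[OF y]]
            P_nat free_rep_def)
    then show ?case by (simp add: free_rep_def)
  qed
  then show ?thesis
    unfolding rep_retract_def by blast
qed

text \<open>Finitely many objects with finite values involve finitely many elements in all, and
  these inject into any infinite type. This is what makes the universes of sets on the two sides of
  the equivalence independent of each other.\<close>

lemma transport:
  assumes "finite (Obj X)" "infinite (UNIV :: 't set)"
  shows "\<exists>(S' :: ('o, 'm, 't) set_functor) I' P'. set_splitting X K R S' I' P'"
proof -
  define U where "U = (\<Union>x\<in>Obj X. SObj S x)"
  have "finite U"
    using assms(1) finite_S by (auto simp: U_def)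
  moreover obtain B :: "'t set" where "finite B" "card B = card U"
    using infinite_arbitrarily_large[OF assms(2)] by blast
  ultimately obtain j where "bij_betw j U B"
    using finite_same_card_bij by metis
  then have inj: "inj_on j U"
    by (rule bij_betw_imp_inj_on)
  \<comment> \<open>One injection \<open>j\<close> serves the union over all objects, so the values
    at different objects may overlap and \<open>g\<close> undoes \<open>j\<close> without mention of
    an object. The action of morphisms is conjugated by \<open>j\<close>.\<close>
  define g where "g = inv_into U j"
  have gj [simp]: "g (j s) = s" if "x \<in> Obj X" "s \<in> SObj S x" for x s
    using that inj by (auto simp: g_def U_def intro: inv_into_f_f)
  have inj_x: "inj_on j (SObj S x)" if "x \<in> Obj X" for x
    using inj that by (auto simp: U_def intro: inj_on_subset)
  define S' where "S' = \<lparr>SObj = (\<lambda>x. j ` SObj S x), SMor = (\<lambda>f s. j (SMor S f (g s)))\<rparr>"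
  have "set_splitting X K R S' (\<lambda>x s. I x (g s)) (\<lambda>x s. P x (g s))"
  proof (intro set_splitting.intro set_splitting_axioms.intro set_rep.intro set_rep_axioms.intro
      vect_rep_axioms category_axioms, goal_cases)
    case (1 f)
    then show ?case by (auto simp: S'_def gj[OF Dom_in] S.SMor_in')
  next
    case (2 x s)
    then show ?case by (auto simp: S'_def S.SMor_Id)
  next
    case (3 f g s)
    then show ?case
      by (auto simp: S'_def S.SMor_Comp Dom_in Cod_in S.SMor_in' gj[of "Dom X f"] gj[of "Cod X f"])
  next
    case (4 x)
    then show ?case by (simp add: S'_def finite_S)
  next
    case (5 x s)
    then show ?case by (auto simp: S'_def I_form)
  next
    case (6 x s)
    then show ?case by (auto simp: S'_def P_carrier)
  next
    case (7 x v)
    interpret V: vectorspace K "VObj R x" using 7(1) by (rule VObj_vectorspace)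
    have "(\<Oplus>\<^bsub>VObj R x\<^esub>s\<in>j ` SObj S x. I x (g s) v \<odot>\<^bsub>VObj R x\<^esub> P x (g s))
      = (\<Oplus>\<^bsub>VObj R x\<^esub>s\<in>SObj S x. I x (g (j s)) v \<odot>\<^bsub>VObj R x\<^esub> P x (g (j s)))"
      using 7 by (intro V.M.finsum_reindex inj_x) (auto simp: I_carrier P_carrier)
    also have "\<dots> = (\<Oplus>\<^bsub>VObj R x\<^esub>s\<in>SObj S x. I x s v \<odot>\<^bsub>VObj R x\<^esub> P x s)"
      using 7 by (intro V.M.finsum_cong') (auto simp: I_carrier P_carrier)
    finally show ?case using 7 by (simp add: S'_def decomp)
  next
    case (8 f s)
    then show ?case by (auto simp: S'_def P_nat Dom_in Cod_in S.SMor_in' gj[of "Cod X f"] gj[of "Dom X f"])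
  next
    case (9 f t v)
    have x: "Dom X f \<in> Obj X" and y: "Cod X f \<in> Obj X"
      using 9 by (auto simp: Dom_in Cod_in)
    obtain t' where t': "t' \<in> SObj S (Cod X f)" "t = j t'"
      using 9 by (auto simp: S'_def)
    have eq: "{s \<in> SObj S' (Dom X f). SMor S' f s = t} = j ` {s \<in> SObj S (Dom X f). SMor S f s = t'}"
      using t' x y 9 S.SMor_in'[OF 9(1)] inj_x[OF y] by (auto simp: S'_def inj_on_def)
    have "(\<Oplus>\<^bsub>K\<^esub>s\<in>j ` {s \<in> SObj S (Dom X f). SMor S f s = t'}. I (Dom X f) (g s) v)
      = (\<Oplus>\<^bsub>K\<^esub>s\<in>{s \<in> SObj S (Dom X f). SMor S f s = t'}. I (Dom X f) (g (j s)) v)"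
      using 9 x inj_x[OF x] by (intro finsum_reindex) (auto simp: I_carrier inj_on_def)
    also have "\<dots> = (\<Oplus>\<^bsub>K\<^esub>s\<in>{s \<in> SObj S (Dom X f). SMor S f s = t'}. I (Dom X f) s v)"
      using 9 x by (intro finsum_cong') (auto simp: I_carrier)
    finally show ?case
      using 9(1,3) t' y unfolding eq by (simp add: I_nat)
  qed
  then show ?thesis by blast
qed

lemma realizable:
  assumes "finite (Obj X)" "infinite (UNIV :: 't set)"
  shows "additively_set_realizable TYPE('t) X K R"
proof -
  obtain S' :: "('o, 'm, 't) set_functor" and I' P' where "set_splitting X K R S' I' P'"
    using transport[OF assms] by blast
  then interpret T: set_splitting X K R S' I' P' .
  show ?thesis
    using vect_rep_axioms T.S.set_rep_axioms T.retract by (rule retract_imp_realizable)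
qed

end

section \<open>Cutting a retract of a free representation down to a finite subfunctor\<close>

lemma retract_imp_splitting:
  fixes S :: "('o, 'm, 's) set_functor"
  assumes "finite_category X" "fin_dim_vect_rep X K R" "set_rep X S" "rep_retract X K R (free_rep X K S)"
  shows "\<exists>(S' :: ('o, 'm, 's) set_functor) I P. set_splitting X K R S' I P"
proof -
  interpret finite_category X by fact
  interpret R: fin_dim_vect_rep X K R by fact
  interpret S: set_rep X S by fact
  obtain i p where "rep_retraction X K R (free_rep X K S) i p"
    using assms(4) unfolding rep_retract_def by blast
  then interpret rep_retraction X K R "free_rep X K S" i p .
  have i_in: "i x v \<in> carrier (free_vs K (SObj S x))" if "x \<in> Obj X" "v \<in> carrier (VObj R x)" for x v
    using i_carrier[OF that] by (simp add: free_rep_def)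
  have form: "linear_form K (VObj R x) (\<lambda>v. i x v s)" if "x \<in> Obj X" "s \<in> SObj S x" for x s
    using i_hom[OF that(1)] that(2)
    by (auto simp: linear_form_def module_hom_def free_rep_def R.free_vs_simps PiE_iff Pi_iff)
  \<comment> \<open>Each vector has finitely many nonzero coordinates; the claim is a finite bound
    on their positions that is uniform in the vector.\<close>
  have "\<exists>T. finite T \<and> T \<subseteq> SObj S x \<and> (\<forall>v\<in>carrier (VObj R x). {s \<in> SObj S x. i x v s \<noteq> \<zero>\<^bsub>K\<^esub>} \<subseteq> T)"
    if x: "x \<in> Obj X" for x
  proof -
    interpret V: vectorspace K "VObj R x" using x by (rule R.VObj_vectorspace)
    obtain G where G: "finite G" "G \<subseteq> carrier (VObj R x)" "V.span G = carrier (VObj R x)"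
      using R.VObj_fin_dim[OF x] unfolding V.fin_dim_def by blast
    define T where "T = (\<Union>v\<in>G. {s \<in> SObj S x. i x v s \<noteq> \<zero>\<^bsub>K\<^esub>})"
    have i0: "i x \<zero>\<^bsub>VObj R x\<^esub> s = \<zero>\<^bsub>K\<^esub>" if "s \<in> SObj S x" for s
      using form[OF x that]
      by (intro additive_zero[OF V.M.abelian_group_axioms R.abelian_group_axioms]) (auto simp: linear_form_def)
    \<comment> \<open>Vanishing of all coordinates outside \<open>T\<close> is a linear condition.
      It holds on the finite spanning set \<open>G\<close> by the choice of \<open>T\<close>, hence
      everywhere.\<close>
    have "submodule K {v \<in> carrier (VObj R x). \<forall>s\<in>SObj S x - T. i x v s = \<zero>\<^bsub>K\<^esub>} (VObj R x)"
      using form[OF x] by unfold_locales (auto simp: linear_form_def i0)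
    moreover have "G \<subseteq> {v \<in> carrier (VObj R x). \<forall>s\<in>SObj S x - T. i x v s = \<zero>\<^bsub>K\<^esub>}"
      using G(2) by (auto simp: T_def)
    ultimately have "carrier (VObj R x) \<subseteq> {v \<in> carrier (VObj R x). \<forall>s\<in>SObj S x - T. i x v s = \<zero>\<^bsub>K\<^esub>}"
      unfolding G(3)[symmetric] using V.span_is_subset by blast
    moreover have "finite T"
      unfolding T_def using G i_in[OF x] by (auto simp: R.free_vs_carrier)
    ultimately show ?thesis
      by (intro exI[of _ T]) (auto simp: T_def)
  qed
  then have "\<forall>x\<in>Obj X. \<exists>T. finite T \<and> T \<subseteq> SObj S x \<and>
    (\<forall>v\<in>carrier (VObj R x). {s \<in> SObj S x. i x v s \<noteq> \<zero>\<^bsub>K\<^esub>} \<subseteq> T)"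
    by blast
  from bchoice[OF this] obtain T where "\<forall>x\<in>Obj X. finite (T x) \<and> T x \<subseteq> SObj S x \<and>
    (\<forall>v\<in>carrier (VObj R x). {s \<in> SObj S x. i x v s \<noteq> \<zero>\<^bsub>K\<^esub>} \<subseteq> T x)" ..
  then have T: "\<And>x. x \<in> Obj X \<Longrightarrow> finite (T x)" "\<And>x. x \<in> Obj X \<Longrightarrow> T x \<subseteq> SObj S x"
    "\<And>x v. \<lbrakk>x \<in> Obj X; v \<in> carrier (VObj R x)\<rbrakk> \<Longrightarrow> {s \<in> SObj S x. i x v s \<noteq> \<zero>\<^bsub>K\<^esub>} \<subseteq> T x"
    by simp_all
  \<comment> \<open>The \<open>T x\<close> need not be stable under morphisms. Their images under
    all morphisms generate a subfunctor: identities show that it contains \<open>T x\<close>,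
    composition that it is stable. It is finite because there are finitely many morphisms.\<close>
  define S0 where "S0 x = (\<Union>f\<in>{f \<in> Mor X. Cod X f = x}. SMor S f ` T (Dom X f))" for x
  define S' where "S' = \<lparr>SObj = S0, SMor = SMor S\<rparr>"
  have S0_fin: "finite (S0 x)" for x
    unfolding S0_def using finite_Mor T(1) Dom_in by auto
  have S0_sub: "S0 x \<subseteq> SObj S x" for x
    unfolding S0_def using T(2)[OF Dom_in] S.SMor_in' by blast
  have T_S0: "T x \<subseteq> S0 x" if "x \<in> Obj X" for x
  proof
    fix s assume "s \<in> T x"
    then show "s \<in> S0 x"
      unfolding S0_def using that T(2)[OF that]
      by (intro UN_I[of "category.Id X x"]) (auto simp: Id_in Cod_Id Dom_Id S.SMor_Id intro!: image_eqI[of s _ s])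
  qed
  have S0_closed: "SMor S g s \<in> S0 (Cod X g)" if g: "g \<in> Mor X" and s: "s \<in> S0 (Dom X g)" for g s
  proof -
    obtain f t where "f \<in> Mor X" "Cod X f = Dom X g" "t \<in> T (Dom X f)" "s = SMor S f t"
      using s by (auto simp: S0_def)
    then show ?thesis
      unfolding S0_def using g T(2)[OF Dom_in]
      by (intro UN_I[of "g \<cdot>\<^bsub>X\<^esub> f"] image_eqI[of _ _ t])
        (simp_all add: Comp_in Cod_Comp Dom_Comp S.SMor_Comp subset_iff)
  qed
  have supp: "i x v s = \<zero>\<^bsub>K\<^esub>" if "x \<in> Obj X" "v \<in> carrier (VObj R x)" "s \<in> SObj S x" "s \<notin> S0 x" for x v s
    using T(3)[OF that(1,2)] T_S0[OF that(1)] that(3,4) by auto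
  \<comment> \<open>A linear map on a free space is determined by these values, so \<open>p\<close>
    is the linear extension of \<open>P\<close>.\<close>
  define P where "P x s = p x (free_gen K (SObj S x) s)" for x s
  have P: "P x \<in> SObj S x \<rightarrow> carrier (VObj R x)" if "x \<in> Obj X" for x
    using that by (auto simp: P_def free_rep_def R.free_gen_carrier intro!: p_carrier)
  have "set_splitting X K R S' (\<lambda>x s v. i x v s) P"
  proof (intro set_splitting.intro set_splitting_axioms.intro set_rep.intro set_rep_axioms.intro
      R.vect_rep_axioms category_axioms, goal_cases)
    case (1 f)
    then show ?case by (auto simp: S'_def S0_closed)
  next
    case (2 x s)
    then have "s \<in> SObj S x" using S0_sub by (auto simp: S'_def)
    then show ?case using 2 by (simp add: S'_def S.SMor_Id)
  next
    case (3 f g s)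
    then have "s \<in> SObj S (Dom X f)" using S0_sub by (auto simp: S'_def)
    then show ?case using 3 by (simp add: S'_def S.SMor_Comp)
  next
    case (4 x)
    then show ?case by (simp add: S'_def S0_fin)
  next
    case (5 x s)
    then show ?case using S0_sub by (auto simp: S'_def intro: form)
  next
    case (6 x s)
    then show ?case using P[OF 6(1)] S0_sub by (auto simp: S'_def)
  next
    case (7 x v)
    interpret V: vectorspace K "VObj R x" using 7(1) by (rule R.VObj_vectorspace)
    have "v = p x (i x v)"
      using 7 by (simp add: p_i)
    also have "\<dots> = free_lift K (VObj R x) (SObj S x) (P x) (i x v)"
      using p_hom[OF 7(1)] V.free_lift_hom[OF P[OF 7(1)]] i_in[OF 7]
      by - (rule V.free_vs_hom_eqI[where g = "p x" and h = "free_lift K (VObj R x) (SObj S x) (P x)"],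
          simp_all add: free_rep_def V.free_lift_gen[OF P[OF 7(1)]] P_def)
    also have "\<dots> = (\<Oplus>\<^bsub>VObj R x\<^esub>s\<in>S0 x. i x v s \<odot>\<^bsub>VObj R x\<^esub> P x s)"
    proof (rule V.free_lift_eq)
      show "{s \<in> SObj S x. i x v s \<noteq> \<zero>\<^bsub>K\<^esub>} \<subseteq> S0 x"
        using supp[OF 7] by blast
    qed (use P[OF 7(1)] i_in[OF 7] S0_fin S0_sub in simp_all)
    finally show ?case by (simp add: S'_def)
  next
    case (8 f s)
    then have s: "s \<in> SObj S (Dom X f)" using S0_sub by (auto simp: S'_def)
    then have "VMor R f (P (Dom X f) s) = p (Cod X f) (VMor (free_rep X K S) f (free_gen K (SObj S (Dom X f)) s))"
      using p_nat[OF 8(1), of "free_gen K (SObj S (Dom X f)) s"]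
      by (simp add: P_def free_rep_def R.free_gen_carrier)
    then show ?case
      using s S.SMor_in[OF 8(1)] by (simp add: free_rep_def P_def S'_def R.free_map_gen)
  next
    case (9 f t v)
    have x: "Dom X f \<in> Obj X" using 9 by (auto simp: Dom_in)
    have t: "t \<in> SObj S (Cod X f)" using 9 S0_sub by (auto simp: S'_def)
    have "i (Cod X f) (VMor R f v) t
      = (\<Oplus>\<^bsub>K\<^esub>s\<in>{s \<in> SObj S (Dom X f). SMor S f s = t \<and> i (Dom X f) v s \<noteq> \<zero>\<^bsub>K\<^esub>}. i (Dom X f) v s)"
      using 9 t by (simp add: i_nat free_rep_def free_map_def)
    \<comment> \<open>The two index sets differ only where the coordinate of \<open>v\<close> is
      zero: coordinates vanish outside \<open>S0\<close> by \<open>supp\<close>, and the fibre on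
      the left is already restricted to the support.\<close>
    also have "\<dots> = (\<Oplus>\<^bsub>K\<^esub>s\<in>{s \<in> S0 (Dom X f). SMor S f s = t}. i (Dom X f) v s)"
      using i_in[OF x 9(3)] S0_fin S0_sub[of "Dom X f"] supp[OF x 9(3)]
      by (intro R.add.finprod_mono_neutral_cong_left) (auto simp: R.free_vs_carrier PiE_iff)
    finally show ?case by (simp add: S'_def)
  qed
  then show ?thesis by blast
qed

lemma realizable_imp_splitting:
  fixes R :: "('o, 'm, 'k, 'v) vect_functor"
  assumes "finite_category X" "fin_dim_vect_rep X K R" "additively_set_realizable TYPE('s) X K R"
  shows "\<exists>(S :: ('o, 'm, nat \<times> 's) set_functor) I P. set_splitting X K R S I P"
proof -
  interpret R: fin_dim_vect_rep X K R by fact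
  obtain S :: "('o, 'm, nat \<times> 's) set_functor" where "set_rep X S" "rep_retract X K R (free_rep X K S)"
    using realizable_imp_retract[OF R.vect_rep_axioms assms(3)] by blast
  then show ?thesis
    by (rule retract_imp_splitting[OF assms(1,2)])
qed

section \<open>Splittings and extension of scalars\<close>

text \<open>The space may be infinite-dimensional, as F' may be over F, so the basis is a maximal
  linearly independent set from Zorn's lemma. The forms are the components of the inverse of the
  isomorphism from the free space on \<open>B\<close>.\<close>

lemma vectorspace_coordinates:
  assumes "vectorspace K V"
  obtains B l where "B \<subseteq> carrier V" "\<And>b. b \<in> B \<Longrightarrow> linear_form K V (l b)"
    "\<And>v. v \<in> carrier V \<Longrightarrow> finite {b \<in> B. l b v \<noteq> \<zero>\<^bsub>K\<^esub>}"
    "\<And>v. v \<in> carrier V \<Longrightarrow> v = (\<Oplus>\<^bsub>V\<^esub>b\<in>{b \<in> B. l b v \<noteq> \<zero>\<^bsub>K\<^esub>}. l b v \<odot>\<^bsub>V\<^esub> b)"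
proof -
  interpret V: vectorspace K V by fact
  define \<A> where "\<A> = {B. B \<subseteq> carrier V \<and> V.lin_indpt B}"
  have "\<exists>M\<in>\<A>. \<forall>B\<in>\<A>. M \<subseteq> B \<longrightarrow> B = M"
  proof (rule subset_Zorn')
    fix \<C> assume \<C>: "subset.chain \<A> \<C>"
    have "V.lin_indpt (\<Union>\<C>)"
    proof
      assume "V.lin_dep (\<Union>\<C>)"
      then obtain A a v where A: "finite A" "A \<subseteq> \<Union>\<C>" "a \<in> A \<rightarrow> carrier K" "V.lincomb a A = \<zero>\<^bsub>V\<^esub>"
        "v \<in> A" "a v \<noteq> \<zero>\<^bsub>K\<^esub>"
        unfolding V.lin_dep_def by blast
      \<comment> \<open>A linear dependence involves only finitely many vectors, and these lie in
        one member of the chain.\<close>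
      then obtain C where C: "C \<in> \<C>" "A \<subseteq> C"
        using finite_subset_Union_chain[OF A(1,2) _ \<C>] by (metis Union_empty empty_iff subsetD)
      then have "V.lin_dep C"
        using A unfolding V.lin_dep_def by blast
      then show False
        using C \<C> by (auto simp: \<A>_def subset.chain_def)
    qed
    then show "\<Union>\<C> \<in> \<A>"
      using \<C> by (auto simp: \<A>_def subset.chain_def)
  qed
  then obtain B where B: "B \<subseteq> carrier V" "V.lin_indpt B" and max: "\<And>B'. \<lbrakk>B' \<in> \<A>; B \<subseteq> B'\<rbrakk> \<Longrightarrow> B' = B"
    by (auto simp: \<A>_def)
  have span: "v \<in> V.span B" if v: "v \<in> carrier V" for v
  proof (cases "v \<in> B")
    case True
    then show ?thesis using V.in_own_span[OF B(1)] by blast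
  next
    case False
    \<comment> \<open>By maximality an outside vector cannot be adjoined independently, so it
      already lies in the span.\<close>
    then have "V.lin_dep (B \<union> {v})"
      using max[of "B \<union> {v}"] B v by (auto simp: \<A>_def)
    then show ?thesis
      using V.lin_dep_iff_in_span[OF B v False] by blast
  qed
  define L where "L = free_lift K V B (\<lambda>b. b)"
  have id: "(\<lambda>b. b) \<in> B \<rightarrow> carrier V"
    using B by auto
  have "L \<in> module_hom K (free_vs K B) V"
    unfolding L_def by (rule V.free_lift_hom[OF id])
  then interpret L: mod_hom K "free_vs K B" V L
    using V.free_vs_vectorspace[of B] by (intro mod_hom.intro mod_hom_axioms.intro V.module_axioms)
      (simp_all add: vectorspace_def)
  interpret F: vectorspace K "free_vs K B"
    by (rule V.free_vs_vectorspace)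
  have inj0: "c = \<zero>\<^bsub>free_vs K B\<^esub>" if c: "c \<in> carrier (free_vs K B)" "L c = \<zero>\<^bsub>V\<^esub>" for c
  proof -
    have "c b = \<zero>\<^bsub>K\<^esub>" if "b \<in> B" for b
    proof (rule ccontr)
      assume "c b \<noteq> \<zero>\<^bsub>K\<^esub>"
      then have "V.lin_dep B"
        unfolding V.lin_dep_def using c that
        by (intro exI[of _ "{b \<in> B. c b \<noteq> \<zero>\<^bsub>K\<^esub>}"] exI[of _ c] exI[of _ b])
          (auto simp: V.free_vs_carrier L_def free_lift_def V.lincomb_def)
      then show False using B by simp
    qed
    then show ?thesis
      using c by (intro ext) (auto simp: V.free_vs_simps PiE_iff extensional_def)
  qed
  have inj: "inj_on L (carrier (free_vs K B))"
  proof
    fix c d assume c: "c \<in> carrier (free_vs K B)" and d: "d \<in> carrier (free_vs K B)" and eq: "L c = L d"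
    then have "c \<ominus>\<^bsub>free_vs K B\<^esub> d = \<zero>\<^bsub>free_vs K B\<^esub>"
      by (intro inj0) (simp_all add: a_minus_def V.M.r_neg)
    then show "c = d"
      using c d by simp
  qed
  have surj: "\<exists>c\<in>carrier (free_vs K B). L c = v" if v: "v \<in> carrier V" for v
  proof -
    obtain a A where A: "A \<subseteq> B" "finite A" "v = V.lincomb a A" "a \<in> A \<rightarrow> carrier K"
      using span[OF v] unfolding V.span_def by blast
    define c where "c = (\<lambda>b\<in>B. if b \<in> A then a b else \<zero>\<^bsub>K\<^esub>)"
    have "c \<in> carrier (free_vs K B)"
      using A by (auto simp: V.free_vs_carrier c_def intro!: finite_subset[OF _ A(2)] split: if_splits)
    moreover from this have "L c = (\<Oplus>\<^bsub>V\<^esub>b\<in>A. c b \<odot>\<^bsub>V\<^esub> b)"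
      unfolding L_def using A id by (intro V.free_lift_eq) (auto simp: c_def)
    moreover have "\<dots> = v"
      unfolding A(3) V.lincomb_def using A B by (intro V.M.finsum_cong') (auto simp: c_def)
    ultimately show ?thesis by blast
  qed
  \<comment> \<open>The coordinate map. Its additivity and homogeneity are read off by applying it
    to \<open>L\<close> of the expected coordinates, since \<open>L\<close> is injective.\<close>
  define cf where "cf = inv_into (carrier (free_vs K B)) L"
  have cf: "cf v \<in> carrier (free_vs K B)" "L (cf v) = v" if "v \<in> carrier V" for v
  proof -
    have "v \<in> L ` carrier (free_vs K B)" using surj[OF that] by blast
    then show "cf v \<in> carrier (free_vs K B)" "L (cf v) = v"
      by (simp_all add: cf_def inv_into_into f_inv_into_f)
  qed
  have cfL: "cf (L c) = c" if "c \<in> carrier (free_vs K B)" for c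
    using inj that by (simp add: cf_def)
  have cf_add: "cf (v \<oplus>\<^bsub>V\<^esub> w) = cf v \<oplus>\<^bsub>free_vs K B\<^esub> cf w" if "v \<in> carrier V" "w \<in> carrier V" for v w
    using cfL[of "cf v \<oplus>\<^bsub>free_vs K B\<^esub> cf w"] cf that by simp
  have cf_smult: "cf (k \<odot>\<^bsub>V\<^esub> v) = k \<odot>\<^bsub>free_vs K B\<^esub> cf v" if "k \<in> carrier K" "v \<in> carrier V" for k v
    using cfL[of "k \<odot>\<^bsub>free_vs K B\<^esub> cf v"] cf that by simp
  show thesis
  proof (rule that[of B "\<lambda>b v. cf v b"])
    show "linear_form K V (\<lambda>v. cf v b)" if "b \<in> B" for b
      using cf(1) that by (auto simp: linear_form_def cf_add cf_smult V.free_vs_simps)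
    show "finite {b \<in> B. cf v b \<noteq> \<zero>\<^bsub>K\<^esub>}" if "v \<in> carrier V" for v
      using cf(1)[OF that] by (simp add: V.free_vs_carrier)
    show "v = (\<Oplus>\<^bsub>V\<^esub>b\<in>{b \<in> B. cf v b \<noteq> \<zero>\<^bsub>K\<^esub>}. cf v b \<odot>\<^bsub>V\<^esub> b)" if "v \<in> carrier V" for v
      using cf(2)[OF that] by (simp add: L_def free_lift_def)
  qed (fact B(1))
qed

section \<open>Spanning sets and basis expansions of tensors\<close>

context scalar_extension begin

text \<open>\<open>VE\<close> and \<open>\<T>\<close> are distinct records over different fields,
  but they share the additive structure, which is all that \<open>finsum\<close> reads.\<close>

lemma finsum_VE: "finsum VE g A = finsum \<T> g A"
  by (simp add: finsum_def finprod_def ext_scalars_def Let_def)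

lemma pure_one_smult: "\<lbrakk>k \<in> carrier F; v \<in> carrier V\<rbrakk> \<Longrightarrow>
    (k \<odot>\<^bsub>V\<^esub> v) \<star> \<one>\<^bsub>F'\<^esub> = \<phi> k \<odot>\<^bsub>VE\<^esub> (v \<star> \<one>\<^bsub>F'\<^esub>)"
  using pure_balanced[of k v "\<one>\<^bsub>F'\<^esub>"] by (simp add: smult_pure)

text \<open>The tensors v \<otimes> 1 with v in a spanning set \<open>G\<close> span over F'. The
  vectors v with v \<otimes> 1 in their F'-span form an F-subspace containing \<open>G\<close>,
  hence all of \<open>V\<close>, and v \<otimes> t is the t-fold of v \<otimes> 1.\<close>

lemma ext_fin_dim:
  assumes "V.fin_dim"
  shows "VE.fin_dim"
proof -
  obtain G where G: "finite G" "G \<subseteq> carrier V" "V.span G = carrier V"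
    using assms unfolding V.fin_dim_def by blast
  define G' where "G' = (\<lambda>v. v \<star> \<one>\<^bsub>F'\<^esub>) ` G"
  have G': "G' \<subseteq> carrier VE"
    using G by (auto simp: G'_def)
  interpret U: submodule F' "VE.span G'" VE
    by (rule VE.span_is_submodule[OF G'])
  note U = U.m_closed[simplified] U.smult_closed
  have "submodule F {v \<in> carrier V. v \<star> \<one>\<^bsub>F'\<^esub> \<in> VE.span G'} V"
    using U.zero_closed by unfold_locales
      (auto simp: pure_add_left pure_one_smult pure_zero_left U.m_closed[simplified])
  moreover have "G \<subseteq> {v \<in> carrier V. v \<star> \<one>\<^bsub>F'\<^esub> \<in> VE.span G'}"
    using G(2) VE.in_own_span[OF G'] by (auto simp: G'_def)
  ultimately have one: "v \<star> \<one>\<^bsub>F'\<^esub> \<in> VE.span G'" if "v \<in> carrier V" for v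
    using V.span_is_subset that G(3) by blast
  have "x \<in> VE.span G'" if "x \<in> carrier \<T>" for x
    using that
  proof (induction rule: tensor_induct)
    case (pure v t)
    then show ?case
      using U(2)[OF _ one[of v], of t] by (simp add: smult_pure)
  next
    case (add x y)
    then show ?case by (simp add: U)
  qed
  then have "VE.span G' = carrier VE"
    using U.subset by auto
  then show ?thesis
    unfolding VE.fin_dim_def using G(1) G' by (intro exI[of _ G']) (simp add: G'_def)
qed

text \<open>The sum over b of \<open>id \<otimes> l b\<close> followed by tensoring with b is the
  identity. The formula is claimed for every finite set between \<open>B0\<close> and
  \<open>B\<close>: this lets the sets for two tensors be merged in the induction, and lets one set
  serve all the vectors of a splitting later.\<close>

lemma basis_expansion:
  assumes B: "B \<subseteq> carrier F'" "\<And>b. b \<in> B \<Longrightarrow> linear_form F E (l b)"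
    and fin: "\<And>t. t \<in> carrier F' \<Longrightarrow> finite {b \<in> B. l b t \<noteq> \<zero>\<^bsub>F\<^esub>}"
    and exp: "\<And>t. t \<in> carrier F' \<Longrightarrow> t = (\<Oplus>\<^bsub>E\<^esub>b\<in>{b \<in> B. l b t \<noteq> \<zero>\<^bsub>F\<^esub>}. l b t \<odot>\<^bsub>E\<^esub> b)"
    and "x \<in> carrier \<T>"
  shows "\<exists>B0. finite B0 \<and> B0 \<subseteq> B \<and>
    (\<forall>B'. finite B' \<longrightarrow> B0 \<subseteq> B' \<longrightarrow> B' \<subseteq> B \<longrightarrow> x = (\<Oplus>\<^bsub>\<T>\<^esub>b\<in>B'. slice (l b) x \<star> b))"
  using \<open>x \<in> carrier \<T>\<close>
proof (induction rule: tensor_induct)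
  case (pure v t)
  note l = B(2)[unfolded linear_form_def, simplified]
  have "v \<star> t = (\<Oplus>\<^bsub>\<T>\<^esub>b\<in>B'. slice (l b) (v \<star> t) \<star> b)"
    if B': "finite B'" "{b \<in> B. l b t \<noteq> \<zero>\<^bsub>F\<^esub>} \<subseteq> B'" "B' \<subseteq> B" for B'
  proof -
    have lt: "l b t \<in> carrier F" "b \<in> carrier F'" if "b \<in> B'" for b
      using l[of b] pure that B' B(1) by (auto simp: Pi_iff)
    have "(\<Oplus>\<^bsub>E\<^esub>b\<in>{b \<in> B. l b t \<noteq> \<zero>\<^bsub>F\<^esub>}. l b t \<odot>\<^bsub>E\<^esub> b) = (\<Oplus>\<^bsub>E\<^esub>b\<in>B'. l b t \<odot>\<^bsub>E\<^esub> b)"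
      using B' lt ring_hom_zero[OF \<phi>_hom V.ring_axioms F'.ring_axioms]
      by (intro W.M.add.finprod_mono_neutral_cong_left) (auto simp: subset_iff)
    then have t: "t = (\<Oplus>\<^bsub>E\<^esub>b\<in>B'. l b t \<odot>\<^bsub>E\<^esub> b)"
      using exp[of t] pure by simp
    \<comment> \<open>Expanding the right factor in the basis and moving each coefficient
      \<open>l b t\<close> to the left by balancedness produces
      \<open>slice (l b) (v \<star> t)\<close>.\<close>
    have "v \<star> (\<Oplus>\<^bsub>E\<^esub>b\<in>B'. l b t \<odot>\<^bsub>E\<^esub> b) = (\<Oplus>\<^bsub>\<T>\<^esub>b\<in>B'. v \<star> (l b t \<odot>\<^bsub>E\<^esub> b))"
      using pure lt
      by (intro additive_finsum[OF W.M.abelian_group_axioms tensor_abelian_group])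
        (auto simp: pure_add_right simp del: E_simps(2) simp: E_simps(2)[symmetric])
    also have "\<dots> = (\<Oplus>\<^bsub>\<T>\<^esub>b\<in>B'. slice (l b) (v \<star> t) \<star> b)"
      using pure lt B' by (intro T.finsum_cong')
        (auto simp: slice_pure[OF B(2)] pure_balanced[symmetric] simp del: E_simps(4))
    finally show ?thesis using t by simp
  qed
  then show ?case
    using fin[of t] pure by (intro exI[of _ "{b \<in> B. l b t \<noteq> \<zero>\<^bsub>F\<^esub>}"]) auto
next
  case (add x y)
  from add.IH(1) obtain B1 where x: "finite B1 \<and> B1 \<subseteq> B \<and>
    (\<forall>B'. finite B' \<longrightarrow> B1 \<subseteq> B' \<longrightarrow> B' \<subseteq> B \<longrightarrow> x = (\<Oplus>\<^bsub>\<T>\<^esub>b\<in>B'. slice (l b) x \<star> b))" ..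
  from add.IH(2) obtain B2 where y: "finite B2 \<and> B2 \<subseteq> B \<and>
    (\<forall>B'. finite B' \<longrightarrow> B2 \<subseteq> B' \<longrightarrow> B' \<subseteq> B \<longrightarrow> y = (\<Oplus>\<^bsub>\<T>\<^esub>b\<in>B'. slice (l b) y \<star> b))" ..
  have "x \<oplus>\<^bsub>\<T>\<^esub> y = (\<Oplus>\<^bsub>\<T>\<^esub>b\<in>B'. slice (l b) (x \<oplus>\<^bsub>\<T>\<^esub> y) \<star> b)"
    if B': "finite B'" "B1 \<union> B2 \<subseteq> B'" "B' \<subseteq> B" for B'
  proof -
    have xe: "(\<Oplus>\<^bsub>\<T>\<^esub>b\<in>B'. slice (l b) x \<star> b) = x"
      by (rule x[THEN conjunct2, THEN conjunct2, rule_format, symmetric]) (use B' in auto)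
    have ye: "(\<Oplus>\<^bsub>\<T>\<^esub>b\<in>B'. slice (l b) y \<star> b) = y"
      by (rule y[THEN conjunct2, THEN conjunct2, rule_format, symmetric]) (use B' in auto)
    have b: "b \<in> carrier F'" "slice (l b) x \<in> carrier V" "slice (l b) y \<in> carrier V" if "b \<in> B'" for b
      using B B' add.hyps that by (auto intro!: slice_carrier)
    have "(\<Oplus>\<^bsub>\<T>\<^esub>b\<in>B'. slice (l b) (x \<oplus>\<^bsub>\<T>\<^esub> y) \<star> b)
      = (\<Oplus>\<^bsub>\<T>\<^esub>b\<in>B'. slice (l b) x \<star> b \<oplus>\<^bsub>\<T>\<^esub> slice (l b) y \<star> b)"
      using b B' add.hyps by (intro T.finsum_cong') (auto simp: slice_add[OF B(2)] pure_add_left)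
    also have "\<dots> = (\<Oplus>\<^bsub>\<T>\<^esub>b\<in>B'. slice (l b) x \<star> b) \<oplus>\<^bsub>\<T>\<^esub> (\<Oplus>\<^bsub>\<T>\<^esub>b\<in>B'. slice (l b) y \<star> b)"
      using b by (intro T.finsum_addf) auto
    finally show ?thesis
      using xe ye by simp
  qed
  moreover have "finite (B1 \<union> B2)" "B1 \<union> B2 \<subseteq> B"
    using x y by blast+
  ultimately show ?case
    by blast
qed

end

context rep_extension begin

text \<open>The slice acts on the factor F' and the morphism on the factor R. On v \<otimes> t both
  orders give the multiple by \<open>l t\<close> of the image of v. For a coordinate form this makes
  the slices of natural vectors natural again.\<close>

lemma slice_nat:
  assumes f: "f \<in> Mor X" and l: "linear_form F (ext_as_vs F' \<phi>) l" and w: "w \<in> carrier (VObj R' (Dom X f))"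
  defines "slice \<equiv> \<lambda>x. tensor_lift F (VObj R x) (ext_as_vs F' \<phi>) (VObj R x) (\<lambda>v t. l t \<odot>\<^bsub>VObj R x\<^esub> v)"
  shows "slice (Cod X f) (VMor R' f w) = VMor R f (slice (Dom X f) w)"
proof -
  interpret A: scalar_extension F F' \<phi> "VObj R (Dom X f)"
    using f by (intro scalar_extension Dom_in)
  interpret B: scalar_extension F F' \<phi> "VObj R (Cod X f)"
    using f by (intro scalar_extension Cod_in)
  note L = VMor_ext[OF f, unfolded VObj_ext, simplified]
  have lt: "l t \<in> carrier F" if "t \<in> carrier F'" for t
    using l that by (auto simp: linear_form_def Pi_iff)
  show ?thesis
    unfolding slice_def
    by (rule A.additive_eqI[where Z = "VObj R (Cod X f)"])
      (use w f in \<open>auto simp: VObj_ext L A.slice_add[OF l] B.slice_add[OF l] A.slice_pure[OF l]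
        B.slice_pure[OF l] VMor_carrier A.slice_carrier[OF l] module_hom_add[OF VMor_hom[OF f]]
        module_hom_smult[OF VMor_hom[OF f]] lt\<close>)
qed

end

text \<open>The set functor is kept, the forms are base-changed, and the vectors become P \<otimes>
  1. The identities that involve an argument are additive in it, so they are checked on v \<otimes>
  t, where they follow from the identities over F.\<close>

lemma splitting_ext_scalars:
  assumes "set_splitting X F R S I P" "rep_extension X F R F' \<phi>"
  shows "\<exists>I' P'. set_splitting X F' (rep_ext_scalars X F F' \<phi> R) S I' P'"
proof -
  interpret set_splitting X F R S I P by fact
  interpret rep_extension X F R F' \<phi> by fact
  define I' where "I' x s = tensor_lift F (VObj R x) (ext_as_vs F' \<phi>) (ext_as_vs F' \<phi>) (\<lambda>v t. \<phi> (I x s v) \<otimes>\<^bsub>F'\<^esub> t)" for x s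
  define P' where "P' x s = ten x (P x s) \<one>\<^bsub>F'\<^esub>" for x s
  have "set_splitting X F' R' S I' P'"
  proof (intro set_splitting.intro set_splitting_axioms.intro ext.vect_rep_axioms S.set_rep_axioms, goal_cases)
    case (1 x)
    then show ?case by (rule finite_S)
  next
    case (2 x s)
    interpret A: scalar_extension F F' \<phi> "VObj R x" by (intro scalar_extension 2)
    show ?case
      unfolding I'_def VObj_ext by (rule A.linear_form_ext_form[OF I_form[OF 2]])
  next
    case (3 x s)
    interpret A: scalar_extension F F' \<phi> "VObj R x" by (intro scalar_extension 3)
    show ?case
      using 3 by (simp add: P'_def VObj_ext P_carrier)
  next
    case (4 x w)
    interpret A: scalar_extension F F' \<phi> "VObj R x" by (intro scalar_extension 4)
    have I': "linear_form F' A.VE (I' x s)" "\<And>v t. \<lbrakk>v \<in> carrier (VObj R x); t \<in> carrier F'\<rbrakk> \<Longrightarrow> I' x s (ten x v t) = \<phi> (I x s v) \<otimes>\<^bsub>F'\<^esub> t"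
      if "s \<in> SObj S x" for s
      unfolding I'_def using A.ext_form[OF I_form[OF 4(1) that]] by simp_all
    have I'_in: "I' x s w \<in> carrier F'" if "s \<in> SObj S x" "w \<in> carrier A.\<T>" for s w
      using I'(1)[OF that(1)] that(2) by (auto simp: linear_form_def Pi_iff)
    have P'_in: "P' x s \<in> carrier A.\<T>" if "s \<in> SObj S x" for s
      using 4 that by (simp add: P'_def P_carrier)
    have "(\<Oplus>\<^bsub>A.VE\<^esub>s\<in>SObj S x. I' x s w \<odot>\<^bsub>A.VE\<^esub> P' x s) = w"
    proof (rule A.additive_eqI[where Z = A.\<T>])
      fix w w' assume w: "w \<in> carrier A.\<T>" "w' \<in> carrier A.\<T>"
      have "(\<Oplus>\<^bsub>A.VE\<^esub>s\<in>SObj S x. I' x s (w \<oplus>\<^bsub>A.\<T>\<^esub> w') \<odot>\<^bsub>A.VE\<^esub> P' x s)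
        = (\<Oplus>\<^bsub>A.VE\<^esub>s\<in>SObj S x. I' x s w \<odot>\<^bsub>A.VE\<^esub> P' x s \<oplus>\<^bsub>A.VE\<^esub> I' x s w' \<odot>\<^bsub>A.VE\<^esub> P' x s)"
        using w I'(1) I'_in P'_in
        by (intro A.VE.M.finsum_cong') (auto simp: linear_form_def A.VE.smult_l_distr[simplified] A.smult_carrier)
      also have "\<dots> = (\<Oplus>\<^bsub>A.VE\<^esub>s\<in>SObj S x. I' x s w \<odot>\<^bsub>A.VE\<^esub> P' x s) \<oplus>\<^bsub>A.VE\<^esub> (\<Oplus>\<^bsub>A.VE\<^esub>s\<in>SObj S x. I' x s w' \<odot>\<^bsub>A.VE\<^esub> P' x s)"
        using w I'_in P'_in by (intro A.VE.M.finsum_addf) (auto simp: A.smult_carrier)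
      finally show "(\<Oplus>\<^bsub>A.VE\<^esub>s\<in>SObj S x. I' x s (w \<oplus>\<^bsub>A.\<T>\<^esub> w') \<odot>\<^bsub>A.VE\<^esub> P' x s)
        = (\<Oplus>\<^bsub>A.VE\<^esub>s\<in>SObj S x. I' x s w \<odot>\<^bsub>A.VE\<^esub> P' x s) \<oplus>\<^bsub>A.\<T>\<^esub> (\<Oplus>\<^bsub>A.VE\<^esub>s\<in>SObj S x. I' x s w' \<odot>\<^bsub>A.VE\<^esub> P' x s)"
        by simp
    next
      fix v t assume v: "v \<in> carrier (VObj R x)" and t: "t \<in> carrier F'"
      \<comment> \<open>The coefficient \<phi>(I v) t acts on the right factor of P \<otimes> 1;
        moving its part from F across the tensor sign gives (I v) P \<otimes> t.\<close>
      have "(\<Oplus>\<^bsub>A.VE\<^esub>s\<in>SObj S x. I' x s (ten x v t) \<odot>\<^bsub>A.VE\<^esub> P' x s)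
        = (\<Oplus>\<^bsub>A.VE\<^esub>s\<in>SObj S x. ten x (I x s v \<odot>\<^bsub>VObj R x\<^esub> P x s) t)"
        using v t 4(1) by (intro A.VE.M.finsum_cong')
          (auto simp: I'(2) P'_def A.smult_pure A.pure_balanced I_carrier P_carrier)
      also have "\<dots> = ten x (\<Oplus>\<^bsub>VObj R x\<^esub>s\<in>SObj S x. I x s v \<odot>\<^bsub>VObj R x\<^esub> P x s) t"
        using v t 4(1)
        by (intro additive_finsum[OF A.V.M.abelian_group_axioms A.VE.M.abelian_group_axioms, of "\<lambda>v. ten x v t", symmetric])
          (auto simp: A.pure_add_left I_carrier P_carrier)
      also have "\<dots> = ten x v t"
        using v 4(1) by (simp add: decomp)
      finally show "(\<Oplus>\<^bsub>A.VE\<^esub>s\<in>SObj S x. I' x s (ten x v t) \<odot>\<^bsub>A.VE\<^esub> P' x s) = ten x v t" .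
    qed (use 4(2) in \<open>simp_all add: VObj_ext\<close>)
    then show ?case by (simp add: VObj_ext)
  next
    case (5 f s)
    have "P (Dom X f) s \<in> carrier (VObj R (Dom X f))"
      using 5 by (simp add: P_carrier Dom_in)
    then show ?case
      using 5 by (simp add: P'_def VMor_ext_pure P_nat)
  next
    case (6 f t w)
    interpret A: scalar_extension F F' \<phi> "VObj R (Dom X f)" by (intro scalar_extension Dom_in 6)
    interpret B: scalar_extension F F' \<phi> "VObj R (Cod X f)" by (intro scalar_extension Cod_in 6)
    note L = VMor_ext[OF 6(1), unfolded VObj_ext, simplified]
    note x = Dom_in[OF 6(1)] and y = Cod_in[OF 6(1)]
    have IA: "linear_form F' A.VE (I' (Dom X f) s)" "\<And>v t. \<lbrakk>v \<in> carrier (VObj R (Dom X f)); t \<in> carrier F'\<rbrakk> \<Longrightarrow> I' (Dom X f) s (ten (Dom X f) v t) = \<phi> (I (Dom X f) s v) \<otimes>\<^bsub>F'\<^esub> t"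
      if "s \<in> SObj S (Dom X f)" for s
      unfolding I'_def using A.ext_form[OF I_form[OF x that]] by simp_all
    have IB: "linear_form F' B.VE (I' (Cod X f) s)" "\<And>v t. \<lbrakk>v \<in> carrier (VObj R (Cod X f)); t \<in> carrier F'\<rbrakk> \<Longrightarrow> I' (Cod X f) s (ten (Cod X f) v t) = \<phi> (I (Cod X f) s v) \<otimes>\<^bsub>F'\<^esub> t"
      if "s \<in> SObj S (Cod X f)" for s
      unfolding I'_def using B.ext_form[OF I_form[OF y that]] by simp_all
    have IA_in: "I' (Dom X f) s w \<in> carrier F'" if "s \<in> SObj S (Dom X f)" "w \<in> carrier A.\<T>" for s w
      using IA(1)[OF that(1)] that(2) by (auto simp: linear_form_def Pi_iff)
    show ?case
    proof (rule A.additive_eqI[where Z = F'])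
      show "w \<in> carrier A.\<T>" using 6 by (simp add: VObj_ext)
    next
      fix w w' assume w: "w \<in> carrier A.\<T>" "w' \<in> carrier A.\<T>"
      then show "I' (Cod X f) t (VMor R' f (w \<oplus>\<^bsub>A.\<T>\<^esub> w')) = I' (Cod X f) t (VMor R' f w) \<oplus>\<^bsub>F'\<^esub> I' (Cod X f) t (VMor R' f w')"
        using IB(1)[OF 6(2)] by (simp add: L linear_form_def)
      have "(\<Oplus>\<^bsub>F'\<^esub>s\<in>{s \<in> SObj S (Dom X f). SMor S f s = t}. I' (Dom X f) s (w \<oplus>\<^bsub>A.\<T>\<^esub> w'))
        = (\<Oplus>\<^bsub>F'\<^esub>s\<in>{s \<in> SObj S (Dom X f). SMor S f s = t}. I' (Dom X f) s w \<oplus>\<^bsub>F'\<^esub> I' (Dom X f) s w')"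
        using w IA(1) IA_in by (intro F'.finsum_cong') (auto simp: linear_form_def)
      also have "\<dots> = (\<Oplus>\<^bsub>F'\<^esub>s\<in>{s \<in> SObj S (Dom X f). SMor S f s = t}. I' (Dom X f) s w) \<oplus>\<^bsub>F'\<^esub>
          (\<Oplus>\<^bsub>F'\<^esub>s\<in>{s \<in> SObj S (Dom X f). SMor S f s = t}. I' (Dom X f) s w')"
        using w IA_in by (intro F'.finsum_addf) auto
      finally show "(\<Oplus>\<^bsub>F'\<^esub>s\<in>{s \<in> SObj S (Dom X f). SMor S f s = t}. I' (Dom X f) s (w \<oplus>\<^bsub>A.\<T>\<^esub> w'))
        = (\<Oplus>\<^bsub>F'\<^esub>s\<in>{s \<in> SObj S (Dom X f). SMor S f s = t}. I' (Dom X f) s w) \<oplus>\<^bsub>F'\<^esub>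
          (\<Oplus>\<^bsub>F'\<^esub>s\<in>{s \<in> SObj S (Dom X f). SMor S f s = t}. I' (Dom X f) s w')" .
    next
      fix v u assume v: "v \<in> carrier (VObj R (Dom X f))" and u: "u \<in> carrier F'"
      have "I' (Cod X f) t (VMor R' f (ten (Dom X f) v u)) = \<phi> (I (Cod X f) t (VMor R f v)) \<otimes>\<^bsub>F'\<^esub> u"
        using v u 6 by (simp add: L IB(2) VMor_carrier)
      also have "\<dots> = \<phi> (\<Oplus>\<^bsub>F\<^esub>s\<in>{s \<in> SObj S (Dom X f). SMor S f s = t}. I (Dom X f) s v) \<otimes>\<^bsub>F'\<^esub> u"
        using v 6 by (simp add: I_nat)
      also have "\<dots> = (\<Oplus>\<^bsub>F'\<^esub>s\<in>{s \<in> SObj S (Dom X f). SMor S f s = t}. \<phi> (I (Dom X f) s v) \<otimes>\<^bsub>F'\<^esub> u)"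
        using v u x
        by (intro additive_finsum[OF abelian_group_axioms F'.abelian_group_axioms, of "\<lambda>a. \<phi> a \<otimes>\<^bsub>F'\<^esub> u"])
          (auto simp: I_carrier ring_hom_add[OF hom] F'.l_distr)
      also have "\<dots> = (\<Oplus>\<^bsub>F'\<^esub>s\<in>{s \<in> SObj S (Dom X f). SMor S f s = t}. I' (Dom X f) s (ten (Dom X f) v u))"
        using v u x by (intro F'.finsum_cong') (auto simp: IA(2) I_carrier)
      finally show "I' (Cod X f) t (VMor R' f (ten (Dom X f) v u))
        = (\<Oplus>\<^bsub>F'\<^esub>s\<in>{s \<in> SObj S (Dom X f). SMor S f s = t}. I' (Dom X f) s (ten (Dom X f) v u))" .
    qed
  qed
  then show ?thesis by blast
qed

lemma splitting_descent:
  fixes S :: "('o, 'm, 's) set_functor" and F' :: "('g, 'l') ring_scheme"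
  assumes "finite (Obj X)" "rep_extension X F R F' \<phi>"
    and "set_splitting X F' (rep_ext_scalars X F F' \<phi> R) S I P"
  shows "\<exists>(S' :: ('o, 'm, 'g \<times> 's) set_functor) I' P'. set_splitting X F R S' I' P'"
proof -
  interpret rep_extension X F R F' \<phi> by fact
  interpret Q: set_splitting X F' R' S I P by fact
  define E where "E = ext_as_vs F' \<phi>"
  have E: "vectorspace F E"
    unfolding E_def by (rule ext_as_vs_vectorspace[OF field_axioms F'.field_axioms hom])
  interpret E: vectorspace F E by (rule E)
  have E_simps: "carrier E = carrier F'" "a \<oplus>\<^bsub>E\<^esub> b = a \<oplus>\<^bsub>F'\<^esub> b" "\<zero>\<^bsub>E\<^esub> = \<zero>\<^bsub>F'\<^esub>" "k \<odot>\<^bsub>E\<^esub> b = \<phi> k \<otimes>\<^bsub>F'\<^esub> b" for a b k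
    by (simp_all add: E_def ext_as_vs_def)
  obtain B l where B: "B \<subseteq> carrier E" and l: "\<And>b. b \<in> B \<Longrightarrow> linear_form F E (l b)"
    and fin: "\<And>t. t \<in> carrier E \<Longrightarrow> finite {b \<in> B. l b t \<noteq> \<zero>\<^bsub>F\<^esub>}"
    and exp: "\<And>t. t \<in> carrier E \<Longrightarrow> t = (\<Oplus>\<^bsub>E\<^esub>b\<in>{b \<in> B. l b t \<noteq> \<zero>\<^bsub>F\<^esub>}. l b t \<odot>\<^bsub>E\<^esub> b)"
    by (rule vectorspace_coordinates[OF E]) blast
  have one: "\<one>\<^bsub>F'\<^esub> \<in> carrier E" by (simp add: E_simps)
  \<comment> \<open>Since 1 is nonzero in F', some basis coordinate of it is nonzero. Rescaling that
    coordinate form yields the F-linear retraction \<pi> of \<phi>.\<close>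
  have "{b \<in> B. l b \<one>\<^bsub>F'\<^esub> \<noteq> \<zero>\<^bsub>F\<^esub>} \<noteq> {}"
  proof
    assume empty: "{b \<in> B. l b \<one>\<^bsub>F'\<^esub> \<noteq> \<zero>\<^bsub>F\<^esub>} = {}"
    have "\<one>\<^bsub>F'\<^esub> = \<zero>\<^bsub>E\<^esub>"
      using exp[OF one] unfolding empty E.M.finsum_empty .
    then show False by (simp add: E_simps)
  qed
  then obtain b0 where b0: "b0 \<in> B" "l b0 \<one>\<^bsub>F'\<^esub> \<noteq> \<zero>\<^bsub>F\<^esub>" by blast
  define \<pi> where "\<pi> t = inv\<^bsub>F\<^esub> (l b0 \<one>\<^bsub>F'\<^esub>) \<otimes>\<^bsub>F\<^esub> l b0 t" for t
  have lb0: "l b0 \<one>\<^bsub>F'\<^esub> \<in> carrier F"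
    using l[OF b0(1)] one by (auto simp: linear_form_def Pi_iff)
  have inv: "inv\<^bsub>F\<^esub> (l b0 \<one>\<^bsub>F'\<^esub>) \<in> carrier F" "inv\<^bsub>F\<^esub> (l b0 \<one>\<^bsub>F'\<^esub>) \<otimes>\<^bsub>F\<^esub> l b0 \<one>\<^bsub>F'\<^esub> = \<one>\<^bsub>F\<^esub>"
    using field_Units lb0 b0(2) by (auto intro: Units_l_inv)
  have \<pi>: "linear_form F E \<pi>" and \<pi>_one: "\<pi> \<one>\<^bsub>F'\<^esub> = \<one>\<^bsub>F\<^esub>"
    using l[OF b0(1)] inv by (auto simp: linear_form_def \<pi>_def r_distr m_lcomm Pi_iff)
  have \<pi>_in: "\<pi> t \<in> carrier F" if "t \<in> carrier F'" for t
    using \<pi> that by (auto simp: linear_form_def E_simps Pi_iff)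
  have \<pi>_add: "\<pi> (t \<oplus>\<^bsub>F'\<^esub> u) = \<pi> t \<oplus>\<^bsub>F\<^esub> \<pi> u" if "t \<in> carrier F'" "u \<in> carrier F'" for t u
    using \<pi> that by (auto simp: linear_form_def E_simps)
  have \<pi>_smult: "\<pi> (\<phi> k \<otimes>\<^bsub>F'\<^esub> t) = k \<otimes>\<^bsub>F\<^esub> \<pi> t" if "k \<in> carrier F" "t \<in> carrier F'" for k t
    using \<pi> that by (auto simp: linear_form_def E_simps)
  define slice where "slice l x = tensor_lift F (VObj R x) (ext_as_vs F' \<phi>) (VObj R x) (\<lambda>v t. l t \<odot>\<^bsub>VObj R x\<^esub> v)"
    for l x
  have "\<exists>B0. finite B0 \<and> B0 \<subseteq> B \<and> (\<forall>B'. finite B' \<longrightarrow> B0 \<subseteq> B' \<longrightarrow> B' \<subseteq> B \<longrightarrow>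
      P x s = (\<Oplus>\<^bsub>VObj R' x\<^esub>b\<in>B'. ten x (slice (l b) x (P x s)) b))"
    if x: "x \<in> Obj X" and s: "s \<in> SObj S x" for x s
  proof -
    interpret A: scalar_extension F F' \<phi> "VObj R x" by (rule scalar_extension[OF x])
    show ?thesis
      using A.basis_expansion[OF _ l[unfolded E_def] fin[unfolded E_def] exp[unfolded E_def], of "P x s"]
        B Q.P_carrier[OF x s]
      by (simp add: slice_def E_def VObj_ext A.finsum_VE)
  qed
  then have "\<forall>a\<in>Sigma (Obj X) (SObj S). \<exists>B0. finite B0 \<and> B0 \<subseteq> B \<and> (\<forall>B'. finite B' \<longrightarrow> B0 \<subseteq> B' \<longrightarrow> B' \<subseteq> B \<longrightarrow>
      P (fst a) (snd a) = (\<Oplus>\<^bsub>VObj R' (fst a)\<^esub>b\<in>B'. ten (fst a) (slice (l b) (fst a) (P (fst a) (snd a))) b))"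
    by auto
  from bchoice[OF this] obtain B0 where B0: "\<forall>a\<in>Sigma (Obj X) (SObj S). finite (B0 a) \<and> B0 a \<subseteq> B \<and>
    (\<forall>B'. finite B' \<longrightarrow> B0 a \<subseteq> B' \<longrightarrow> B' \<subseteq> B \<longrightarrow>
      P (fst a) (snd a) = (\<Oplus>\<^bsub>VObj R' (fst a)\<^esub>b\<in>B'. ten (fst a) (slice (l b) (fst a) (P (fst a) (snd a))) b))" ..
  \<comment> \<open>Finitely many pairs \<open>(x, s)\<close> occur, so this union is finite, and
    each expansion remains valid over it.\<close>
  define B1 where "B1 = (\<Union>a\<in>Sigma (Obj X) (SObj S). B0 a)"
  have B1: "finite B1" "B1 \<subseteq> B"
    using B0 assms(1) Q.finite_S by (auto simp: B1_def)
  have P_exp: "P x s = (\<Oplus>\<^bsub>VObj R' x\<^esub>b\<in>B1. ten x (slice (l b) x (P x s)) b)"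
    if "x \<in> Obj X" "s \<in> SObj S x" for x s
    using B0[rule_format, of "(x, s)", THEN conjunct2, THEN conjunct2, rule_format, of B1] B1 that
    by (auto simp: B1_def)
  have B1F: "b \<in> carrier F'" if "b \<in> B1" for b
    using B B1 that by (auto simp: E_simps)

  \<comment> \<open>\<open>B1 \<times> S\<close>, with morphisms fixing the first component; it
    becomes the set functor over F.\<close>
  define S' where "S' = set_sum B1 (\<lambda>_. S)"
  define I' where "I' x a v = \<pi> (fst a \<otimes>\<^bsub>F'\<^esub> I x (snd a) (ten x v \<one>\<^bsub>F'\<^esub>))" for x a v
  define P' where "P' x a = slice (l (fst a)) x (P x (snd a))" for x a
  have ten_in: "ten x v t \<in> carrier (VObj R' x)" if "x \<in> Obj X" "v \<in> carrier (VObj R x)" "t \<in> carrier F'" for x v t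
  proof -
    interpret A: scalar_extension F F' \<phi> "VObj R x" by (rule scalar_extension[OF that(1)])
    show ?thesis using that by (simp add: VObj_ext)
  qed
  have c_in: "I x s (ten x v \<one>\<^bsub>F'\<^esub>) \<in> carrier F'" if "x \<in> Obj X" "s \<in> SObj S x" "v \<in> carrier (VObj R x)" for x s v
    using that by (intro Q.I_carrier ten_in) auto
  have I'_in: "I' x a v \<in> carrier F" if "x \<in> Obj X" "a \<in> B1 \<times> SObj S x" "v \<in> carrier (VObj R x)" for x a v
    using that by (auto simp: I'_def \<pi>_in c_in B1F)
  have P'_in: "P' x a \<in> carrier (VObj R x)" if "x \<in> Obj X" "a \<in> B1 \<times> SObj S x" for x a
  proof -
    interpret A: scalar_extension F F' \<phi> "VObj R x" by (rule scalar_extension[OF that(1)])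
    show ?thesis
      using that B1 Q.P_carrier[OF that(1)] unfolding P'_def slice_def
      by (intro A.slice_carrier l[unfolded E_def]) (auto simp: VObj_ext)
  qed
  have "set_splitting X F R S' I' P'"
  proof (intro set_splitting.intro set_splitting_axioms.intro vect_rep_axioms, goal_cases)
    case 1
    show ?case
      unfolding S'_def by (intro set_rep_set_sum category_axioms Q.S.set_rep_axioms)
  next
    case (2 x)
    then show ?case by (auto simp: S'_def set_sum_def B1 Q.finite_S)
  next
    case (3 x a)
    interpret A: scalar_extension F F' \<phi> "VObj R x" by (rule scalar_extension[OF 3(1)])
    obtain b s where a: "a = (b, s)" "b \<in> B1" "s \<in> SObj S x"
      using 3 by (auto simp: S'_def set_sum_def)
    have bF: "b \<in> carrier F'" using B1F a by simp
    have "I' x a (v \<oplus>\<^bsub>VObj R x\<^esub> w) = I' x a v \<oplus>\<^bsub>F\<^esub> I' x a w"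
      if "v \<in> carrier (VObj R x)" "w \<in> carrier (VObj R x)" for v w
      using that Q.I_add[OF 3(1) a(3) ten_in[OF 3(1) that(1)] ten_in[OF 3(1) that(2)]] c_in[OF 3(1) a(3)] bF
      by (simp add: I'_def a A.pure_add_left VObj_ext F'.r_distr \<pi>_add)
    moreover have "I' x a (k \<odot>\<^bsub>VObj R x\<^esub> v) = k \<otimes>\<^bsub>F\<^esub> I' x a v"
      if "k \<in> carrier F" "v \<in> carrier (VObj R x)" for k v
      using that Q.I_smult[OF 3(1) a(3) _ ten_in[OF 3(1) that(2)], of "\<phi> k"] c_in[OF 3(1) a(3)] bF
        F'.m_lcomm[of b "\<phi> k" "I x s (ten x v \<one>\<^bsub>F'\<^esub>)"]
      by (simp add: I'_def a A.pure_one_smult VObj_ext \<pi>_smult)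
    ultimately show ?case
      using I'_in[OF 3(1), of a] a by (auto simp: linear_form_def)
  next
    case (4 x a)
    then show ?case by (intro P'_in) (auto simp: S'_def set_sum_def)
  next
    case (5 x v)
    interpret A: scalar_extension F F' \<phi> "VObj R x" by (rule scalar_extension[OF 5(1)])
    note sl = A.slice_carrier[OF \<pi>[unfolded E_def]] A.slice_add[OF \<pi>[unfolded E_def]] A.slice_pure[OF \<pi>[unfolded E_def]]
    let ?c = "\<lambda>s. I x s (ten x v \<one>\<^bsub>F'\<^esub>)"
    \<comment> \<open>Slicing by \<pi> is only F-linear, so the F'-scalar \<open>?c s\<close> cannot
      be pulled out. Expanding \<open>P x s\<close> over \<open>B1\<close> puts it next to the basis
      element, and the slice of each term has the F-coefficient \<pi>(b c), which is the value of
      \<open>I'\<close>.\<close>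
    have key: "slice \<pi> x (?c s \<odot>\<^bsub>A.VE\<^esub> P x s) = (\<Oplus>\<^bsub>VObj R x\<^esub>b\<in>B1. I' x (b, s) v \<odot>\<^bsub>VObj R x\<^esub> P' x (b, s))"
      if s: "s \<in> SObj S x" for s
    proof -
      have c: "?c s \<in> carrier F'" using 5 s by (simp add: c_in)
      have P'b: "P' x (b, s) \<in> carrier (VObj R x)" if "b \<in> B1" for b
        using P'_in[OF 5(1)] s that by simp
      have "slice \<pi> x (?c s \<odot>\<^bsub>A.VE\<^esub> P x s) = slice \<pi> x (?c s \<odot>\<^bsub>A.VE\<^esub> (\<Oplus>\<^bsub>A.VE\<^esub>b\<in>B1. ten x (P' x (b, s)) b))"
        using P_exp[OF 5(1) s] by (simp add: P'_def VObj_ext)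
      also have "\<dots> = (\<Oplus>\<^bsub>VObj R x\<^esub>b\<in>B1. slice \<pi> x (?c s \<odot>\<^bsub>A.VE\<^esub> ten x (P' x (b, s)) b))"
        unfolding slice_def using c P'b B1F sl
        by (intro additive_finsum[OF A.VE.M.abelian_group_axioms A.V.M.abelian_group_axioms])
          (auto simp: A.smult_carrier A.smult_add)
      also have "\<dots> = (\<Oplus>\<^bsub>VObj R x\<^esub>b\<in>B1. I' x (b, s) v \<odot>\<^bsub>VObj R x\<^esub> P' x (b, s))"
        using c P'b B1F I'_in[OF 5(1)] s 5(2)
        by (intro A.V.M.finsum_cong') (auto simp: A.smult_pure slice_def sl I'_def F'.m_comm)
      finally show ?thesis .
    qed
    have in_V: "I' x a v \<odot>\<^bsub>VObj R x\<^esub> P' x a \<in> carrier (VObj R x)" if "a \<in> B1 \<times> SObj S x" for a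
      using I'_in[OF 5(1) that 5(2)] P'_in[OF 5(1) that] by simp
    \<comment> \<open>The sum over \<open>B1 \<times> SObj S x\<close> is grouped by the second
      component, so that each group is an instance of \<open>key\<close>.\<close>
    have "(\<Oplus>\<^bsub>VObj R x\<^esub>a\<in>B1 \<times> SObj S x. I' x a v \<odot>\<^bsub>VObj R x\<^esub> P' x a)
      = (\<Oplus>\<^bsub>VObj R x\<^esub>s\<in>SObj S x. \<Oplus>\<^bsub>VObj R x\<^esub>a\<in>{a \<in> B1 \<times> SObj S x. snd a = s}. I' x a v \<odot>\<^bsub>VObj R x\<^esub> P' x a)"
      using in_V B1 Q.finite_S[OF 5(1)] by (intro A.V.M.finsum_fibres) auto
    also have "\<dots> = (\<Oplus>\<^bsub>VObj R x\<^esub>s\<in>SObj S x. slice \<pi> x (?c s \<odot>\<^bsub>A.VE\<^esub> P x s))"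
    proof (intro A.V.M.finsum_cong' refl funcsetI)
      fix s assume s: "s \<in> SObj S x"
      have "{a \<in> B1 \<times> SObj S x. snd a = s} = (\<lambda>b. (b, s)) ` B1"
        using s by auto
      moreover have "(\<Oplus>\<^bsub>VObj R x\<^esub>a\<in>(\<lambda>b. (b, s)) ` B1. I' x a v \<odot>\<^bsub>VObj R x\<^esub> P' x a)
        = (\<Oplus>\<^bsub>VObj R x\<^esub>b\<in>B1. I' x (b, s) v \<odot>\<^bsub>VObj R x\<^esub> P' x (b, s))"
        using in_V s by (intro A.V.M.finsum_reindex) (auto simp: inj_on_def)
      ultimately show "(\<Oplus>\<^bsub>VObj R x\<^esub>a\<in>{a \<in> B1 \<times> SObj S x. snd a = s}. I' x a v \<odot>\<^bsub>VObj R x\<^esub> P' x a)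
        = slice \<pi> x (?c s \<odot>\<^bsub>A.VE\<^esub> P x s)"
        using key[OF s] by simp
      show "slice \<pi> x (?c s \<odot>\<^bsub>A.VE\<^esub> P x s) \<in> carrier (VObj R x)"
        using in_V s key[OF s] by (auto intro!: A.V.M.finsum_closed)
    qed
    also have "\<dots> = slice \<pi> x (\<Oplus>\<^bsub>A.VE\<^esub>s\<in>SObj S x. ?c s \<odot>\<^bsub>A.VE\<^esub> P x s)"
      unfolding slice_def using sl 5 c_in[OF 5(1) _ 5(2)] Q.P_carrier[OF 5(1)]
      by (intro additive_finsum[OF A.VE.M.abelian_group_axioms A.V.M.abelian_group_axioms, symmetric])
        (auto simp: A.smult_carrier VObj_ext)
    \<comment> \<open>The decomposition over F' is used for the single tensor v \<otimes> 1; slicing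
      it by \<pi> returns v because \<pi> 1 = 1.\<close>
    also have "(\<Oplus>\<^bsub>A.VE\<^esub>s\<in>SObj S x. ?c s \<odot>\<^bsub>A.VE\<^esub> P x s) = ten x v \<one>\<^bsub>F'\<^esub>"
      using Q.decomp[OF 5(1) ten_in[OF 5 F'.one_closed]] by (simp add: VObj_ext)
    also have "slice \<pi> x (ten x v \<one>\<^bsub>F'\<^esub>) = v"
      using 5(2) by (simp add: slice_def sl \<pi>_one)
    finally show ?case by (simp add: S'_def set_sum_def)
  next
    case (6 f a)
    \<comment> \<open>The basis element is fixed by the morphism, so both vectors are slices by the
      same \<open>l b\<close>, and \<open>slice_nat\<close> turns the naturality of \<open>P\<close>
      into that of \<open>P'\<close>.\<close>
    then show ?case
      using B1 slice_nat[OF 6(1) l[unfolded E_def] Q.P_carrier[OF Dom_in[OF 6(1)]]]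
      by (auto simp: S'_def set_sum_def P'_def slice_def Q.P_nat[symmetric])
  next
    case (7 f a v)
    obtain b t where a: "a = (b, t)" "b \<in> B1" "t \<in> SObj S (Cod X f)"
      using 7 by (auto simp: S'_def set_sum_def)
    note x = Dom_in[OF 7(1)]
    have bF: "b \<in> carrier F'" using B1F a by simp
    \<comment> \<open>The fibre over \<open>(b, t)\<close> has the single first component
      \<open>b\<close>, so the fibre sum for \<open>I\<close> passes through multiplication by
      \<open>b\<close> and \<pi>, which are additive.\<close>
    have eq: "{a' \<in> SObj S' (Dom X f). SMor S' f a' = a} = Pair b ` {s \<in> SObj S (Dom X f). SMor S f s = t}"
      using a by (auto simp: S'_def set_sum_def)
    have "I' (Cod X f) a (VMor R f v) = \<pi> (b \<otimes>\<^bsub>F'\<^esub> I (Cod X f) t (VMor R' f (ten (Dom X f) v \<one>\<^bsub>F'\<^esub>)))"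
      using 7 by (simp add: I'_def a VMor_ext_pure)
    also have "\<dots> = \<pi> (b \<otimes>\<^bsub>F'\<^esub> (\<Oplus>\<^bsub>F'\<^esub>s\<in>{s \<in> SObj S (Dom X f). SMor S f s = t}. I (Dom X f) s (ten (Dom X f) v \<one>\<^bsub>F'\<^esub>)))"
      using 7 a x by (simp add: Q.I_nat ten_in)
    also have "\<dots> = (\<Oplus>\<^bsub>F\<^esub>s\<in>{s \<in> SObj S (Dom X f). SMor S f s = t}. I' (Dom X f) (b, s) v)"
      unfolding I'_def fst_conv snd_conv using 7 x bF
      by (intro additive_finsum[OF F'.abelian_group_axioms abelian_group_axioms])
        (auto simp: \<pi>_in \<pi>_add c_in F'.r_distr)
    also have "\<dots> = (\<Oplus>\<^bsub>F\<^esub>a'\<in>Pair b ` {s \<in> SObj S (Dom X f). SMor S f s = t}. I' (Dom X f) a' v)"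
      using 7 x a by (intro finsum_reindex[symmetric]) (auto simp: inj_on_def intro!: I'_in)
    finally show ?case unfolding eq .
  qed
  then show ?thesis by blast
qed

theorem theorem3p14:
  fixes X :: "('o, 'm) category"
    and F :: "('f, 'l) ring_scheme"
    and F' :: "('g, 'l') ring_scheme"
    and \<phi> :: "'f \<Rightarrow> 'g"
    and R :: "('o, 'm, 'f, 'v) vect_functor"
  assumes "finite_category X"
    and "field F"
    and "field F'"
    and "\<phi> \<in> ring_hom F F'"
    and "fin_dim_vect_rep X F R"
    and "infinite (UNIV :: 's set)"
    and "infinite (UNIV :: 't set)"
  shows "additively_set_realizable TYPE('s) X F R \<longleftrightarrow>
         additively_set_realizable TYPE('t) X F' (rep_ext_scalars X F F' \<phi> R)"
proof
  interpret finite_category X by fact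
  interpret R: fin_dim_vect_rep X F R by fact
  have ext: "rep_extension X F R F' \<phi>"
    using assms by (simp add: rep_extension_def rep_extension_axioms_def R.vect_rep_axioms)
  then interpret rep_extension X F R F' \<phi> .
  show "additively_set_realizable TYPE('t) X F' R'" if real: "additively_set_realizable TYPE('s) X F R"
  proof -
    obtain S :: "('o, 'm, nat \<times> 's) set_functor" and I P where "set_splitting X F R S I P"
      using realizable_imp_splitting[OF assms(1,5) real] by blast
    then obtain I' P' where "set_splitting X F' R' S I' P'"
      using splitting_ext_scalars[OF _ ext] by blast
    then show ?thesis
      using finite_Obj assms(7) by (rule set_splitting.realizable)
  qed
  show "additively_set_realizable TYPE('s) X F R" if real: "additively_set_realizable TYPE('t) X F' R'"
  proof -
    \<comment> \<open>Needed over F' because the reduction to a finite subfunctor starts from finite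
      spanning sets of the representation being split.\<close>
    have "fin_dim_vect_rep X F' R'"
    proof (intro fin_dim_vect_rep.intro fin_dim_vect_rep_axioms.intro ext.vect_rep_axioms)
      fix x assume x: "x \<in> Obj X"
      interpret A: scalar_extension F F' \<phi> "VObj R x" by (rule scalar_extension[OF x])
      show "vectorspace.fin_dim F' (VObj R' x)"
        unfolding VObj_ext by (rule A.ext_fin_dim[OF R.VObj_fin_dim[OF x]])
    qed
    then obtain S :: "('o, 'm, nat \<times> 't) set_functor" and I P where "set_splitting X F' R' S I P"
      using realizable_imp_splitting[OF assms(1) _ real] by blast
    \<comment> \<open>An element now carries a basis element in F', a summand index and an element
      of the original set. As all values are finite, \<open>realizable\<close> can replace this type
      by \<open>'s\<close>.\<close>
    then obtain S' :: "('o, 'm, 'g \<times> nat \<times> 't) set_functor" and I' P' where "set_splitting X F R S' I' P'"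
      using splitting_descent[OF finite_Obj ext] by blast
    then show ?thesis
      using finite_Obj assms(6) by (rule set_splitting.realizable)
  qed
qed

end
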